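(* Let $n\ge1$, $1<p<\infty$, $s>0$, and let $\alpha\in\mathbb{N}_0^n$ be a multi-index with $0\le|\alpha|<s$. Then there exist constants $0<c\le C<\infty$, independent of $E$ and $\delta$, such that for all $E>0$ and $0<\delta<E$ $$c\,E^{|\alpha|/s}\delta^{1-|\alpha|/s}\;\le\;\inf_{\substack{\mathcal{A}:L^p\to L^p\\ \mathcal{A}(0)=0}}\ \sup_{\substack{\|f\|_{H^{s,p}}\le E\\ \|f-f_\delta\|_{L^p}\le\delta}}\|\partial^\alpha f-\mathcal{A}(f_\delta)\|_{L^p}\;\le\;C\,E^{|\alpha|/s}\delta^{1-|\alpha|/s}.$$ Here the infimum is over arbitrary maps $\mathcal{A}:L^p(\mathbb{R}^n)\to L^p(\mathbb{R}^n)$ with $\mathcal{A}(0)=0$, and the supremum is over all pairs $f\in H^{s,p}(\mathbb{R}^n)$, $f_\delta\in L^p(\mathbb{R}^n)$ satisfying the indicated constraints.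
   Context: $H^{s,p}(\mathbb{R}^n)$ is the Bessel potential space of all tempered distributions $f$ with $\mathcal{F}^{-1}((1+|\xi|^2)^{s/2}\widehat f)\in L^p(\mathbb{R}^n)$, with norm $\|f\|_{H^{s,p}}=\|\mathcal{F}^{-1}((1+|\xi|^2)^{s/2}\widehat f)\|_{L^p}$, where $\widehat f(\xi)=(2\pi)^{-n/2}\int_{\mathbb{R}^n}f(x)e^{-ix\cdot\xi}\,dx$ and $\mathcal{F}^{-1}$ is the inverse Fourier transform. *)

theory Defs
  imports "HOL-Analysis.Analysis"
begin

type_synonym 'n cfun = "real ^ 'n \<Rightarrow> complex"

section \<open>Partial derivatives and multi-indices\<close>

definition partial :: "'n::finite \<Rightarrow> 'n cfun \<Rightarrow> 'n cfun" where
  "partial i f x = vector_derivative (\<lambda>t. f (x + t *\<^sub>R axis i 1)) (at 0)"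

definition iter_partial :: "'n::finite list \<Rightarrow> 'n cfun \<Rightarrow> 'n cfun" where
  "iter_partial ds f = foldr partial ds f"

definition mi_size :: "nat ^ 'n::finite \<Rightarrow> nat" where
  "mi_size \<alpha> = (\<Sum>i\<in>UNIV. \<alpha> $ i)"

text \<open>A list of directions in which each \<open>i\<close> occurs \<open>\<alpha> $ i\<close> times. Which one is chosen is
  irrelevant: partial derivatives of smooth functions commute.\<close>

definition mi_dirs :: "nat ^ 'n::finite \<Rightarrow> 'n list" where
  "mi_dirs \<alpha> = (SOME ds. \<forall>i. count_list ds i = \<alpha> $ i)"

definition mi_partial :: "nat ^ 'n::finite \<Rightarrow> 'n cfun \<Rightarrow> 'n cfun" where
  "mi_partial \<alpha> f = iter_partial (mi_dirs \<alpha>) f"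

section \<open>Schwartz space and tempered distributions\<close>

text \<open>Derivatives of arbitrary order are indexed here by lists of directions, so that each
  multi-index is covered in every order of differentiation. Differentiability of all iterated
  partial derivatives is the same as being infinitely differentiable.\<close>

definition smooth :: "'n::finite cfun \<Rightarrow> bool" where
  "smooth f \<longleftrightarrow> (\<forall>ds x. iter_partial ds f differentiable (at x))"

definition schwartz :: "'n::finite cfun set" where
  "schwartz = {\<phi>. smooth \<phi> \<and>
     (\<forall>k ds. bounded (range (\<lambda>x. (1 + norm x) ^ k *\<^sub>R iter_partial ds \<phi> x)))}"

definition schwartz_seminorm :: "nat \<Rightarrow> 'n::finite list \<Rightarrow> 'n cfun \<Rightarrow> real" where
  "schwartz_seminorm k ds \<phi> = (SUP x. (1 + norm x) ^ k * norm (iter_partial ds \<phi> x))"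

definition schwartz_topology :: "'n::finite cfun topology" where
  "schwartz_topology = topology_generated_by
     {{\<psi> \<in> schwartz. schwartz_seminorm k ds (\<lambda>x. \<psi> x - \<phi> x) < \<epsilon>} | k ds \<phi> \<epsilon>.
        \<phi> \<in> schwartz \<and> \<epsilon> > 0}"

text \<open>A distribution is a functional on \<^const>\<open>schwartz\<close>; since functions are total, its values
  at other arguments are arbitrary and are never used.\<close>

type_synonym 'n distr = "'n cfun \<Rightarrow> complex"

definition tempered :: "'n::finite distr \<Rightarrow> bool" where
  "tempered u \<longleftrightarrow>
     (\<forall>\<phi>\<in>schwartz. \<forall>\<psi>\<in>schwartz. \<forall>a b. u (\<lambda>x. a * \<phi> x + b * \<psi> x) = a * u \<phi> + b * u \<psi>) \<and>
     continuous_map schwartz_topology euclidean u"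

definition distr_of :: "'n::finite cfun \<Rightarrow> 'n distr" where
  "distr_of g = (\<lambda>\<phi>. LINT x|lborel. g x * \<phi> x)"

definition distr_diff :: "'n::finite distr \<Rightarrow> 'n distr \<Rightarrow> 'n distr" where
  "distr_diff u v = (\<lambda>\<phi>. u \<phi> - v \<phi>)"

definition distr_partial :: "nat ^ 'n::finite \<Rightarrow> 'n distr \<Rightarrow> 'n distr" where
  "distr_partial \<alpha> u = (\<lambda>\<phi>. (-1) ^ mi_size \<alpha> * u (mi_partial \<alpha> \<phi>))"

definition distr_mult :: "'n::finite cfun \<Rightarrow> 'n distr \<Rightarrow> 'n distr" where
  "distr_mult m u = (\<lambda>\<phi>. u (\<lambda>\<xi>. m \<xi> * \<phi> \<xi>))"

section \<open>Fourier transform\<close>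

definition fourier :: "'n::finite cfun \<Rightarrow> 'n cfun" where
  "fourier f \<xi> = complex_of_real ((2 * pi) powr (- real CARD('n) / 2)) *
     (LINT x|lborel. f x * exp (- \<i> * complex_of_real (x \<bullet> \<xi>)))"

definition inv_fourier :: "'n::finite cfun \<Rightarrow> 'n cfun" where
  "inv_fourier f x = complex_of_real ((2 * pi) powr (- real CARD('n) / 2)) *
     (LINT \<xi>|lborel. f \<xi> * exp (\<i> * complex_of_real (x \<bullet> \<xi>)))"

definition distr_fourier :: "'n::finite distr \<Rightarrow> 'n distr" where
  "distr_fourier u = (\<lambda>\<phi>. u (fourier \<phi>))"

definition distr_inv_fourier :: "'n::finite distr \<Rightarrow> 'n distr" where
  "distr_inv_fourier u = (\<lambda>\<phi>. u (inv_fourier \<phi>))"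

section \<open>Lebesgue spaces\<close>

text \<open>Elements of \<open>L\<^sup>p\<close> are given by Borel representatives; every Lebesgue measurable function
  agrees almost everywhere with a Borel one.\<close>

definition Lp :: "real \<Rightarrow> 'n::finite cfun set" where
  "Lp p = {g. g \<in> borel_measurable lborel \<and> integrable lborel (\<lambda>x. norm (g x) powr p)}"

definition Lp_norm :: "real \<Rightarrow> 'n::finite cfun \<Rightarrow> real" where
  "Lp_norm p g = (LINT x|lborel. norm (g x) powr p) powr (1 / p)"

text \<open>Maps between spaces of equivalence classes, expressed on representatives.\<close>

definition Lp_maps :: "real \<Rightarrow> ('n::finite cfun \<Rightarrow> 'n cfun) set" where
  "Lp_maps p = {A. (\<forall>g\<in>Lp p. A g \<in> Lp p) \<and>
     (\<forall>g\<in>Lp p. \<forall>h\<in>Lp p. (AE x in lborel. g x = h x) \<longrightarrow> (AE x in lborel. A g x = A h x))}"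

text \<open>The \<open>L\<^sup>p\<close> norm of a tempered distribution, infinite if the distribution is not in \<open>L\<^sup>p\<close>.
  A representing function is unique up to null sets, so the infimum is over at most one value;
  the infimum of the empty set is \<open>\<infinity>\<close>.\<close>

definition represents :: "'n::finite cfun \<Rightarrow> 'n distr \<Rightarrow> bool" where
  "represents g u \<longleftrightarrow> (\<forall>\<phi>\<in>schwartz. u \<phi> = distr_of g \<phi>)"

definition distr_Lp_norm :: "real \<Rightarrow> 'n::finite distr \<Rightarrow> ennreal" where
  "distr_Lp_norm p u = (INF g\<in>{g \<in> Lp p. represents g u}. ennreal (Lp_norm p g))"

section \<open>Bessel potential spaces\<close>

definition bessel_op :: "real \<Rightarrow> 'n::finite distr \<Rightarrow> 'n distr" where
  "bessel_op s u = distr_inv_fourier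
     (distr_mult (\<lambda>\<xi>. complex_of_real ((1 + (norm \<xi>)\<^sup>2) powr (s / 2))) (distr_fourier u))"

definition bessel_space :: "real \<Rightarrow> real \<Rightarrow> 'n::finite distr set" where
  "bessel_space s p = {u. tempered u \<and> (\<exists>g\<in>Lp p. represents g (bessel_op s u))}"

definition bessel_norm :: "real \<Rightarrow> real \<Rightarrow> 'n::finite distr \<Rightarrow> ennreal" where
  "bessel_norm s p u = distr_Lp_norm p (bessel_op s u)"

end

(* The symbol of the derivative is split at frequency scale 1/h, h = (delta/E)^(1/s), as
     (-i xi)^alpha = a(xi) + (1 + |xi|^2)^(s/2) b(xi),
   where a and b are symbols of convolutions with integrable kernels of mass O(h^(-|alpha|)) and
   O(h^(s-|alpha|)). Taking the operator with symbol a as reconstruction, the error is the sum of a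
   applied to the data noise and b applied to the Bessel derivative of f. The splitting comes from
   the resolvent symbol Z = (1 - h^2) / (1 + h^2|xi|^2), for which
   1 - Z = h^2 (1 + |xi|^2) / (1 + h^2|xi|^2): resolvent kernels are Gamma integrals of
   Gaussians, and (1 - Z)^t is bounded uniformly in h since its binomial series converges absolutely.

   For the lower bound the data are 0. A bump of width h and suitable height is admissible, since
   h^s (1 + |xi|^2)^(s/2) = (1 - Z)^(s/2) (1 + h^2|xi|^2)^(s/2) reduces its Bessel norm to that
   of the unscaled bump; its derivative is tested against a Gaussian of width h. *)

theory Submission
  imports Defs "HOL-Probability.Probability"
begin

section \<open>Schwartz functions\<close>

text \<open>Every operator stays within convolutions by an integrable kernel plus a Dirac multiple.
  These are bounded on L^p by the mass of the kernel, for all p at once, so no multiplier theorem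
  tied to 1 < p < infinity enters, and the dependence on h is read off the mass. The price is that
  each symbol must come from an integrable kernel: resolvents replace sharp frequency cut-offs, and
  |alpha| < s must be strict, because the mass bound for the derivative symbol times a resolvent of
  order s/2 contains Gamma ((s - |alpha|)/2). The exponents meet because h^s = delta/E balances the
  two errors, and delta < E is what gives h < 1. Distributions are handled by transposition. f is
  only applied to Schwartz functions written as Fourier transforms, so symbols act on the test
  function; besides having an integrable kernel they must therefore preserve the Schwartz class. In
  the lower bound, A(0) = 0 makes the reconstruction vanish on zero data, so the error is the full
  derivative of f.\<close>

lemma partial_eq:
  assumes "(f has_derivative D) (at x)"
  shows "partial i f x = D (axis i 1)"
proof -
  have "((\<lambda>t. f (x + t *\<^sub>R axis i 1)) has_derivative (\<lambda>t. D (t *\<^sub>R axis i 1))) (at 0)"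
    by (rule has_derivative_compose[where f = "\<lambda>t. x + t *\<^sub>R axis i 1" and g = f, simplified])
       (auto intro!: derivative_eq_intros assms)
  moreover have "D (t *\<^sub>R axis i 1) = t *\<^sub>R D (axis i 1)" for t
    using assms by (intro linear_scale has_derivative_linear)
  ultimately have "((\<lambda>t. f (x + t *\<^sub>R axis i 1)) has_vector_derivative D (axis i 1)) (at 0)"
    by (simp add: has_vector_derivative_def)
  thus ?thesis
    unfolding partial_def by (rule vector_derivative_at)
qed

lemma has_derivative_partial:
  assumes "f differentiable (at x)"
  obtains D where "(f has_derivative D) (at x)" "\<And>i. partial i f x = D (axis i 1)"
  using assms partial_eq unfolding differentiable_def by blast

lemma partial_add:
  assumes "f differentiable (at x)" "g differentiable (at x)"
  shows "partial i (\<lambda>x. f x + g x) x = partial i f x + partial i g x"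
proof -
  obtain D E where *: "(f has_derivative D) (at x)" "(g has_derivative E) (at x)"
    "partial i f x = D (axis i 1)" "partial i g x = E (axis i 1)"
    using assms by (meson has_derivative_partial)
  show ?thesis
    using partial_eq[OF has_derivative_add[OF *(1,2)], of i] *(3,4) by simp
qed

lemma partial_mult:
  assumes "f differentiable (at x)" "g differentiable (at x)"
  shows "partial i (\<lambda>x. f x * g x) x = partial i f x * g x + f x * partial i g x"
proof -
  obtain D E where *: "(f has_derivative D) (at x)" "(g has_derivative E) (at x)"
    "partial i f x = D (axis i 1)" "partial i g x = E (axis i 1)"
    using assms by (meson has_derivative_partial)
  show ?thesis
    using partial_eq[OF has_derivative_mult[OF *(1,2)], of i] *(3,4) by simp
qed

text \<open>Rapid decrease of the function alone. Derivatives are left to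
  \<open>schwartz_coinduct\<close>, so the estimates need not mention
  \<open>iter_partial\<close>.\<close>

definition decays :: "'n::finite cfun \<Rightarrow> bool" where
  "decays \<phi> \<longleftrightarrow> (\<forall>k. \<exists>B. \<forall>x. (1 + norm x) ^ k * norm (\<phi> x) \<le> B)"

lemma bounded_decay_iff:
  "bounded (range (\<lambda>x. (1 + norm x) ^ k *\<^sub>R f x)) \<longleftrightarrow> (\<exists>B. \<forall>x. (1 + norm x) ^ k * norm (f x) \<le> B)"
  for f :: "'n::finite cfun"
  by (auto simp: bounded_iff)

text \<open>Iterated derivatives never leave an invariant set, so smoothness and all seminorm bounds
  reduce to statements about single members of that set. The closure properties below exhibit such a
  set or reduce to one that does.\<close>

lemma schwartz_coinduct:
  assumes "\<phi> \<in> X"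
    and "\<And>\<phi> x. \<phi> \<in> X \<Longrightarrow> \<phi> differentiable (at x)"
    and "\<And>\<phi> i. \<phi> \<in> X \<Longrightarrow> partial i \<phi> \<in> X"
    and "\<And>\<phi>. \<phi> \<in> X \<Longrightarrow> decays \<phi>"
  shows "\<phi> \<in> schwartz"
proof -
  have "iter_partial ds \<phi> \<in> X" for ds
    by (induction ds) (auto simp: iter_partial_def assms(1,3))
  thus ?thesis
    using assms(2,4) unfolding schwartz_def smooth_def decays_def bounded_decay_iff by blast
qed

lemma schwartz_differentiable: "\<phi> \<in> schwartz \<Longrightarrow> \<phi> differentiable (at x)"
  unfolding schwartz_def smooth_def iter_partial_def
  by simp (metis comp_id foldr.simps(1) id_apply)

lemma schwartz_decays: "\<phi> \<in> schwartz \<Longrightarrow> decays \<phi>"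
  unfolding schwartz_def decays_def bounded_decay_iff iter_partial_def
  by simp (metis foldr.simps(1) id_apply)

lemma schwartz_partial:
  assumes "\<phi> \<in> schwartz"
  shows "partial i \<phi> \<in> schwartz"
proof -
  \<comment> \<open>\<open>foldr\<close> applies the head of the list last, so the innermost
    derivative is the last entry.\<close>
  have "iter_partial ds (partial i \<phi>) = iter_partial (ds @ [i]) \<phi>" for ds
    by (simp add: iter_partial_def)
  thus ?thesis
    using assms unfolding schwartz_def smooth_def by simp
qed

lemma schwartz_iter_partial: "\<phi> \<in> schwartz \<Longrightarrow> iter_partial ds \<phi> \<in> schwartz"
  by (induction ds) (auto simp: iter_partial_def schwartz_partial)

lemma schwartz_continuous: "\<phi> \<in> schwartz \<Longrightarrow> continuous_on A \<phi>"
  using schwartz_differentiable differentiable_imp_continuous_on differentiable_on_def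
  by (metis differentiable_at_withinI)

lemma schwartz_measurable [measurable_dest]: "\<phi> \<in> schwartz \<Longrightarrow> \<phi> \<in> borel_measurable borel"
  by (intro borel_measurable_continuous_onI schwartz_continuous)

lemma decays_add:
  assumes "decays \<phi>" "decays \<psi>"
  shows "decays (\<lambda>x. \<phi> x + \<psi> x)"
  unfolding decays_def
proof
  fix k
  obtain B C where B: "\<And>x. (1 + norm x) ^ k * norm (\<phi> x) \<le> B"
    and C: "\<And>x. (1 + norm x) ^ k * norm (\<psi> x) \<le> C"
    using assms unfolding decays_def by metis
  have "(1 + norm x) ^ k * norm (\<phi> x + \<psi> x) \<le> B + C" for x
  proof -
    have "(1 + norm x) ^ k * norm (\<phi> x + \<psi> x) \<le> (1 + norm x) ^ k * (norm (\<phi> x) + norm (\<psi> x))"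
      by (intro mult_left_mono norm_triangle_ineq) auto
    also have "\<dots> \<le> B + C"
      using B[of x] C[of x] by (simp add: algebra_simps)
    finally show ?thesis .
  qed
  thus "\<exists>B. \<forall>x. (1 + norm x) ^ k * norm (\<phi> x + \<psi> x) \<le> B"
    by blast
qed

lemma decays_mult_poly:
  assumes "decays \<phi>" and m: "\<And>x. norm (m x) \<le> C * (1 + norm x) ^ j"
  shows "decays (\<lambda>x. m x * \<phi> x)"
  unfolding decays_def
proof
  fix k
  obtain B where B: "\<And>x. (1 + norm x) ^ (k + j) * norm (\<phi> x) \<le> B"
    using assms unfolding decays_def by metis
  have C: "C \<ge> 0"
    using m[of 0] by simp (meson norm_ge_zero order_trans)
  have "(1 + norm x) ^ k * norm (m x * \<phi> x) \<le> C * B" for x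
  proof -
    have "(1 + norm x) ^ k * norm (m x * \<phi> x) \<le> (1 + norm x) ^ k * ((C * (1 + norm x) ^ j) * norm (\<phi> x))"
      unfolding norm_mult by (intro mult_left_mono mult_right_mono m) auto
    also have "\<dots> = C * ((1 + norm x) ^ (k + j) * norm (\<phi> x))"
      by (simp add: power_add)
    also have "\<dots> \<le> C * B"
      by (intro mult_left_mono B C)
    finally show ?thesis .
  qed
  thus "\<exists>B. \<forall>x. (1 + norm x) ^ k * norm (m x * \<phi> x) \<le> B"
    by blast
qed

lemma schwartz_add:
  assumes "\<phi> \<in> schwartz" "\<psi> \<in> schwartz"
  shows "(\<lambda>x. \<phi> x + \<psi> x) \<in> schwartz"
proof (rule schwartz_coinduct[where X = "{\<lambda>x. \<phi> x + \<psi> x | \<phi> \<psi>. \<phi> \<in> schwartz \<and> \<psi> \<in> schwartz}"])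
  fix u i assume "u \<in> {\<lambda>x. \<phi> x + \<psi> x | \<phi> \<psi>. \<phi> \<in> schwartz \<and> \<psi> \<in> (schwartz :: 'a cfun set)}"
  then obtain \<phi> \<psi> where *: "u = (\<lambda>x. \<phi> x + \<psi> x)" "\<phi> \<in> schwartz" "\<psi> \<in> schwartz"
    by auto
  have "partial i u = (\<lambda>x. partial i \<phi> x + partial i \<psi> x)"
    unfolding * using *(2,3) by (auto simp: partial_add schwartz_differentiable)
  thus "partial i u \<in> {\<lambda>x. \<phi> x + \<psi> x | \<phi> \<psi>. \<phi> \<in> schwartz \<and> \<psi> \<in> schwartz}"
    using *(2,3) schwartz_partial by blast
qed (use assms in \<open>auto intro!: decays_add[OF schwartz_decays schwartz_decays] simp: schwartz_differentiable\<close>)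

text \<open>The invariant set for \<open>schwartz_coinduct\<close>. Sums are included because the
  product rule produces two terms.\<close>

inductive_set mult_closure :: "('i \<Rightarrow> 'n::finite cfun) \<Rightarrow> 'n cfun set" for m where
  base: "\<phi> \<in> schwartz \<Longrightarrow> (\<lambda>x. m i x * \<phi> x) \<in> mult_closure m"
| add: "u \<in> mult_closure m \<Longrightarrow> v \<in> mult_closure m \<Longrightarrow> (\<lambda>x. u x + v x) \<in> mult_closure m"

text \<open>A family of functions of polynomial growth acts on Schwartz functions by multiplication as
  soon as the partial derivatives of its members stay in its span over the Schwartz functions.\<close>

lemma schwartz_mult_family:
  fixes m :: "'i \<Rightarrow> 'n::finite cfun"
  assumes diff: "\<And>i x. m i differentiable (at x)"
    and growth: "\<And>i. \<exists>C j. \<forall>x. norm (m i x) \<le> C * (1 + norm x) ^ j"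
    and part: "\<And>i j \<phi>. \<phi> \<in> schwartz \<Longrightarrow> (\<lambda>x. partial j (m i) x * \<phi> x) \<in> mult_closure m"
    and "\<phi> \<in> schwartz"
  shows "(\<lambda>x. m i x * \<phi> x) \<in> schwartz"
proof (rule schwartz_coinduct[where X = "mult_closure m"])
  fix \<psi> x assume "\<psi> \<in> mult_closure m"
  then show "\<psi> differentiable (at x)"
    by induction (auto simp: diff schwartz_differentiable)
next
  fix \<psi> assume "\<psi> \<in> mult_closure m"
  then show "decays \<psi>"
  proof induction
    case (base \<phi> i)
    obtain C j where "\<And>x. norm (m i x) \<le> C * (1 + norm x) ^ j"
      using growth by blast
    then show ?case
      using base by (intro decays_mult_poly schwartz_decays)
  qed (auto intro: decays_add)
next
  fix \<psi> j assume \<psi>: "\<psi> \<in> mult_closure m"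
  have d: "\<psi> differentiable (at x)" if "\<psi> \<in> mult_closure m" for \<psi> x
    using that by induction (auto simp: diff schwartz_differentiable)
  show "partial j \<psi> \<in> mult_closure m"
    using \<psi>
  proof induction
    case (base \<phi> i)
    have "partial j (\<lambda>x. m i x * \<phi> x) = (\<lambda>x. partial j (m i) x * \<phi> x + m i x * partial j \<phi> x)"
      using base by (auto simp: partial_mult diff schwartz_differentiable)
    then show ?case
      using part[OF base] base by (auto intro!: mult_closure.intros schwartz_partial)
  next
    case (add u v)
    have "partial j (\<lambda>x. u x + v x) = (\<lambda>x. partial j u x + partial j v x)"
      using add d by (auto simp: partial_add)
    then show ?case
      using add by (auto intro!: mult_closure.add)
  qed
qed (use assms(4) in \<open>auto intro: mult_closure.base\<close>)

lemma partial_const [simp]: "partial i (\<lambda>x. c) x = 0"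
  using partial_eq[OF has_derivative_const[of c "at x"]] by simp

lemma schwartz_cmult:
  assumes "\<phi> \<in> schwartz"
  shows "(\<lambda>x. c * \<phi> x) \<in> schwartz"
proof (rule schwartz_mult_family[where m = "\<lambda>c x. c"])
  fix c :: complex
  show "\<exists>C j. \<forall>x :: real^'a. norm c \<le> C * (1 + norm x) ^ j"
    by (rule exI[of _ "norm c"], rule exI[of _ 0]) auto
  fix \<phi> :: "'a cfun" and j assume "\<phi> \<in> schwartz"
  show "(\<lambda>x. partial j (\<lambda>x. c) x * \<phi> x) \<in> mult_closure (\<lambda>c x. c)"
    using mult_closure.base[OF \<open>\<phi> \<in> schwartz\<close>, of "\<lambda>c x. c" 0] by simp
qed (use assms in auto)

lemma schwartz_minus:
  "\<phi> \<in> schwartz \<Longrightarrow> \<psi> \<in> schwartz \<Longrightarrow> (\<lambda>x. \<phi> x - \<psi> x) \<in> schwartz"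
  using schwartz_add[of \<phi> "\<lambda>x. (-1) * \<psi> x"] schwartz_cmult[of \<psi> "-1"] by simp

lemma has_derivative_coord:
  "((\<lambda>x. complex_of_real (x $ i)) has_derivative (\<lambda>h. complex_of_real (h $ i))) (at x)"
  by (intro bounded_linear_imp_has_derivative bounded_linear_compose[OF bounded_linear_of_real]
            bounded_linear_vec_nth)

lemma partial_coord: "partial j (\<lambda>x. complex_of_real (x $ i)) x = (if i = j then 1 else 0)"
  by (subst partial_eq[OF has_derivative_coord]) (auto simp: axis_def)

lemma schwartz_coord_mult:
  assumes "\<phi> \<in> schwartz"
  shows "(\<lambda>x. complex_of_real (x $ i) * \<phi> x) \<in> schwartz"
proof -
  \<comment> \<open>Adjoining the constant 1 closes the coordinates under differentiation; a
    vanishing derivative is represented by the zero Schwartz coefficient.\<close>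
  define m :: "'a option \<Rightarrow> 'a cfun" where
    "m = (\<lambda>i x. case i of None \<Rightarrow> 1 | Some i \<Rightarrow> complex_of_real (x $ i))"
  have m: "m None = (\<lambda>_. 1)" "m (Some i) = (\<lambda>x. complex_of_real (x $ i))" for i
    by (auto simp: m_def)
  have "(\<lambda>x. m (Some i) x * \<phi> x) \<in> schwartz"
  proof (rule schwartz_mult_family)
    fix k x
    show "m k differentiable (at x)"
      by (cases k) (auto simp: m intro: differentiableI has_derivative_coord)
    have "norm (m k x) \<le> 1 * (1 + norm x) ^ 1" for x
      by (cases k) (auto simp: m intro: order_trans[OF component_le_norm_cart])
    thus "\<exists>C j. \<forall>x. norm (m k x) \<le> C * (1 + norm x) ^ j"
      by blast
    fix \<phi> :: "'a cfun" and j assume \<phi>: "\<phi> \<in> schwartz"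
    show "(\<lambda>x. partial j (m k) x * \<phi> x) \<in> mult_closure m"
      using mult_closure.base[OF \<phi>, of m None] mult_closure.base[OF schwartz_cmult[OF \<phi>, of 0], of m None]
      by (cases k) (auto simp: m partial_coord)
  qed fact
  thus ?thesis by (simp add: m)
qed

text \<open>All exponents form one family: differentiation lowers the exponent by one and leaves a
  coordinate, which goes into the Schwartz factor. Since c > 0 the base stays away from 0, so real
  powers cause no singularity.\<close>

lemma schwartz_powr_mult:
  fixes \<phi> :: "'n::finite cfun"
  assumes "\<phi> \<in> schwartz" and cd: "c > 0" "d > 0"
  shows "(\<lambda>x. complex_of_real ((c + d * (norm x)\<^sup>2) powr \<sigma>) * \<phi> x) \<in> schwartz"
proof (rule schwartz_mult_family[where m = "\<lambda>\<sigma> x. complex_of_real ((c + d * (norm x)\<^sup>2) powr \<sigma>)"])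
  have pos: "c + d * (norm x)\<^sup>2 > 0" for x :: "real^'n"
    using cd by (intro add_pos_nonneg) auto
  have D: "((\<lambda>x. complex_of_real ((c + d * (norm x)\<^sup>2) powr \<sigma>)) has_derivative
      (\<lambda>h. complex_of_real (2 * d * \<sigma> * (x \<bullet> h) * (c + d * (norm x)\<^sup>2) powr (\<sigma> - 1)))) (at x)" 
    for \<sigma> and x :: "real^'n"
  proof -
    have "((\<lambda>x. (c + d * (x \<bullet> x)) powr \<sigma>) has_derivative
      (\<lambda>h. (2 * d * \<sigma> * (x \<bullet> h) * (c + d * (norm x)\<^sup>2) powr (\<sigma> - 1)))) (at x)"
      using pos[of x]
      by (auto intro!: derivative_eq_intros simp: power2_norm_eq_inner inner_commute powr_diff field_simps)
    thus ?thesis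
      unfolding power2_norm_eq_inner[symmetric] by (intro has_derivative_of_real)
  qed
  fix \<sigma>
  show "(\<lambda>x. complex_of_real ((c + d * (norm x)\<^sup>2) powr \<sigma>)) differentiable (at x)" for x :: "real^'n"
    using D by (rule differentiableI)
  show "\<exists>C j. \<forall>x :: real^'n. norm (complex_of_real ((c + d * (norm x)\<^sup>2) powr \<sigma>)) \<le> C * (1 + norm x) ^ j"
  proof (cases "\<sigma> \<ge> 0")
    case True
    define j where "j = nat \<lceil>\<sigma>\<rceil>"
    have j: "\<sigma> \<le> real j" unfolding j_def by linarith
    have "(c + d * (norm x)\<^sup>2) powr \<sigma> \<le> (1 + c + d) ^ j * (1 + norm x) ^ (2 * j)" for x :: "real^'n"
    proof -
      have "c + d * (norm x)\<^sup>2 \<le> (1 + c + d) * (1 + norm x)\<^sup>2"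
        using cd by (simp add: power2_eq_square algebra_simps)
      hence "(c + d * (norm x)\<^sup>2) powr \<sigma> \<le> ((1 + c + d) * (1 + norm x)\<^sup>2) powr \<sigma>"
        using True pos[of x] by (intro powr_mono2) auto
      \<comment> \<open>The enlarged base is at least 1, so rounding the exponent up to an integer
        can only increase the power.\<close>
      also have "1 * 1 \<le> (1 + c + d) * (1 + norm x)\<^sup>2"
        using cd by (intro mult_mono) auto
      hence "((1 + c + d) * (1 + norm x)\<^sup>2) powr \<sigma> \<le> ((1 + c + d) * (1 + norm x)\<^sup>2) powr real j"
        using j by (intro powr_mono) auto
      also have "\<dots> = ((1 + c + d) * (1 + norm x)\<^sup>2) ^ j"
        using cd by (intro powr_realpow mult_pos_pos zero_less_power) (auto simp: add_pos_nonneg)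
      finally show ?thesis
        by (simp add: power_mult_distrib power_mult)
    qed
    thus ?thesis by (auto intro!: exI)
  next
    case False
    have "(c + d * (norm x)\<^sup>2) powr \<sigma> \<le> c powr \<sigma> * (1 + norm x) ^ 0" for x :: "real^'n"
      using False cd by (auto intro!: powr_mono2')
    thus ?thesis
      by (intro exI[of _ "c powr \<sigma>"] exI[of _ 0]) simp
  qed
  fix \<phi> :: "'n cfun" and j assume \<phi>: "\<phi> \<in> schwartz"
  have "(\<lambda>x. complex_of_real ((c + d * (norm x)\<^sup>2) powr (\<sigma> - 1)) *
      (complex_of_real (2 * d * \<sigma>) * (complex_of_real (x $ j) * \<phi> x)))
    \<in> mult_closure (\<lambda>\<sigma> x. complex_of_real ((c + d * (norm x)\<^sup>2) powr \<sigma>))"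
    by (intro mult_closure.base schwartz_cmult schwartz_coord_mult \<phi>)
  also have "(\<lambda>x. complex_of_real ((c + d * (norm x)\<^sup>2) powr (\<sigma> - 1)) *
      (complex_of_real (2 * d * \<sigma>) * (complex_of_real (x $ j) * \<phi> x))) =
      (\<lambda>x. partial j (\<lambda>x. complex_of_real ((c + d * (norm x)\<^sup>2) powr \<sigma>)) x * \<phi> x)"
    by (subst partial_eq[OF D]) (auto simp: inner_axis fun_eq_iff)
  finally show "(\<lambda>x. partial j (\<lambda>x. complex_of_real ((c + d * (norm x)\<^sup>2) powr \<sigma>)) x * \<phi> x)
    \<in> mult_closure (\<lambda>\<sigma> x. complex_of_real ((c + d * (norm x)\<^sup>2) powr \<sigma>))" .
qed fact

lemma partial_dilate:
  assumes "\<phi> differentiable (at (r *\<^sub>R x))"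
  shows "(\<lambda>x. \<phi> (r *\<^sub>R x)) differentiable (at x)"
    "partial i (\<lambda>x. \<phi> (r *\<^sub>R x)) x = r * partial i \<phi> (r *\<^sub>R x)"
proof -
  obtain D where D: "(\<phi> has_derivative D) (at (r *\<^sub>R x))" "partial i \<phi> (r *\<^sub>R x) = D (axis i 1)"
    using has_derivative_partial[OF assms] by metis
  have E: "((\<lambda>x. \<phi> (r *\<^sub>R x)) has_derivative (\<lambda>h. D (r *\<^sub>R h))) (at x)"
    by (rule has_derivative_compose[where f = "\<lambda>x. r *\<^sub>R x" and g = \<phi> and g' = D])
       (auto intro!: derivative_eq_intros D(1))
  show "(\<lambda>x. \<phi> (r *\<^sub>R x)) differentiable (at x)"
    using E by (rule differentiableI)
  show "partial i (\<lambda>x. \<phi> (r *\<^sub>R x)) x = r * partial i \<phi> (r *\<^sub>R x)"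
    using partial_eq[OF E, of i] D(2) linear_scale[OF has_derivative_linear[OF D(1)], of r "axis i 1"]
    by (simp add: scaleR_conv_of_real)
qed

lemma schwartz_dilate:
  fixes \<phi> :: "'n::finite cfun"
  assumes "\<phi> \<in> schwartz" and r: "r \<noteq> 0"
  shows "(\<lambda>x. \<phi> (r *\<^sub>R x)) \<in> schwartz"
proof (rule schwartz_coinduct[where X = "{\<lambda>x. \<phi> (r *\<^sub>R x) | \<phi>. \<phi> \<in> schwartz}"])
  fix u :: "'n cfun" assume "u \<in> {\<lambda>x. \<phi> (r *\<^sub>R x) | \<phi>. \<phi> \<in> schwartz}"
  then obtain \<phi> where u: "u = (\<lambda>x. \<phi> (r *\<^sub>R x))" and \<phi>: "\<phi> \<in> schwartz"
    by auto
  show "u differentiable (at x)" for x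
    unfolding u by (intro partial_dilate schwartz_differentiable \<phi>)
  have "partial i u = (\<lambda>x. (\<lambda>x. r * partial i \<phi> x) (r *\<^sub>R x))" for i
    unfolding u using \<phi> by (auto simp: partial_dilate schwartz_differentiable)
  thus "partial i u \<in> {\<lambda>x. \<phi> (r *\<^sub>R x) | \<phi>. \<phi> \<in> schwartz}" for i
    using schwartz_cmult[OF schwartz_partial[OF \<phi>, of i], of r]
    by (intro CollectI exI[of _ "\<lambda>x. r * partial i \<phi> x"]) simp
  show "decays u"
    unfolding decays_def
  proof
    fix k
    obtain B where B: "\<And>x. (1 + norm x) ^ k * norm (\<phi> x) \<le> B"
      using schwartz_decays[OF \<phi>] unfolding decays_def by metis
    \<comment> \<open>Chosen so that 1 + |x| \<le> C (1 + |r x|), which transfers the weight to the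
      dilated argument.\<close>
    define C where "C = max 1 (1 / \<bar>r\<bar>)"
    have C: "C \<ge> 1" "C * \<bar>r\<bar> \<ge> 1"
      using r mult_right_mono[of "1 / \<bar>r\<bar>" C "\<bar>r\<bar>"] by (auto simp: C_def)
    have "(1 + norm x) ^ k * norm (u x) \<le> C ^ k * B" for x
    proof -
      have "1 + norm x \<le> C * (1 + norm (r *\<^sub>R x))"
        using C mult_right_mono[OF C(2), of "norm x"] by (auto simp: algebra_simps)
      hence "(1 + norm x) ^ k * norm (u x) \<le> (C * (1 + norm (r *\<^sub>R x))) ^ k * norm (\<phi> (r *\<^sub>R x))"
        unfolding u by (intro mult_right_mono power_mono) auto
      also have "\<dots> = C ^ k * ((1 + norm (r *\<^sub>R x)) ^ k * norm (\<phi> (r *\<^sub>R x)))"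
        by (simp add: power_mult_distrib)
      also have "\<dots> \<le> C ^ k * B"
        using C by (intro mult_left_mono B) auto
      finally show ?thesis .
    qed
    thus "\<exists>B. \<forall>x. (1 + norm x) ^ k * norm (u x) \<le> B"
      by blast
  qed
qed (use assms in auto)

section \<open>Integration\<close>

lemma nn_integral_lborel_affine:
  fixes f :: "'a::euclidean_space \<Rightarrow> ennreal"
  assumes [measurable]: "f \<in> borel_measurable borel" and c: "c \<noteq> 0"
  shows "(\<integral>\<^sup>+x. f x \<partial>lborel) = ennreal (\<bar>c\<bar> ^ DIM('a)) * (\<integral>\<^sup>+x. f (t + c *\<^sub>R x) \<partial>lborel)"
  by (subst lborel_affine[OF c, of t])
     (simp add: nn_integral_density nn_integral_distr nn_integral_cmult ennreal_power)

lemma integrable_lborel_affine: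
  fixes f :: "'a::euclidean_space \<Rightarrow> 'b::{banach, second_countable_topology}"
  assumes f: "integrable lborel f" and c: "c \<noteq> 0"
  shows "integrable lborel (\<lambda>x. f (t + c *\<^sub>R x))"
proof -
  have [measurable]: "f \<in> borel_measurable borel"
    using f by auto
  have "ennreal (\<bar>c\<bar> ^ DIM('a)) > 0"
    using c by (simp add: ennreal_zero_less_mult_iff)
  thus ?thesis
    using f c unfolding integrable_iff_bounded
    by (subst (asm) nn_integral_lborel_affine[OF _ c, of _ t]) (auto simp: ennreal_mult_less_top)
qed

lemma integral_lborel_affine:
  fixes f :: "'a::euclidean_space \<Rightarrow> 'b::{banach, second_countable_topology}"
  assumes c: "c \<noteq> 0"
  shows "(LINT x|lborel. f x) = \<bar>c\<bar> ^ DIM('a) *\<^sub>R (LINT x|lborel. f (t + c *\<^sub>R x))"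
proof (cases "integrable lborel f")
  case True
  then have [measurable]: "f \<in> borel_measurable borel"
    by auto
  show ?thesis
    by (subst lborel_affine[OF c, of t]) (simp add: integral_density integral_distr)
next
  \<comment> \<open>The inverse substitution transfers non-integrability, so both integrals have the
    default value 0.\<close>
  case False
  have "\<not> integrable lborel (\<lambda>x. f (t + c *\<^sub>R x))"
  proof
    assume "integrable lborel (\<lambda>x. f (t + c *\<^sub>R x))"
    from integrable_lborel_affine[OF this, of "1 / c" "- (1 / c) *\<^sub>R t"] c False show False
      by (simp add: algebra_simps)
  qed
  then show ?thesis
    using False by (simp add: not_integrable_integral_eq)
qed

lemma nn_integral_inverse_one_plus_square_finite:
  "(\<integral>\<^sup>+x. ennreal (1 / (1 + x\<^sup>2)) \<partial>(lborel :: real measure)) < \<infinity>"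
proof -
  have "integrable lborel (\<lambda>x::real. 1 / (1 + x\<^sup>2))"
    using integrable_inverse_1_plus_square by (simp add: set_integrable_def inverse_eq_divide)
  thus ?thesis
    by (simp add: integrable_iff_bounded)
qed

text \<open>Each 1 + x_i^2 is at most (1 + |x|)^2, so the weight is dominated by a product of
  one-dimensional weights 1 / (1 + x_i^2). This fixes the exponent 2n.\<close>

lemma integrable_decay_weight:
  "integrable lborel (\<lambda>x::real^'n::finite. 1 / (1 + norm x) ^ (2 * CARD('n)))"
proof (rule integrableI_bounded)
  have "(\<integral>\<^sup>+x. norm (1 / (1 + norm x) ^ (2 * CARD('n))) \<partial>(lborel :: (real^'n) measure))
      \<le> (\<integral>\<^sup>+x. (\<Prod>b\<in>Basis. ennreal (1 / (1 + (x \<bullet> b)\<^sup>2))) \<partial>(lborel :: (real^'n) measure))"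
  proof (rule nn_integral_mono)
    fix x :: "real^'n"
    have "(\<Prod>b\<in>Basis. 1 + (x \<bullet> b)\<^sup>2) \<le> (\<Prod>b\<in>(Basis :: (real^'n) set). (1 + norm x)\<^sup>2)"
    proof (rule prod_mono, safe)
      fix b :: "real^'n" assume "b \<in> Basis"
      hence "\<bar>x \<bullet> b\<bar> \<le> norm x"
        by (rule Basis_le_norm)
      hence "(x \<bullet> b)\<^sup>2 \<le> (norm x)\<^sup>2"
        by (metis abs_norm_cancel abs_le_square_iff)
      thus "1 + (x \<bullet> b)\<^sup>2 \<le> (1 + norm x)\<^sup>2"
        using norm_ge_zero[of x] by (simp add: power2_sum del: norm_ge_zero)
    qed auto
    also have "\<dots> = (1 + norm x) ^ (2 * CARD('n))"
      by (simp add: power_mult)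
    finally have "1 / (1 + norm x) ^ (2 * CARD('n)) \<le> 1 / (\<Prod>b\<in>Basis. 1 + (x \<bullet> b)\<^sup>2)"
      by (intro divide_left_mono mult_pos_pos prod_pos) (auto simp: add_pos_nonneg)
    also have "\<dots> = (\<Prod>b\<in>Basis. 1 / (1 + (x \<bullet> b)\<^sup>2))"
      by (simp add: prod_dividef)
    finally show "ennreal (norm (1 / (1 + norm x) ^ (2 * CARD('n)))) \<le> (\<Prod>b\<in>Basis. ennreal (1 / (1 + (x \<bullet> b)\<^sup>2)))"
      by (subst prod_ennreal) (auto intro: ennreal_leI)
  qed
  also have "\<dots> = (\<Prod>b\<in>(Basis :: (real^'n) set). \<integral>\<^sup>+x. ennreal (1 / (1 + x\<^sup>2)) \<partial>lborel)"
    by (rule nn_integral_lborel_prod) auto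
  also have "\<dots> < \<infinity>"
    using nn_integral_inverse_one_plus_square_finite by (simp add: power_less_top_ennreal)
  finally show "(\<integral>\<^sup>+x. norm (1 / (1 + norm x) ^ (2 * CARD('n))) \<partial>(lborel :: (real^'n) measure)) < \<infinity>" .
qed auto

lemma decays_powr_integrable:
  fixes \<phi> :: "'n::finite cfun"
  assumes "decays \<phi>" and [measurable]: "\<phi> \<in> borel_measurable borel" and q: "q > 0"
  shows "integrable lborel (\<lambda>x. norm (\<phi> x) powr q)"
proof -
  \<comment> \<open>Large enough that \<open>k * q\<close> reaches the exponent 2n of the integrable
    weight.\<close>
  define k where "k = nat \<lceil>2 * real CARD('n) / q\<rceil>"
  have "2 * real CARD('n) / q \<le> real k"
    unfolding k_def by linarith
  hence k: "2 * real CARD('n) \<le> real k * q"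
    using q by (simp add: field_simps)
  obtain B where B: "\<And>x. (1 + norm x) ^ k * norm (\<phi> x) \<le> B"
    using assms unfolding decays_def by metis
  have B0: "B \<ge> 0"
    using B[of 0] by (meson norm_ge_zero order_trans zero_le_mult_iff zero_le_power add_nonneg_nonneg zero_le_one)
  have "norm (\<phi> x) powr q \<le> B powr q * (1 / (1 + norm x) ^ (2 * CARD('n)))" for x
  proof -
    have "(1 + norm x) ^ (2 * CARD('n)) = (1 + norm x) powr (2 * real CARD('n))"
      by (subst powr_realpow[symmetric]) (auto simp: add_pos_nonneg)
    also have "\<dots> \<le> (1 + norm x) powr (real k * q)"
      using k by (intro powr_mono) auto
    also have "\<dots> = ((1 + norm x) ^ k) powr q"
      by (simp add: powr_powr[symmetric] powr_realpow add_pos_nonneg)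
    finally have "(1 + norm x) ^ (2 * CARD('n)) * norm (\<phi> x) powr q
        \<le> ((1 + norm x) ^ k) powr q * norm (\<phi> x) powr q"
      by (intro mult_right_mono) auto
    also have "\<dots> = ((1 + norm x) ^ k * norm (\<phi> x)) powr q"
      by (subst powr_mult) auto
    also have "\<dots> \<le> B powr q"
      using B q by (intro powr_mono2) auto
    finally show ?thesis
      by (simp add: field_simps add_pos_nonneg)
  qed
  thus ?thesis
    by (intro Bochner_Integration.integrable_bound[OF integrable_mult_right[OF integrable_decay_weight, of "B powr q"]])
       (auto intro!: AE_I2)
qed

lemma schwartz_powr_integrable:
  "\<phi> \<in> schwartz \<Longrightarrow> q > 0 \<Longrightarrow> integrable lborel (\<lambda>x. norm (\<phi> x) powr q)"
  by (intro decays_powr_integrable schwartz_decays schwartz_measurable)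

lemma decays_integrable:
  assumes "decays \<phi>" and [measurable]: "\<phi> \<in> borel_measurable borel"
  shows "integrable lborel \<phi>"
  by (rule Bochner_Integration.integrable_bound[OF decays_powr_integrable[OF assms, of 1]]) auto

lemma schwartz_integrable: "\<phi> \<in> schwartz \<Longrightarrow> integrable lborel \<phi>"
  by (intro decays_integrable schwartz_decays schwartz_measurable)

lemma schwartz_bounded:
  assumes "\<phi> \<in> schwartz"
  obtains B where "\<And>x. norm (\<phi> x) \<le> B"
  using schwartz_decays[OF assms] unfolding decays_def by (metis mult_1 power_0)

section \<open>The Fourier transform of Schwartz functions\<close>

abbreviation fourier_const :: "'n::finite itself \<Rightarrow> complex" where
  "fourier_const _ \<equiv> complex_of_real ((2 * pi) powr (- real CARD('n) / 2))"

lemma fourier_cis: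
  fixes f :: "'n::finite cfun"
  shows "fourier f \<xi> = fourier_const TYPE('n) * (LINT x|lborel. f x * cis (- (x \<bullet> \<xi>)))"
  unfolding fourier_def by (simp add: cis_conv_exp)

lemma inv_fourier_eq: "inv_fourier f x = fourier f (- x)"
  unfolding fourier_def inv_fourier_def by (simp add: inner_commute)

lemma borel_measurable_cis [measurable]: "cis \<in> borel_measurable borel"
  by (intro borel_measurable_continuous_onI continuous_intros)

lemma integrable_mult_cis [simp]:
  fixes f :: "'n::finite cfun"
  assumes "integrable lborel f" and [measurable]: "g \<in> borel_measurable borel"
  shows "integrable lborel (\<lambda>x. f x * cis (g x))"
proof (rule Bochner_Integration.integrable_bound[OF assms(1)])
  have [measurable]: "f \<in> borel_measurable borel"
    using assms(1) by auto
  show "(\<lambda>x. f x * cis (g x)) \<in> borel_measurable lborel"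
    by measurable
qed (auto simp: norm_mult)

lemma norm_fourier_le:
  fixes f :: "'n::finite cfun"
  assumes "integrable lborel f"
  shows "norm (fourier f \<xi>) \<le> (2 * pi) powr (- real CARD('n) / 2) * (LINT x|lborel. norm (f x))"
proof -
  have "norm (LINT x|lborel. f x * cis (- (x \<bullet> \<xi>))) \<le> (LINT x|lborel. norm (f x * cis (- (x \<bullet> \<xi>))))"
    by (rule integral_norm_bound)
  thus ?thesis
    unfolding fourier_cis norm_mult by (intro mult_mono) (auto simp: norm_mult)
qed

text \<open>Replaces differentiation under the integral sign: for the Fourier transform, the
  second-order Taylor bound of the character integrates to a multiple of the second moment.\<close>

lemma has_derivative_quadratic:
  fixes f :: "'a::real_normed_vector \<Rightarrow> 'b::real_normed_vector"
  assumes "bounded_linear D" and "\<And>h. norm (f (x + h) - f x - D h) \<le> K * (norm h)\<^sup>2"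
  shows "(f has_derivative D) (at x)"
  unfolding has_derivative_at
proof (intro conjI assms(1))
  show "(\<lambda>h. norm (f (x + h) - f x - D h) / norm h) \<midarrow>0\<rightarrow> 0"
  proof (rule Lim_null_comparison)
    show "\<forall>\<^sub>F h in at 0. norm (norm (f (x + h) - f x - D h) / norm h) \<le> K * norm h"
      using assms(2) by (intro eventuallyI) (auto simp: divide_simps power2_eq_square mult_ac)
    show "((\<lambda>h. K * norm h) \<longlongrightarrow> 0) (at (0::'a))"
      by (auto intro!: tendsto_eq_intros)
  qed
qed

lemma norm_cis_approx: "norm (cis u - 1 - \<i> * complex_of_real u) \<le> u\<^sup>2 / 2"
  using iexp_approx1[of u 1] by (simp add: cis_conv_exp eval_nat_numeral algebra_simps)

lemma schwartz_norm_mult: 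
  assumes "\<phi> \<in> schwartz"
  shows "integrable lborel (\<lambda>x. norm x ^ k * norm (\<phi> x))"
proof -
  have "decays (\<lambda>x. complex_of_real (norm x ^ k) * \<phi> x)"
  proof (rule decays_mult_poly[OF schwartz_decays[OF assms]])
    show "norm (complex_of_real (norm x ^ k)) \<le> 1 * (1 + norm x) ^ k" for x :: "real^'a"
      by (auto simp: norm_power intro: power_mono)
  qed
  hence "integrable lborel (\<lambda>x. complex_of_real (norm x ^ k) * \<phi> x)"
    using assms by (intro decays_integrable) (auto dest: schwartz_measurable)
  from integrable_norm[OF this] show ?thesis
    by (simp add: norm_mult norm_power)
qed

lemma fourier_derivative:
  fixes \<phi> :: "'n::finite cfun"
  assumes \<phi>: "\<phi> \<in> schwartz"
  shows "(fourier \<phi> has_derivative (\<lambda>h. fourier (\<lambda>x. - \<i> * complex_of_real (x \<bullet> h) * \<phi> x) \<xi>)) (at \<xi>)"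
proof (rule has_derivative_quadratic)
  have [measurable]: "\<phi> \<in> borel_measurable borel"
    using \<phi> by (rule schwartz_measurable)
  have i: "integrable lborel (\<lambda>x. - \<i> * complex_of_real (x \<bullet> h) * \<phi> x)" for h
  proof (rule Bochner_Integration.integrable_bound)
    show "integrable lborel (\<lambda>x. norm h * (norm x ^ 1 * norm (\<phi> x)))"
      by (intro integrable_mult_right schwartz_norm_mult \<phi>)
    have "norm (- \<i> * complex_of_real (x \<bullet> h) * \<phi> x) \<le> (norm x * norm h) * norm (\<phi> x)" for x
      by (simp add: norm_mult Cauchy_Schwarz_ineq2 mult_right_mono)
    thus "AE x in lborel. norm (- \<i> * complex_of_real (x \<bullet> h) * \<phi> x) \<le> norm (norm h * (norm x ^ 1 * norm (\<phi> x)))"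
      by (intro AE_I2) (simp add: mult_ac)
  qed measurable
  have "linear (\<lambda>h. fourier (\<lambda>x. - \<i> * complex_of_real (x \<bullet> h) * \<phi> x) \<xi>)"
  proof (rule linearI)
    fix a b :: "real^'n"
    have "(\<lambda>x. - \<i> * complex_of_real (x \<bullet> (a + b)) * \<phi> x * cis (- (x \<bullet> \<xi>))) =
      (\<lambda>x. - \<i> * complex_of_real (x \<bullet> a) * \<phi> x * cis (- (x \<bullet> \<xi>)) + - \<i> * complex_of_real (x \<bullet> b) * \<phi> x * cis (- (x \<bullet> \<xi>)))"
      by (auto simp: algebra_simps inner_add_right)
    thus "fourier (\<lambda>x. - \<i> * complex_of_real (x \<bullet> (a + b)) * \<phi> x) \<xi> =
        fourier (\<lambda>x. - \<i> * complex_of_real (x \<bullet> a) * \<phi> x) \<xi> + fourier (\<lambda>x. - \<i> * complex_of_real (x \<bullet> b) * \<phi> x) \<xi>"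
      unfolding fourier_cis using i[of a] i[of b]
      by (simp only: Bochner_Integration.integral_add integrable_mult_cis borel_measurable_uminus borel_measurable_inner
           borel_measurable_const measurable_ident_sets) (simp add: algebra_simps)
  next
    fix r :: real and b :: "real^'n"
    have "(\<lambda>x. - \<i> * complex_of_real (x \<bullet> (r *\<^sub>R b)) * \<phi> x * cis (- (x \<bullet> \<xi>))) =
      (\<lambda>x. r *\<^sub>R (- \<i> * complex_of_real (x \<bullet> b) * \<phi> x * cis (- (x \<bullet> \<xi>))))"
      by (simp add: fun_eq_iff scaleR_conv_of_real[where 'a = complex] mult_ac)
    thus "fourier (\<lambda>x. - \<i> * complex_of_real (x \<bullet> (r *\<^sub>R b)) * \<phi> x) \<xi> =
        r *\<^sub>R fourier (\<lambda>x. - \<i> * complex_of_real (x \<bullet> b) * \<phi> x) \<xi>"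
      unfolding fourier_cis by (simp only: integral_scaleR_right) simp
  qed
  thus "bounded_linear (\<lambda>h. fourier (\<lambda>x. - \<i> * complex_of_real (x \<bullet> h) * \<phi> x) \<xi>)"
    by (simp add: linear_conv_bounded_linear)
  fix h :: "real^'n"
  \<comment> \<open>The Taylor remainder of the character in direction h, after the unimodular
    factor at \<xi> has been split off.\<close>
  let ?R = "\<lambda>x. \<phi> x * cis (- (x \<bullet> \<xi>)) * (cis (- (x \<bullet> h)) - 1 - \<i> * complex_of_real (- (x \<bullet> h)))"
  have "?R = (\<lambda>x. \<phi> x * cis (- (x \<bullet> (\<xi> + h))) - \<phi> x * cis (- (x \<bullet> \<xi>)) - (- \<i> * complex_of_real (x \<bullet> h) * \<phi> x) * cis (- (x \<bullet> \<xi>)))"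
    by (auto simp: inner_add_right algebra_simps cis_mult)
  hence R: "fourier \<phi> (\<xi> + h) - fourier \<phi> \<xi> - fourier (\<lambda>x. - \<i> * complex_of_real (x \<bullet> h) * \<phi> x) \<xi> =
     fourier_const TYPE('n) * (LINT x|lborel. ?R x)"
    unfolding fourier_cis using i[of h] schwartz_integrable[OF \<phi>]
    by (simp add: Bochner_Integration.integral_diff right_diff_distrib distrib_left)
  have "norm (LINT x|lborel. ?R x) \<le> (LINT x|lborel. norm (?R x))"
    by (rule integral_norm_bound)
  also have "\<dots> \<le> (LINT x|lborel. (norm h)\<^sup>2 * (norm x ^ 2 * norm (\<phi> x)))"
  proof (rule Bochner_Integration.integral_mono')
    show "integrable lborel (\<lambda>x. (norm h)\<^sup>2 * (norm x ^ 2 * norm (\<phi> x)))"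
      by (intro integrable_mult_right schwartz_norm_mult \<phi>)
    fix x
    have "norm (?R x) \<le> norm (\<phi> x) * ((- (x \<bullet> h))\<^sup>2 / 2)"
      unfolding norm_mult norm_cis mult_1_right by (intro mult_left_mono norm_cis_approx norm_ge_zero)
    also have "(- (x \<bullet> h))\<^sup>2 / 2 \<le> (x \<bullet> h)\<^sup>2"
      by simp
    also have "\<dots> \<le> (norm x * norm h)\<^sup>2"
      using power_mono[OF Cauchy_Schwarz_ineq2[of x h], of 2] by simp
    finally have "norm (?R x) \<le> norm (\<phi> x) * (norm x * norm h)\<^sup>2"
      by (simp add: mult_left_mono)
    also have "\<dots> = (norm h)\<^sup>2 * (norm x ^ 2 * norm (\<phi> x))"
      by (simp add: power_mult_distrib mult_ac)
    finally show "norm (?R x) \<le> (norm h)\<^sup>2 * (norm x ^ 2 * norm (\<phi> x))" .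
  qed auto
  also have "\<dots> = (LINT x|lborel. norm x ^ 2 * norm (\<phi> x)) * (norm h)\<^sup>2"
    by (subst integral_mult_right_zero) (rule mult.commute)
  finally have "norm (LINT x|lborel. ?R x) \<le> (LINT x|lborel. norm x ^ 2 * norm (\<phi> x)) * (norm h)\<^sup>2" .
  hence "norm (fourier_const TYPE('n) * (LINT x|lborel. ?R x)) \<le>
    (2 * pi) powr (- real CARD('n) / 2) * ((LINT x|lborel. norm x ^ 2 * norm (\<phi> x)) * (norm h)\<^sup>2)"
    unfolding norm_mult by (intro mult_mono) auto
  thus "norm (fourier \<phi> (\<xi> + h) - fourier \<phi> \<xi> - fourier (\<lambda>x. - \<i> * complex_of_real (x \<bullet> h) * \<phi> x) \<xi>) \<le>
     ((2 * pi) powr (- real CARD('n) / 2) * (LINT x|lborel. norm x ^ 2 * norm (\<phi> x))) * (norm h)\<^sup>2"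
    unfolding R by (simp add: mult_ac)
qed

lemma fourier_partial:
  assumes "\<phi> \<in> schwartz"
  shows "partial i (fourier \<phi>) = fourier (\<lambda>x. - \<i> * complex_of_real (x $ i) * \<phi> x)"
  using partial_eq[OF fourier_derivative[OF assms]] by (auto simp: inner_axis)

lemma fourier_cmult: "fourier (\<lambda>x. c * f x) \<xi> = c * fourier f \<xi>"
  unfolding fourier_def by (simp add: mult.assoc)

lemma fourier_translate:
  fixes f :: "'n::finite cfun"
  shows "fourier (\<lambda>x. f (x + a)) \<xi> = cis (a \<bullet> \<xi>) * fourier f \<xi>"
proof -
  have "(LINT x|lborel. f x * cis (- (x \<bullet> \<xi>))) = (LINT x|lborel. f (a + x) * cis (- ((a + x) \<bullet> \<xi>)))"
    using integral_lborel_affine[of 1 "\<lambda>x. f x * cis (- (x \<bullet> \<xi>))" a] by simp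
  also have "\<dots> = (LINT x|lborel. cis (- (a \<bullet> \<xi>)) * (f (x + a) * cis (- (x \<bullet> \<xi>))))"
    by (simp add: inner_add_left cis_mult add_ac mult.left_commute)
  also have "\<dots> = cis (- (a \<bullet> \<xi>)) * (LINT x|lborel. f (x + a) * cis (- (x \<bullet> \<xi>)))"
    by simp
  finally show ?thesis
    unfolding fourier_cis by (simp add: cis_mult mult.assoc[symmetric])
qed

lemma fourier_diff:
  assumes "integrable lborel f" "integrable lborel g"
  shows "fourier (\<lambda>x. f x - g x) \<xi> = fourier f \<xi> - fourier g \<xi>"
  unfolding fourier_cis using assms by (simp add: left_diff_distrib right_diff_distrib)

lemma fourier_add:
  assumes "integrable lborel f" "integrable lborel g"
  shows "fourier (\<lambda>x. f x + g x) \<xi> = fourier f \<xi> + fourier g \<xi>"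
  unfolding fourier_cis using assms by (simp add: distrib_right distrib_left)

text \<open>The dominating function for \<open>fourier_of_partial\<close>. The mean value theorem
  gives a derivative at an intermediate point; a shift of length at most 1 changes 1 + |x| by at
  most a factor 2, hence the constant 2^(2n).\<close>

lemma schwartz_difference_quotient_bound:
  fixes \<phi> :: "'n::finite cfun"
  assumes \<phi>: "\<phi> \<in> schwartz"
  obtains B where "\<And>x t. 0 < t \<Longrightarrow> t \<le> 1 \<Longrightarrow> 
     norm (\<phi> (x + t *\<^sub>R axis i 1) - \<phi> x) \<le> t * (B * (1 / (1 + norm x) ^ (2 * CARD('n))))"
proof -
  let ?k = "2 * CARD('n)"
  obtain B where B: "\<And>x. (1 + norm x) ^ ?k * norm (partial i \<phi> x) \<le> B"
    using schwartz_decays[OF schwartz_partial[OF \<phi>]] unfolding decays_def by metis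
  have "norm (\<phi> (x + t *\<^sub>R axis i 1) - \<phi> x) \<le> t * ((2 ^ ?k * B) * (1 / (1 + norm x) ^ ?k))"
    if t: "0 < t" "t \<le> 1" for x t
  proof -
    have D: "((\<lambda>t. \<phi> (x + t *\<^sub>R axis i 1)) has_derivative (\<lambda>h. h *\<^sub>R partial i \<phi> (x + u *\<^sub>R axis i 1))) (at u)" for u
    proof -
      obtain D where D: "(\<phi> has_derivative D) (at (x + u *\<^sub>R axis i 1))" "partial i \<phi> (x + u *\<^sub>R axis i 1) = D (axis i 1)"
        using has_derivative_partial[OF schwartz_differentiable[OF \<phi>]] by metis
      have "((\<lambda>t. \<phi> (x + t *\<^sub>R axis i 1)) has_derivative (\<lambda>h. D (h *\<^sub>R axis i 1))) (at u)"
        by (rule has_derivative_compose[where f = "\<lambda>t. x + t *\<^sub>R axis i 1" and g = \<phi> and g' = D])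
           (auto intro!: derivative_eq_intros D(1))
      thus ?thesis
        using linear_scale[OF has_derivative_linear[OF D(1)]] D(2) by simp
    qed
    have "continuous_on {0..t} (\<lambda>t. \<phi> (x + t *\<^sub>R axis i 1))"
      by (intro differentiable_imp_continuous_on) 
         (auto simp: differentiable_on_def intro: differentiable_at_withinI differentiableI D)
    then obtain u where u: "u \<in> {0<..<t}" and
      "norm (\<phi> (x + t *\<^sub>R axis i 1) - \<phi> (x + 0 *\<^sub>R axis i 1)) \<le> norm ((t - 0) *\<^sub>R partial i \<phi> (x + u *\<^sub>R axis i 1))"
      using mvt_general[OF t(1), of "\<lambda>t. \<phi> (x + t *\<^sub>R axis i 1)" "\<lambda>u h. h *\<^sub>R partial i \<phi> (x + u *\<^sub>R axis i 1)"] D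
      by blast
    hence 1: "norm (\<phi> (x + t *\<^sub>R axis i 1) - \<phi> x) \<le> t * norm (partial i \<phi> (x + u *\<^sub>R axis i 1))"
      using t by simp
    let ?y = "x + u *\<^sub>R axis i 1"
    have "norm x \<le> norm ?y + norm (u *\<^sub>R (axis i 1 :: real^'n))"
      by (metis add_diff_cancel norm_triangle_ineq4)
    moreover have "norm (u *\<^sub>R (axis i 1 :: real^'n)) \<le> 1"
      using u t by (simp add: norm_axis_1)
    moreover have "a \<le> b + c \<Longrightarrow> c \<le> 1 \<Longrightarrow> 0 \<le> b \<Longrightarrow> 1 + a \<le> 2 * (1 + b)" for a b c :: real
      by (simp add: algebra_simps)
    ultimately have "1 + norm x \<le> 2 * (1 + norm ?y)"
      using norm_ge_zero by blast
    hence "(1 + norm x) ^ ?k * norm (partial i \<phi> ?y) \<le> (2 * (1 + norm ?y)) ^ ?k * norm (partial i \<phi> ?y)"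
      by (intro mult_right_mono power_mono) auto
    also have "\<dots> = 2 ^ ?k * ((1 + norm ?y) ^ ?k * norm (partial i \<phi> ?y))"
      by (simp only: power_mult_distrib mult.assoc)
    also have "\<dots> \<le> 2 ^ ?k * B"
      by (intro mult_left_mono B) auto
    finally have "norm (partial i \<phi> ?y) \<le> (2 ^ ?k * B) * (1 / (1 + norm x) ^ ?k)"
      by (simp add: field_simps add_pos_nonneg)
    thus ?thesis
      using 1 t by (meson mult_left_mono order_trans less_imp_le)
  qed
  thus ?thesis using that by blast
qed

lemma has_vector_derivative_difference_quotient:
  fixes f :: "real \<Rightarrow> 'a::real_normed_vector"
  assumes "(f has_vector_derivative d) (at 0)"
  shows "((\<lambda>t. (f t - f 0) /\<^sub>R t) \<longlongrightarrow> d) (at 0)"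
proof (rule LIM_zero_cancel, rule tendsto_norm_zero_cancel)
  have "((\<lambda>h. norm (f (0 + h) - f 0 - h *\<^sub>R d) / norm h) \<longlongrightarrow> 0) (at 0)"
    using assms by (simp add: has_vector_derivative_def has_derivative_at)
  also have "?this \<longleftrightarrow> ((\<lambda>h. norm ((f h - f 0) /\<^sub>R h - d)) \<longlongrightarrow> 0) (at 0)"
  proof (intro filterlim_cong refl eventually_at_filter[THEN iffD2] always_eventually allI impI)
    fix h :: real assume h: "h \<noteq> 0"
    have "(f h - f 0) /\<^sub>R h - d = (f h - f 0 - h *\<^sub>R d) /\<^sub>R h"
      using h by (simp add: algebra_simps)
    thus "norm (f (0 + h) - f 0 - h *\<^sub>R d) / norm h = norm ((f h - f 0) /\<^sub>R h - d)"
      by (simp add: divide_inverse_commute)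
  qed
  finally show "((\<lambda>h. norm ((f h - f 0) /\<^sub>R h - d)) \<longlongrightarrow> 0) (at 0)" .
qed

text \<open>Difference quotients take the place of integration by parts. Their transform is known
  exactly from the translation rule and converges by the derivative of \<open>cis\<close>, while
  dominated convergence identifies the same limit as the transform of the derivative.\<close>

lemma fourier_of_partial:
  fixes \<phi> :: "'n::finite cfun"
  assumes \<phi>: "\<phi> \<in> schwartz"
  shows "fourier (partial i \<phi>) \<xi> = \<i> * complex_of_real (\<xi> $ i) * fourier \<phi> \<xi>"
proof (rule LIMSEQ_unique)
  let ?t = "\<lambda>n. 1 / real (Suc n)"
  let ?q = "\<lambda>n x. (\<phi> (x + ?t n *\<^sub>R axis i 1) - \<phi> x) /\<^sub>R ?t n"
  have [measurable]: "\<phi> \<in> borel_measurable borel" "partial i \<phi> \<in> borel_measurable borel"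
    using \<phi> by (auto intro!: schwartz_measurable schwartz_partial)
  have t0: "filterlim ?t (at 0) sequentially"
    unfolding filterlim_at using LIMSEQ_inverse_real_of_nat by (simp add: divide_inverse)
  obtain B where B: "\<And>x t. 0 < t \<Longrightarrow> t \<le> 1 \<Longrightarrow> 
     norm (\<phi> (x + t *\<^sub>R axis i 1) - \<phi> x) \<le> t * (B * (1 / (1 + norm x) ^ (2 * CARD('n))))"
    using schwartz_difference_quotient_bound[OF \<phi>, of i] by blast
  have "(\<lambda>n. LINT x|lborel. ?q n x * cis (- (x \<bullet> \<xi>))) \<longlonglongrightarrow> (LINT x|lborel. partial i \<phi> x * cis (- (x \<bullet> \<xi>)))"
  proof (rule integral_dominated_convergence)
    show "integrable lborel (\<lambda>x::real^'n. B * (1 / (1 + norm x) ^ (2 * CARD('n))))"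
      by (intro integrable_mult_right integrable_decay_weight)
    show "AE x in lborel. (\<lambda>n. ?q n x * cis (- (x \<bullet> \<xi>))) \<longlonglongrightarrow> partial i \<phi> x * cis (- (x \<bullet> \<xi>))"
    proof (intro AE_I2 tendsto_mult tendsto_const)
      fix x
      obtain D where D: "(\<phi> has_derivative D) (at x)" "partial i \<phi> x = D (axis i 1)"
        using has_derivative_partial[OF schwartz_differentiable[OF \<phi>]] by metis
      have "((\<lambda>t. \<phi> (x + t *\<^sub>R axis i 1)) has_derivative (\<lambda>h. D (h *\<^sub>R axis i 1))) (at 0)"
        by (rule has_derivative_compose[where f = "\<lambda>t. x + t *\<^sub>R axis i 1" and g = \<phi> and g' = D])
           (auto intro!: derivative_eq_intros D(1))
      hence "((\<lambda>t. \<phi> (x + t *\<^sub>R axis i 1)) has_vector_derivative partial i \<phi> x) (at 0)"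
        using linear_scale[OF has_derivative_linear[OF D(1)]] D(2) by (simp add: has_vector_derivative_def)
      hence "((\<lambda>t. (\<phi> (x + t *\<^sub>R axis i 1) - \<phi> x) /\<^sub>R t) \<longlongrightarrow> partial i \<phi> x) (at 0)"
        using has_vector_derivative_difference_quotient by force
      from filterlim_compose[OF this t0] show "(\<lambda>n. ?q n x) \<longlonglongrightarrow> partial i \<phi> x" .
    qed
    show "AE x in lborel. norm (?q n x * cis (- (x \<bullet> \<xi>))) \<le> B * (1 / (1 + norm x) ^ (2 * CARD('n)))" for n
    proof (rule AE_I2)
      fix x
      show "norm (?q n x * cis (- (x \<bullet> \<xi>))) \<le> B * (1 / (1 + norm x) ^ (2 * CARD('n)))"
        using mult_left_mono[OF B[of "?t n" x], of "inverse (?t n)"]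
        unfolding norm_mult norm_cis norm_scaleR mult.assoc[symmetric] by simp
    qed
  qed measurable
  hence "(\<lambda>n. fourier (?q n) \<xi>) \<longlonglongrightarrow> fourier (partial i \<phi>) \<xi>"
    unfolding fourier_cis by (intro tendsto_mult tendsto_const)
  moreover have "fourier (?q n) \<xi> = ((cis (?t n * \<xi> $ i) - 1) /\<^sub>R ?t n) * fourier \<phi> \<xi>" for n
  proof -
    have "fourier (?q n) \<xi> = complex_of_real (inverse (?t n)) * fourier (\<lambda>x. \<phi> (x + ?t n *\<^sub>R axis i 1) - \<phi> x) \<xi>"
      by (subst fourier_cmult[symmetric]) (simp add: scaleR_conv_of_real)
    also have "fourier (\<lambda>x. \<phi> (x + ?t n *\<^sub>R axis i 1) - \<phi> x) \<xi> = cis (?t n * \<xi> $ i) * fourier \<phi> \<xi> - fourier \<phi> \<xi>"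
      using schwartz_integrable[OF \<phi>] integrable_lborel_affine[OF schwartz_integrable[OF \<phi>], of 1 "?t n *\<^sub>R axis i 1"]
      by (subst fourier_diff) (auto simp: fourier_translate inner_axis' add_ac)
    finally show ?thesis
      by (simp add: scaleR_conv_of_real algebra_simps)
  qed
  ultimately show "(\<lambda>n. ((cis (?t n * \<xi> $ i) - 1) /\<^sub>R ?t n) * fourier \<phi> \<xi>) \<longlonglongrightarrow> fourier (partial i \<phi>) \<xi>"
    by simp
  have "((\<lambda>t. cis (t * \<xi> $ i)) has_vector_derivative (\<i> * complex_of_real (\<xi> $ i))) (at 0)"
    by (auto intro!: derivative_eq_intros simp: scaleR_conv_of_real has_vector_derivative_def)
  hence "((\<lambda>t. (cis (t * \<xi> $ i) - 1) /\<^sub>R t) \<longlongrightarrow> \<i> * complex_of_real (\<xi> $ i)) (at 0)"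
    using has_vector_derivative_difference_quotient by force
  from filterlim_compose[OF this t0]
  show "(\<lambda>n. ((cis (?t n * \<xi> $ i) - 1) /\<^sub>R ?t n) * fourier \<phi> \<xi>) \<longlonglongrightarrow> \<i> * complex_of_real (\<xi> $ i) * fourier \<phi> \<xi>"
    by (intro tendsto_mult tendsto_const)
qed

text \<open>One power of 1 + |\<xi>| costs one derivative: |\<xi>| is at most the sum of the
  |\<xi>_i|, and \<xi>_i times the transform is, up to a unit, the transform of a partial
  derivative. The induction therefore runs over all Schwartz functions at once.\<close>

lemma fourier_decays:
  fixes \<phi> :: "'n::finite cfun"
  assumes "\<phi> \<in> schwartz"
  shows "decays (fourier \<phi>)"
proof -
  have "\<exists>B. \<forall>\<xi>. (1 + norm \<xi>) ^ k * norm (fourier \<phi> \<xi>) \<le> B" for k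
    using assms
  proof (induction k arbitrary: \<phi>)
    case 0
    then show ?case
      using norm_fourier_le[OF schwartz_integrable] by auto
  next
    case (Suc k)
    obtain B where B: "\<And>\<xi>. (1 + norm \<xi>) ^ k * norm (fourier \<phi> \<xi>) \<le> B"
      using Suc by metis
    have "\<forall>i. \<exists>B. \<forall>\<xi>. (1 + norm \<xi>) ^ k * norm (fourier (partial i \<phi>) \<xi>) \<le> B"
      using Suc schwartz_partial by blast
    then obtain C where C: "\<And>i \<xi>. (1 + norm \<xi>) ^ k * norm (fourier (partial i \<phi>) \<xi>) \<le> C i"
      by metis
    have "(1 + norm \<xi>) ^ Suc k * norm (fourier \<phi> \<xi>) \<le> B + (\<Sum>i\<in>UNIV. C i)" for \<xi>
    proof -
      have "(1 + norm \<xi>) ^ Suc k * norm (fourier \<phi> \<xi>) = (1 + norm \<xi>) * ((1 + norm \<xi>) ^ k * norm (fourier \<phi> \<xi>))"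
        by simp
      also have "\<dots> \<le> (1 + (\<Sum>i\<in>UNIV. \<bar>\<xi> $ i\<bar>)) * ((1 + norm \<xi>) ^ k * norm (fourier \<phi> \<xi>))"
        by (intro mult_right_mono add_left_mono norm_le_l1_cart) auto
      also have "\<dots> = (1 + norm \<xi>) ^ k * norm (fourier \<phi> \<xi>) + (\<Sum>i\<in>UNIV. (1 + norm \<xi>) ^ k * norm (fourier (partial i \<phi>) \<xi>))"
        unfolding fourier_of_partial[OF Suc.prems] norm_mult distrib_right sum_distrib_right
        by (simp add: mult_ac)
      also have "\<dots> \<le> B + (\<Sum>i\<in>UNIV. C i)"
        by (intro add_mono sum_mono B C)
      finally show ?thesis .
    qed
    then show ?case by blast
  qed
  thus ?thesis by (simp add: decays_def)
qed

text \<open>The image of the Schwartz space is itself invariant, since differentiating a transform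
  multiplies the original function by a coordinate.\<close>

lemma fourier_schwartz:
  fixes \<phi> :: "'n::finite cfun"
  assumes "\<phi> \<in> schwartz"
  shows "fourier \<phi> \<in> schwartz"
proof (rule schwartz_coinduct[where X = "fourier ` schwartz"])
  fix u :: "'n cfun" assume "u \<in> fourier ` schwartz"
  then obtain \<phi> where u: "u = fourier \<phi>" and \<phi>: "\<phi> \<in> schwartz"
    by auto
  show "u differentiable (at x)" for x
    unfolding u using fourier_derivative[OF \<phi>] by (rule differentiableI)
  show "partial i u \<in> fourier ` schwartz" for i
    unfolding u fourier_partial[OF \<phi>]
    using schwartz_cmult[OF schwartz_coord_mult[OF \<phi>], of "-\<i>"] by (auto simp: mult.assoc)
  show "decays u"
    unfolding u using \<phi> by (rule fourier_decays)
qed (use assms in auto)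

lemma inv_fourier_schwartz:
  assumes "\<phi> \<in> schwartz"
  shows "inv_fourier \<phi> \<in> schwartz"
proof -
  have "inv_fourier \<phi> = (\<lambda>x. fourier \<phi> ((-1) *\<^sub>R x))"
    by (auto simp: inv_fourier_eq)
  thus ?thesis
    using schwartz_dilate[OF fourier_schwartz[OF assms], of "-1"] by simp
qed

section \<open>The Gaussian and Fourier inversion\<close>

definition gauss :: "'n::finite cfun" where
  "gauss x = complex_of_real (exp (- (norm x)\<^sup>2 / 2))"

lemma gauss_derivative:
  "(gauss has_derivative (\<lambda>h. - complex_of_real (x \<bullet> h) * gauss x)) (at x)" for x :: "real^'n::finite"
proof -
  have "((\<lambda>x. exp (- (x \<bullet> x) / 2)) has_derivative (\<lambda>h. - (x \<bullet> h) * exp (- (x \<bullet> x) / 2))) (at x)"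
    by (auto intro!: derivative_eq_intros simp: inner_commute)
  from has_derivative_of_real[OF this] show ?thesis
    by (simp add: gauss_def[abs_def] power2_norm_eq_inner)
qed

lemma partial_gauss: "partial i gauss = (\<lambda>x. - (complex_of_real (x $ i) * gauss x))"
  using partial_eq[OF gauss_derivative] by (auto simp: inner_axis)

text \<open>Polynomial multiples of the Gaussian, the invariant set that places \<open>gauss\<close>
  in the Schwartz space.\<close>

inductive_set gauss_polys :: "'n::finite cfun set" where
  "gauss \<in> gauss_polys"
| "u \<in> gauss_polys \<Longrightarrow> (\<lambda>x. c * u x) \<in> gauss_polys"
| "u \<in> gauss_polys \<Longrightarrow> (\<lambda>x. complex_of_real (x $ i) * u x) \<in> gauss_polys"
| "u \<in> gauss_polys \<Longrightarrow> v \<in> gauss_polys \<Longrightarrow> (\<lambda>x. u x + v x) \<in> gauss_polys"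

text \<open>A single term of the exponential series at r^2/2 is at most its sum.\<close>

lemma exp_neg_half_square_le: "r ^ (2 * k) * exp (- r\<^sup>2 / 2) \<le> 2 ^ k * fact k" for r :: real
proof -
  have "(r\<^sup>2 / 2) ^ k / fact k \<le> exp (r\<^sup>2 / 2)"
  proof -
    have "(\<Sum>n\<in>{k}. inverse (fact n) * (r\<^sup>2 / 2) ^ n) \<le> (\<Sum>n. inverse (fact n) * (r\<^sup>2 / 2) ^ n)"
      by (rule sum_le_suminf[OF summable_exp]) auto
    thus ?thesis
      by (simp add: exp_def field_simps)
  qed
  hence "(r\<^sup>2) ^ k \<le> 2 ^ k * fact k * exp (r\<^sup>2 / 2)"
    by (simp add: field_simps power_divide)
  hence "r ^ (2 * k) \<le> 2 ^ k * fact k * exp (r\<^sup>2 / 2)"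
    by (simp only: power_mult)
  hence "r ^ (2 * k) * exp (- r\<^sup>2 / 2) \<le> 2 ^ k * fact k * exp (r\<^sup>2 / 2) * exp (- r\<^sup>2 / 2)"
    by (intro mult_right_mono) auto
  also have "\<dots> = 2 ^ k * fact k"
    by (simp add: mult.assoc exp_add[symmetric])
  finally show ?thesis .
qed

lemma gauss_decays: "decays gauss"
  unfolding decays_def
proof
  fix k
  have "(1 + norm x) ^ k * norm (gauss x) \<le> 2 ^ (2 * k) + 2 ^ (2 * k) * (2 ^ k * fact k)" for x :: "real^'n"
  proof -
    \<comment> \<open>The bound \<open>exp_neg_half_square_le\<close> concerns even powers, hence
      the passage from k to 2k.\<close>
    have "(1 + norm x) ^ k \<le> (1 + norm x) ^ (2 * k)"
      by (intro power_increasing) auto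
    also have "\<dots> \<le> (2 * max 1 (norm x)) ^ (2 * k)"
      by (intro power_mono) auto
    also have "\<dots> = 2 ^ (2 * k) * max 1 (norm x) ^ (2 * k)"
      by (simp add: power_mult_distrib)
    also have "\<dots> \<le> 2 ^ (2 * k) * (1 + norm x ^ (2 * k))"
      by (intro mult_left_mono) (auto simp: max_def)
    finally have "(1 + norm x) ^ k * norm (gauss x) \<le> 2 ^ (2 * k) * (1 + norm x ^ (2 * k)) * norm (gauss x)"
      by (intro mult_right_mono) auto
    also have "\<dots> = 2 ^ (2 * k) * exp (- (norm x)\<^sup>2 / 2) + 2 ^ (2 * k) * (norm x ^ (2 * k) * exp (- (norm x)\<^sup>2 / 2))"
      by (simp add: gauss_def algebra_simps)
    also have "\<dots> \<le> 2 ^ (2 * k) * 1 + 2 ^ (2 * k) * (2 ^ k * fact k)"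
      by (intro add_mono mult_left_mono exp_neg_half_square_le) auto
    finally show ?thesis by simp
  qed
  thus "\<exists>B. \<forall>x::real^'n. (1 + norm x) ^ k * norm (gauss x) \<le> B"
    by blast
qed

lemma gauss_schwartz: "gauss \<in> schwartz"
proof (rule schwartz_coinduct[OF gauss_polys.intros(1)])
  have d: "u differentiable (at x)" if "u \<in> gauss_polys" for u :: "'a cfun" and x
    using that
  proof induction
    case 1
    show ?case by (rule differentiableI[OF gauss_derivative])
  next
    case (3 u i)
    show ?case by (rule differentiable_mult[OF differentiableI[OF has_derivative_coord] 3(2)])
  qed auto
  fix u :: "'a cfun" assume u: "u \<in> gauss_polys"
  show "u differentiable (at x)" for x
    using u d by blast
  show "decays u"
    using u
  proof induction
    case (2 u c)
    then show ?case by (intro decays_mult_poly[where C = "norm c" and j = 0]) auto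
  next
    case (3 u i)
    then show ?case
      by (intro decays_mult_poly[where C = 1 and j = 1]) (auto intro: order_trans[OF component_le_norm_cart])
  qed (auto intro: gauss_decays decays_add)
  show "partial i u \<in> gauss_polys" for i
    using u
  proof induction
    case 1
    show ?case
      unfolding partial_gauss
      using gauss_polys.intros(2)[OF gauss_polys.intros(3)[OF gauss_polys.intros(1)], of "-1" i] by simp
  next
    case (2 u c)
    have "partial i (\<lambda>x. c * u x) = (\<lambda>x. c * partial i u x)"
      using d[OF 2(1)] by (auto simp: partial_mult)
    then show ?case using 2 gauss_polys.intros by simp
  next
    case (3 u j)
    have "partial i (\<lambda>x. complex_of_real (x $ j) * u x) =
       (\<lambda>x. (if j = i then 1 else 0) * u x + complex_of_real (x $ j) * partial i u x)"
      by (intro ext)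
         (simp add: partial_mult[OF differentiableI[OF has_derivative_coord] d[OF 3(1)]] partial_coord)
    moreover have "(\<lambda>x. (if j = i then 1 else 0) * u x + complex_of_real (x $ j) * partial i u x) \<in> gauss_polys"
      by (intro gauss_polys.intros 3)
    ultimately show ?case by simp
  next
    case (4 u v)
    have "partial i (\<lambda>x. u x + v x) = (\<lambda>x. partial i u x + partial i v x)"
      using d 4 by (auto simp: partial_add)
    then show ?case using 4 gauss_polys.intros by simp
  qed
qed

text \<open>The integral factors over the coordinates, and each factor is the total mass of the
  standard normal density times sqrt (2 pi).\<close>

lemma integral_gauss:
  "(LINT x|lborel. gauss (x :: real^'n::finite)) = complex_of_real ((2 * pi) powr (real CARD('n) / 2))"
proof -
  have 1: "(\<integral>\<^sup>+x. ennreal (exp (- x\<^sup>2 / 2)) \<partial>lborel) = ennreal (sqrt (2 * pi))"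
  proof -
    have "(\<integral>\<^sup>+x. ennreal (exp (- x\<^sup>2 / 2)) \<partial>lborel) = (\<integral>\<^sup>+x. ennreal (sqrt (2 * pi)) * ennreal (std_normal_density x) \<partial>lborel)"
      by (intro nn_integral_cong) (auto simp: std_normal_density_def ennreal_mult[symmetric])
    also have "\<dots> = ennreal (sqrt (2 * pi)) * (\<integral>\<^sup>+x. ennreal (std_normal_density x) \<partial>lborel)"
      by (intro nn_integral_cmult) auto
    also have "(\<integral>\<^sup>+x. ennreal (std_normal_density x) \<partial>lborel) = 1"
      using integrable_normal_density[of 1 0] integral_normal_density[of 1 0]
      by (subst nn_integral_eq_integral) auto
    finally show ?thesis by simp
  qed
  have "(\<integral>\<^sup>+x. ennreal (exp (- (norm x)\<^sup>2 / 2)) \<partial>(lborel :: (real^'n) measure)) =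
     (\<integral>\<^sup>+x. (\<Prod>b\<in>Basis. ennreal (exp (- (x \<bullet> b)\<^sup>2 / 2))) \<partial>(lborel :: (real^'n) measure))"
  proof (intro nn_integral_cong)
    fix x :: "real^'n"
    have "(norm x)\<^sup>2 = (\<Sum>b\<in>Basis. (x \<bullet> b)\<^sup>2)"
      unfolding power2_norm_eq_inner by (subst euclidean_inner) (simp add: power2_eq_square)
    thus "ennreal (exp (- (norm x)\<^sup>2 / 2)) = (\<Prod>b\<in>Basis. ennreal (exp (- (x \<bullet> b)\<^sup>2 / 2)))"
      by (simp add: prod_ennreal exp_sum[symmetric] sum_negf sum_divide_distrib)
  qed
  also have "\<dots> = (\<Prod>b\<in>(Basis :: (real^'n) set). (\<integral>\<^sup>+x. ennreal (exp (- x\<^sup>2 / 2)) \<partial>lborel))"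
    by (rule nn_integral_lborel_prod) auto
  also have "\<dots> = ennreal (sqrt (2 * pi) ^ CARD('n))"
    by (subst 1) (simp add: ennreal_power)
  also have "sqrt (2 * pi) ^ CARD('n) = (2 * pi) powr (real CARD('n) / 2)"
    by (simp add: powr_half_sqrt[symmetric] powr_realpow[symmetric] powr_powr)
  finally have "has_bochner_integral lborel (\<lambda>x::real^'n. exp (- (norm x)\<^sup>2 / 2)) ((2 * pi) powr (real CARD('n) / 2))"
    by (intro has_bochner_integral_nn_integral) auto
  hence "(LINT x|lborel. exp (- (norm (x::real^'n))\<^sup>2 / 2)) = (2 * pi) powr (real CARD('n) / 2)"
    by (rule has_bochner_integral_integral_eq)
  thus ?thesis
    by (simp add: gauss_def)
qed

text \<open>Transforming the formula for the partial derivatives of the Gaussian shows that the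
  transform satisfies the same first-order equation. Its quotient \<open>u\<close> by the Gaussian
  is therefore constant, and the value at 0 comes from \<open>integral_gauss\<close>.\<close>

lemma fourier_gauss: "fourier gauss = (gauss :: 'n::finite cfun)"
proof -
  define u :: "'n cfun" where "u = (\<lambda>x. fourier gauss x * complex_of_real (exp ((norm x)\<^sup>2 / 2)))"
  have "(u has_derivative (\<lambda>h. 0)) (at \<xi>)" for \<xi>
  proof -
    have x_gauss: "fourier (\<lambda>x. - \<i> * complex_of_real (x $ i) * gauss x) \<xi> = - complex_of_real (\<xi> $ i) * fourier gauss \<xi>" for i
    proof -
      have "fourier (\<lambda>x. - \<i> * complex_of_real (x $ i) * gauss x) \<xi> = fourier (\<lambda>x. \<i> * partial i gauss x) \<xi>"
        by (simp add: partial_gauss mult.assoc)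
      also have "\<dots> = \<i> * (\<i> * complex_of_real (\<xi> $ i) * fourier gauss \<xi>)"
        by (subst fourier_cmult) (simp add: fourier_of_partial gauss_schwartz)
      finally show ?thesis by (simp add: mult.assoc[symmetric])
    qed
    obtain D where D: "(fourier gauss has_derivative D) (at \<xi>)" "\<And>i. partial i (fourier gauss) \<xi> = D (axis i 1)"
      using has_derivative_partial[OF schwartz_differentiable[OF fourier_schwartz[OF gauss_schwartz]]] by metis
    have lin: "linear D" using D(1) by (rule has_derivative_linear)
    have "D h = - complex_of_real (\<xi> \<bullet> h) * fourier gauss \<xi>" for h
    proof -
      have "D h = D (\<Sum>i\<in>UNIV. h $ i *\<^sub>R axis i 1)"
        by (simp add: basis_expansion flip: scalar_mult_eq_scaleR)
      also have "\<dots> = (\<Sum>i\<in>UNIV. h $ i *\<^sub>R D (axis i 1))"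
        using lin by (simp add: linear_sum linear_scale)
      also have "\<dots> = (\<Sum>i\<in>UNIV. - complex_of_real (h $ i * \<xi> $ i) * fourier gauss \<xi>)"
        unfolding D(2)[symmetric] fourier_partial[OF gauss_schwartz] x_gauss
        by (simp add: scaleR_conv_of_real mult_ac)
      also have "\<dots> = - complex_of_real (\<xi> \<bullet> h) * fourier gauss \<xi>"
        by (simp add: inner_vec_def sum_distrib_right sum_distrib_left sum_negf mult_ac)
      finally show ?thesis .
    qed
    hence D': "(fourier gauss has_derivative (\<lambda>h. - complex_of_real (\<xi> \<bullet> h) * fourier gauss \<xi>)) (at \<xi>)"
      using D(1) by (metis (no_types, lifting) ext)
    have "((\<lambda>x. exp ((x \<bullet> x) / 2)) has_derivative (\<lambda>h. (\<xi> \<bullet> h) * exp ((\<xi> \<bullet> \<xi>) / 2))) (at \<xi>)"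
      by (auto intro!: derivative_eq_intros simp: inner_commute)
    from has_derivative_mult[OF D' has_derivative_of_real[OF this]] show ?thesis
      unfolding u_def power2_norm_eq_inner by (simp add: mult_ac)
  qed
  hence "u x = u 0" for x
    using has_derivative_zero_unique_connected[of UNIV u x 0] by (auto simp: has_derivative_at_withinI)
  moreover have "u 0 = 1"
  proof -
    have "fourier gauss (0::real^'n) = fourier_const TYPE('n) * complex_of_real ((2 * pi) powr (real CARD('n) / 2))"
      unfolding fourier_cis integral_gauss[where 'n = 'n, symmetric] by simp
    also have "\<dots> = 1"
      by (simp add: of_real_mult[symmetric] powr_add[symmetric] del: of_real_mult)
    finally show ?thesis by (simp add: u_def)
  qed
  ultimately have "fourier gauss x * complex_of_real (exp ((norm x)\<^sup>2 / 2)) = 1" for x :: "real^'n"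
    unfolding u_def by metis
  hence "fourier gauss x = gauss x" for x :: "real^'n"
    by (simp add: gauss_def exp_minus field_simps)
  thus ?thesis by blast
qed

lemma integrable_fubini_mult:
  fixes f g :: "'n::finite cfun"
  assumes "integrable lborel f" "integrable lborel g"
    and [measurable]: "c \<in> borel_measurable (borel \<Otimes>\<^sub>M borel)"
  shows "integrable (lborel \<Otimes>\<^sub>M lborel) (\<lambda>(x, y). f x * g y * cis (c (x, y)))"
proof (rule lborel_pair.Fubini_integrable)
  have [measurable]: "f \<in> borel_measurable borel" "g \<in> borel_measurable borel"
    using assms by auto
  show "(\<lambda>(x, y). f x * g y * cis (c (x, y))) \<in> borel_measurable (lborel \<Otimes>\<^sub>M lborel)"
    by measurable
  have "integrable lborel (\<lambda>x. norm (f x) * (LINT y|lborel. norm (g y)))"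
    using assms by auto
  thus "integrable lborel (\<lambda>x. LINT y|lborel. norm (case (x, y) of (x, y) \<Rightarrow> f x * g y * cis (c (x, y))))"
    by (simp add: norm_mult)
  show "AE x in lborel. integrable lborel (\<lambda>y. case (x, y) of (x, y) \<Rightarrow> f x * g y * cis (c (x, y)))"
    using assms(2) by (auto intro!: AE_I2 integrable_mult_cis)
qed

lemma fourier_mult_formula:
  fixes f g :: "'n::finite cfun"
  assumes f: "integrable lborel f" and g: "integrable lborel g"
  shows "(LINT x|lborel. fourier f x * g x) = (LINT x|lborel. f x * fourier g x)"
proof -
  have I: "integrable (lborel \<Otimes>\<^sub>M lborel) (\<lambda>(x, y). f x * g y * cis (- (x \<bullet> y)))"
    using integrable_fubini_mult[OF f g, of "\<lambda>(x, y). - (x \<bullet> y)"] by simp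
  have "(LINT y|lborel. fourier f y * g y) = fourier_const TYPE('n) * (LINT y|lborel. LINT x|lborel. f x * g y * cis (- (x \<bullet> y)))"
    unfolding fourier_cis integral_mult_right_zero[symmetric] integral_mult_left_zero[symmetric]
    by (simp add: mult_ac)
  also have "(LINT y|lborel. LINT x|lborel. f x * g y * cis (- (x \<bullet> y))) = (LINT x|lborel. LINT y|lborel. f x * g y * cis (- (x \<bullet> y)))"
    by (rule lborel_pair.Fubini_integral[OF I])
  also have "fourier_const TYPE('n) * \<dots> = (LINT x|lborel. f x * fourier g x)"
    unfolding fourier_cis integral_mult_right_zero[symmetric]
    by (simp add: mult_ac inner_commute)
  finally show ?thesis .
qed

lemma fourier_modulate: "fourier (\<lambda>y. cis (x \<bullet> y) * f y) z = fourier f (z - x)"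
  unfolding fourier_cis by (simp add: inner_diff_right cis_mult mult_ac inner_commute algebra_simps)

lemma fourier_dilate:
  fixes f :: "'n::finite cfun"
  assumes r: "r > 0"
  shows "fourier (\<lambda>x. f (r *\<^sub>R x)) \<xi> = complex_of_real (1 / r ^ CARD('n)) * fourier f (\<xi> /\<^sub>R r)"
proof -
  have "(LINT x|lborel. f x * cis (- (x \<bullet> (\<xi> /\<^sub>R r)))) = (r ^ CARD('n)) *\<^sub>R (LINT x|lborel. f (r *\<^sub>R x) * cis (- (x \<bullet> \<xi>)))"
    using r by (subst integral_lborel_affine[of r _ 0]) (auto simp: mult.assoc[symmetric])
  thus ?thesis
    using r unfolding fourier_cis by (simp add: scaleR_conv_of_real[where 'a = complex])
qed

text \<open>The inversion integral is damped by \<open>gauss (r y)\<close>. Moving the transform to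
  the other factor turns the damped character into a Gaussian of width r centred at x, an
  approximate identity. Letting r = 1/(n+1) tend to 0 gives the two sides by dominated
  convergence.\<close>

lemma inv_fourier_fourier:
  fixes \<phi> :: "'n::finite cfun"
  assumes \<phi>: "\<phi> \<in> schwartz"
  shows "inv_fourier (fourier \<phi>) = \<phi>"
proof
  fix x
  let ?e = "\<lambda>n. 1 / real (Suc n)"
  have [measurable]: "\<phi> \<in> borel_measurable borel" "fourier \<phi> \<in> borel_measurable borel" "(gauss :: 'n cfun) \<in> borel_measurable borel"
    using \<phi> by (auto intro!: schwartz_measurable fourier_schwartz gauss_schwartz)
  have e0: "?e \<longlonglongrightarrow> 0"
    using LIMSEQ_inverse_real_of_nat by (simp add: divide_inverse)
  have g: "(\<lambda>y. gauss (r *\<^sub>R y)) \<in> (schwartz :: 'n cfun set)" if "r \<noteq> 0" for r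
    using schwartz_dilate[OF gauss_schwartz that] .
  have iF: "integrable lborel (fourier \<phi>)"
    by (intro schwartz_integrable fourier_schwartz \<phi>)
  have ng: "norm (gauss y) \<le> 1" for y :: "real^'n"
    by (simp add: gauss_def)
  have eq: "(LINT y|lborel. fourier \<phi> y * (cis (x \<bullet> y) * gauss (r *\<^sub>R y))) = (LINT u|lborel. \<phi> (x + r *\<^sub>R u) * gauss u)"
    if r: "r > 0" for r
  proof -
    have "integrable lborel (\<lambda>y. gauss (r *\<^sub>R y) * cis (x \<bullet> y))"
      by (intro integrable_mult_cis schwartz_integrable g) (use r in auto)
    hence "(LINT y|lborel. fourier \<phi> y * (cis (x \<bullet> y) * gauss (r *\<^sub>R y))) =
        (LINT y|lborel. \<phi> y * fourier (\<lambda>y. cis (x \<bullet> y) * gauss (r *\<^sub>R y)) y)"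
      by (intro fourier_mult_formula[OF schwartz_integrable[OF \<phi>]]) (simp add: mult.commute)
    also have "\<dots> = (LINT y|lborel. \<phi> y * (complex_of_real (1 / r ^ CARD('n)) * gauss ((y - x) /\<^sub>R r)))"
      using r by (simp only: fourier_modulate fourier_dilate fourier_gauss)
    also have "\<dots> = (LINT u|lborel. \<phi> (x + r *\<^sub>R u) * gauss u)"
      using r by (subst integral_lborel_affine[of r _ x]) (auto simp: scaleR_conv_of_real[where 'a = complex])
    finally show ?thesis .
  qed
  have "(\<lambda>n. LINT y|lborel. fourier \<phi> y * (cis (x \<bullet> y) * gauss (?e n *\<^sub>R y))) \<longlonglongrightarrow> (LINT y|lborel. fourier \<phi> y * cis (x \<bullet> y))"
  proof (rule integral_dominated_convergence)
    show "integrable lborel (\<lambda>y. norm (fourier \<phi> y))"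
      using iF by auto
    show "AE y in lborel. (\<lambda>n. fourier \<phi> y * (cis (x \<bullet> y) * gauss (?e n *\<^sub>R y))) \<longlonglongrightarrow> fourier \<phi> y * cis (x \<bullet> y)"
    proof (rule AE_I2)
      fix y
      have "(\<lambda>n. fourier \<phi> y * (cis (x \<bullet> y) * gauss (?e n *\<^sub>R y))) \<longlonglongrightarrow> fourier \<phi> y * (cis (x \<bullet> y) * complex_of_real (exp (- (norm (0 *\<^sub>R y))\<^sup>2 / 2)))"
        unfolding gauss_def by (intro tendsto_intros e0) auto
      thus "(\<lambda>n. fourier \<phi> y * (cis (x \<bullet> y) * gauss (?e n *\<^sub>R y))) \<longlonglongrightarrow> fourier \<phi> y * cis (x \<bullet> y)"
        by simp
    qed
    show "AE y in lborel. norm (fourier \<phi> y * (cis (x \<bullet> y) * gauss (?e n *\<^sub>R y))) \<le> norm (fourier \<phi> y)" for n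
      using ng by (intro AE_I2) (auto simp: norm_mult mult_left_le)
  qed measurable
  moreover have "(\<lambda>n. LINT u|lborel. \<phi> (x + ?e n *\<^sub>R u) * gauss u) \<longlonglongrightarrow> (LINT u|lborel. \<phi> x * gauss (u :: real^'n))"
  proof -
    obtain B where B: "\<And>x. norm (\<phi> x) \<le> B"
      using schwartz_bounded[OF \<phi>] by metis
    show ?thesis
    proof (rule integral_dominated_convergence)
      show "integrable lborel (\<lambda>u::real^'n. B * norm (gauss u))"
        by (intro integrable_mult_right integrable_norm schwartz_integrable gauss_schwartz)
      show "AE u in lborel. (\<lambda>n. \<phi> (x + ?e n *\<^sub>R u) * gauss u) \<longlonglongrightarrow> \<phi> x * gauss u"
      proof (intro AE_I2 tendsto_mult tendsto_const)
        fix u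
        have "isCont \<phi> (x + 0 *\<^sub>R u)"
          using schwartz_continuous[OF \<phi>, of UNIV] by (simp add: continuous_on_eq_continuous_at)
        moreover have "(\<lambda>n. x + ?e n *\<^sub>R u) \<longlonglongrightarrow> x + 0 *\<^sub>R u"
          by (intro tendsto_intros e0)
        ultimately show "(\<lambda>n. \<phi> (x + ?e n *\<^sub>R u)) \<longlonglongrightarrow> \<phi> x"
          using isCont_tendsto_compose by fastforce
      qed
      show "AE u in lborel. norm (\<phi> (x + ?e n *\<^sub>R u) * gauss u) \<le> B * norm (gauss u)" for n
        by (intro AE_I2) (auto simp: norm_mult intro!: mult_right_mono B)
    qed measurable
  qed
  ultimately have "(LINT y|lborel. fourier \<phi> y * cis (x \<bullet> y)) = (LINT u|lborel. \<phi> x * gauss (u :: real^'n))"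
    using eq[of "?e _"] by (auto intro: LIMSEQ_unique)
  also have "\<dots> = \<phi> x * complex_of_real ((2 * pi) powr (real CARD('n) / 2))"
    using integral_gauss[where 'n = 'n] by simp
  finally have "fourier_const TYPE('n) * (LINT y|lborel. fourier \<phi> y * cis (x \<bullet> y)) =
      \<phi> x * (fourier_const TYPE('n) * complex_of_real ((2 * pi) powr (real CARD('n) / 2)))"
    by simp
  also have "\<dots> = \<phi> x"
    by (simp add: of_real_mult[symmetric] powr_add[symmetric] del: of_real_mult)
  finally show "inv_fourier (fourier \<phi>) x = \<phi> x"
    unfolding inv_fourier_eq fourier_cis by (simp add: inner_commute)
qed

lemma fourier_inv_fourier:
  fixes \<phi> :: "'n::finite cfun"
  assumes \<phi>: "\<phi> \<in> schwartz"
  shows "fourier (inv_fourier \<phi>) = \<phi>"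
proof
  fix x :: "real^'n"
  \<comment> \<open>Reflecting the variable exchanges the two orders of composition.\<close>
  have "(LINT y|lborel. inv_fourier \<phi> y * cis (- (y \<bullet> x))) = (LINT y|lborel. fourier \<phi> y * cis (- (y \<bullet> (- x))))"
    by (subst integral_lborel_affine[of "-1" _ 0]) (auto simp: inv_fourier_eq)
  hence "fourier (inv_fourier \<phi>) x = inv_fourier (fourier \<phi>) x"
    unfolding inv_fourier_eq[of "fourier \<phi>"] fourier_cis by simp
  thus "fourier (inv_fourier \<phi>) x = \<phi> x"
    by (simp add: inv_fourier_fourier \<phi>)
qed

section \<open>Multipliers with an integrable kernel\<close>

text \<open>Symbols of convolution operators whose kernel is an integrable function plus a multiple of
  the Dirac measure; \<open>C\<close> bounds the total mass of the kernel.\<close>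

definition L1_multiplier :: "real \<Rightarrow> 'n::finite cfun \<Rightarrow> bool" where
  "L1_multiplier C m \<longleftrightarrow> (\<exists>a k. integrable lborel k \<and> norm a + (LINT y|lborel. norm (k y)) \<le> C \<and>
     (\<forall>\<xi>. m \<xi> = a + (LINT y|lborel. k y * cis (- (y \<bullet> \<xi>)))))"

lemma L1_multiplierI:
  assumes "integrable lborel k" "norm a + (LINT y|lborel. norm (k y)) \<le> C"
    "\<And>\<xi>. m \<xi> = a + (LINT y|lborel. k y * cis (- (y \<bullet> \<xi>)))"
  shows "L1_multiplier C m"
  using assms unfolding L1_multiplier_def by blast

lemma L1_multiplierE:
  assumes "L1_multiplier C m"
  obtains k a where "integrable lborel k" "norm a + (LINT y|lborel. norm (k y)) \<le> C"
    "\<forall>\<xi>. m \<xi> = a + (LINT y|lborel. k y * cis (- (y \<bullet> \<xi>)))"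
  using assms unfolding L1_multiplier_def by auto

lemma L1_multiplier_nonneg:
  assumes "L1_multiplier C m"
  shows "C \<ge> 0"
proof (rule L1_multiplierE[OF assms])
  fix k a assume "norm a + (LINT y|lborel. norm (k y)) \<le> C"
  moreover have "(LINT y|lborel. norm (k y)) \<ge> 0"
    by simp
  ultimately show "C \<ge> 0"
    using norm_ge_zero[of a] by linarith
qed

lemma L1_multiplier_mono:
  assumes "L1_multiplier C m" "C \<le> C'"
  shows "L1_multiplier C' m"
proof (rule L1_multiplierE[OF assms(1)])
  fix k a assume "integrable lborel k" "norm a + (LINT y|lborel. norm (k y)) \<le> C"
    "\<forall>\<xi>. m \<xi> = a + (LINT y|lborel. k y * cis (- (y \<bullet> \<xi>)))"
  thus "L1_multiplier C' m"
    using assms(2) by (intro L1_multiplierI[of k a]) auto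
qed

section \<open>Sums, products and series of multipliers\<close>

lemma L1_multiplier_const: "L1_multiplier (norm a) (\<lambda>_. a)"
  by (rule L1_multiplierI[of "\<lambda>_. 0" a]) auto

lemma L1_multiplier_add:
  assumes "L1_multiplier C m" "L1_multiplier C' m'"
  shows "L1_multiplier (C + C') (\<lambda>\<xi>. m \<xi> + m' \<xi>)"
proof -
  obtain k a where k: "integrable lborel k" "norm a + (LINT y|lborel. norm (k y)) \<le> C"
      "\<forall>\<xi>. m \<xi> = a + (LINT y|lborel. k y * cis (- (y \<bullet> \<xi>)))"
    by (rule L1_multiplierE[OF assms(1)])
  obtain k' a' where k': "integrable lborel k'" "norm a' + (LINT y|lborel. norm (k' y)) \<le> C'"
      "\<forall>\<xi>. m' \<xi> = a' + (LINT y|lborel. k' y * cis (- (y \<bullet> \<xi>)))"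
    by (rule L1_multiplierE[OF assms(2)])
  show ?thesis
  proof (rule L1_multiplierI[of "\<lambda>y. k y + k' y" "a + a'"])
    have "(LINT y|lborel. norm (k y + k' y)) \<le> (LINT y|lborel. norm (k y) + norm (k' y))"
      using k(1) k'(1) by (intro integral_mono) (auto intro: norm_triangle_ineq)
    also have "\<dots> = (LINT y|lborel. norm (k y)) + (LINT y|lborel. norm (k' y))"
      using k(1) k'(1) by simp
    finally show "norm (a + a') + (LINT y|lborel. norm (k y + k' y)) \<le> C + C'"
      using k(2) k'(2) norm_triangle_ineq[of a a'] by linarith
    show "m \<xi> + m' \<xi> = a + a' + (LINT y|lborel. (k y + k' y) * cis (- (y \<bullet> \<xi>)))" for \<xi>
      using k(1) k'(1) by (simp add: k(3)[rule_format] k'(3)[rule_format] distrib_right)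
  qed (use k(1) k'(1) in auto)
qed

lemma L1_multiplier_cmult:
  assumes "L1_multiplier C m"
  shows "L1_multiplier (norm c * C) (\<lambda>\<xi>. c * m \<xi>)"
proof -
  obtain k a where k: "integrable lborel k" "norm a + (LINT y|lborel. norm (k y)) \<le> C"
      "\<forall>\<xi>. m \<xi> = a + (LINT y|lborel. k y * cis (- (y \<bullet> \<xi>)))"
    by (rule L1_multiplierE[OF assms])
  show ?thesis
  proof (rule L1_multiplierI[of "\<lambda>y. c * k y" "c * a"])
    show "norm (c * a) + (LINT y|lborel. norm (c * k y)) \<le> norm c * C"
      using mult_left_mono[OF k(2), of "norm c"] by (simp add: norm_mult distrib_left)
  qed (use k(1) in \<open>auto simp: k(3)[rule_format] distrib_left mult.assoc\<close>)
qed

text \<open>Minkowski's integral inequality and Fubini for a family of kernels. The parameter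
  measure is left general because it is used over R^n, for convolution of kernels, and over the real
  line, for Gamma integrals.\<close>

lemma kernel_superposition:
  fixes M :: "'a measure" and k :: "'a \<Rightarrow> 'n::finite cfun"
  assumes "sigma_finite_measure M"
    and [measurable]: "case_prod k \<in> borel_measurable (M \<Otimes>\<^sub>M lborel)"
    and k: "\<And>t. integrable lborel (k t)"
    and w: "integrable M (\<lambda>t. LINT y|lborel. norm (k t y))"
  shows "integrable lborel (\<lambda>y. LINT t|M. k t y)"
    and "(LINT y|lborel. norm (LINT t|M. k t y)) \<le> (LINT t|M. LINT y|lborel. norm (k t y))"
    and "(LINT y|lborel. (LINT t|M. k t y) * cis (- (y \<bullet> \<xi>))) = (LINT t|M. LINT y|lborel. k t y * cis (- (y \<bullet> \<xi>)))"
proof -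
  interpret M: sigma_finite_measure M by fact
  interpret P: pair_sigma_finite M "lborel :: (real^'n) measure" ..
  have I: "integrable (M \<Otimes>\<^sub>M lborel) (case_prod k)"
    by (rule P.Fubini_integrable) (use k w in auto)
  have In: "integrable (M \<Otimes>\<^sub>M lborel) (\<lambda>(t, y). norm (k t y))"
    using integrable_norm[OF I] by (simp add: case_prod_unfold)
  show 1: "integrable lborel (\<lambda>y. LINT t|M. k t y)"
    using P.integrable_snd[OF I] .
  have "(LINT y|lborel. norm (LINT t|M. k t y)) \<le> (LINT y|lborel. LINT t|M. norm (k t y))"
    by (intro integral_mono integrable_norm 1 P.integrable_snd[OF In] integral_norm_bound)
  also have "\<dots> = (LINT t|M. LINT y|lborel. norm (k t y))"
    by (rule P.Fubini_integral[OF In])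
  finally show "(LINT y|lborel. norm (LINT t|M. k t y)) \<le> (LINT t|M. LINT y|lborel. norm (k t y))" .
  have I': "integrable (M \<Otimes>\<^sub>M lborel) (\<lambda>(t, y). k t y * cis (- (y \<bullet> \<xi>)))"
    by (rule Bochner_Integration.integrable_bound[OF I]) (auto simp: norm_mult)
  have "(LINT y|lborel. (LINT t|M. k t y) * cis (- (y \<bullet> \<xi>))) = (LINT y|lborel. LINT t|M. k t y * cis (- (y \<bullet> \<xi>)))"
    by simp
  also have "\<dots> = (LINT t|M. LINT y|lborel. k t y * cis (- (y \<bullet> \<xi>)))"
    by (rule P.Fubini_integral[OF I'])
  finally show "(LINT y|lborel. (LINT t|M. k t y) * cis (- (y \<bullet> \<xi>))) = (LINT t|M. LINT y|lborel. k t y * cis (- (y \<bullet> \<xi>)))" .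
qed

lemma integrable_translate:
  fixes g :: "'n::finite cfun"
  assumes "integrable lborel g"
  shows "integrable lborel (\<lambda>x. g (x - t))" "(LINT x|lborel. norm (g (x - t))) = (LINT x|lborel. norm (g x))"
proof -
  show "integrable lborel (\<lambda>x. g (x - t))"
    using integrable_lborel_affine[OF assms, of 1 "- t"] by simp
  have "(LINT x|lborel. norm (g x)) = 1 *\<^sub>R (LINT x|lborel. norm (g (- t + 1 *\<^sub>R x)))"
    by (subst integral_lborel_affine[of 1 _ "- t"]) (simp_all only: abs_one power_one zero_neq_one[symmetric] simp_thms)
  thus "(LINT x|lborel. norm (g (x - t))) = (LINT x|lborel. norm (g x))"
    by simp
qed

text \<open>Symbols multiply when kernels are convolved. With the Dirac parts expanded the new
  kernel is a k' + a' k + k * k', and the mass bound is the product of the two masses. The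
  convolution is a superposition over t of translates of k' with weight k t.\<close>

lemma L1_multiplier_mult:
  fixes m m' :: "'n::finite cfun"
  assumes "L1_multiplier C m" "L1_multiplier C' m'"
  shows "L1_multiplier (C * C') (\<lambda>\<xi>. m \<xi> * m' \<xi>)"
proof -
  obtain k a where k: "integrable lborel k" "norm a + (LINT y|lborel. norm (k y)) \<le> C"
      "\<forall>\<xi>. m \<xi> = a + (LINT y|lborel. k y * cis (- (y \<bullet> \<xi>)))"
    by (rule L1_multiplierE[OF assms(1)])
  obtain k' a' where k': "integrable lborel k'" "norm a' + (LINT y|lborel. norm (k' y)) \<le> C'"
      "\<forall>\<xi>. m' \<xi> = a' + (LINT y|lborel. k' y * cis (- (y \<bullet> \<xi>)))"
    by (rule L1_multiplierE[OF assms(2)])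
  have [measurable]: "k \<in> borel_measurable borel" "k' \<in> borel_measurable borel"
    using k(1) k'(1) by auto
  let ?c = "\<lambda>t y. k t * k' (y - t)"
  have c: "sigma_finite_measure (lborel :: (real^'n) measure)"
    "case_prod ?c \<in> borel_measurable (lborel \<Otimes>\<^sub>M lborel)"
    "\<And>t. integrable lborel (?c t)"
    "integrable lborel (\<lambda>t. LINT y|lborel. norm (?c t y))"
  proof -
    show "integrable lborel (?c t)" for t
      by (intro integrable_mult_right integrable_translate k'(1))
    show "integrable lborel (\<lambda>t. LINT y|lborel. norm (?c t y))"
      using k(1) by (simp add: norm_mult integrable_translate(2)[OF k'(1)])
    show "case_prod ?c \<in> borel_measurable (lborel \<Otimes>\<^sub>M lborel)"
      by measurable
  qed (rule sigma_finite_lborel)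
  note conv = kernel_superposition[OF c]
  have "(LINT t|lborel. LINT y|lborel. norm (?c t y)) = (LINT y|lborel. norm (k y)) * (LINT y|lborel. norm (k' y))"
    by (simp add: norm_mult integrable_translate(2)[OF k'(1)])
  note conv_bound = conv(2)[unfolded this]
  have conv_hat: "(LINT y|lborel. (LINT t|lborel. ?c t y) * cis (- (y \<bullet> \<xi>))) =
      (LINT y|lborel. k y * cis (- (y \<bullet> \<xi>))) * (LINT y|lborel. k' y * cis (- (y \<bullet> \<xi>)))" for \<xi>
  proof -
    have "(LINT y|lborel. ?c t y * cis (- (y \<bullet> \<xi>))) = k t * cis (- (t \<bullet> \<xi>)) * (LINT y|lborel. k' y * cis (- (y \<bullet> \<xi>)))" for t
    proof -
      have "(LINT y|lborel. ?c t y * cis (- (y \<bullet> \<xi>))) = (LINT y|lborel. k t * cis (- (t \<bullet> \<xi>)) * (k' y * cis (- (y \<bullet> \<xi>))))"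
        by (subst integral_lborel_affine[of 1 _ t]) (auto simp: inner_add_left cis_mult mult_ac add_ac intro!: Bochner_Integration.integral_cong)
      thus ?thesis by simp
    qed
    thus ?thesis
      unfolding conv(3) by simp
  qed
  let ?K = "\<lambda>y. a * k' y + a' * k y + (LINT t|lborel. ?c t y)"
  show ?thesis
  proof (rule L1_multiplierI[of ?K "a * a'"])
    show "integrable lborel ?K"
      using k(1) k'(1) conv(1) by auto
    have "(LINT y|lborel. norm (?K y)) \<le> (LINT y|lborel. norm a * norm (k' y) + norm a' * norm (k y) + norm (LINT t|lborel. ?c t y))"
      using k(1) k'(1) conv(1)
      by (intro integral_mono)
         (auto simp: norm_mult[symmetric] intro!: order_trans[OF norm_triangle_ineq] add_mono norm_triangle_ineq)
    also have "\<dots> = norm a * (LINT y|lborel. norm (k' y)) + norm a' * (LINT y|lborel. norm (k y)) +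
        (LINT y|lborel. norm (LINT t|lborel. ?c t y))"
      using k(1) k'(1) conv(1) by simp
    also have "\<dots> \<le> norm a * (LINT y|lborel. norm (k' y)) + norm a' * (LINT y|lborel. norm (k y)) +
        (LINT y|lborel. norm (k y)) * (LINT y|lborel. norm (k' y))"
      using conv_bound by simp
    finally have "norm (a * a') + (LINT y|lborel. norm (?K y)) \<le>
        (norm a + (LINT y|lborel. norm (k y))) * (norm a' + (LINT y|lborel. norm (k' y)))"
      by (simp add: norm_mult algebra_simps)
    also have "\<dots> \<le> C * C'"
      using L1_multiplier_nonneg[OF assms(1)] by (intro mult_mono k(2) k'(2)) (auto intro!: add_nonneg_nonneg)
    finally show "norm (a * a') + (LINT y|lborel. norm (?K y)) \<le> C * C'" .
    show "m \<xi> * m' \<xi> = a * a' + (LINT y|lborel. ?K y * cis (- (y \<bullet> \<xi>)))" for \<xi>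
    proof -
      have "(LINT y|lborel. ?K y * cis (- (y \<bullet> \<xi>))) = (LINT y|lborel. a * (k' y * cis (- (y \<bullet> \<xi>))) + a' * (k y * cis (- (y \<bullet> \<xi>)))
         + (LINT t|lborel. ?c t y) * cis (- (y \<bullet> \<xi>)))"
        by (simp only: distrib_right mult.assoc)
      also have "\<dots> = a * (LINT y|lborel. k' y * cis (- (y \<bullet> \<xi>))) + a' * (LINT y|lborel. k y * cis (- (y \<bullet> \<xi>)))
         + (LINT y|lborel. (LINT t|lborel. ?c t y) * cis (- (y \<bullet> \<xi>)))"
        using integrable_mult_cis[OF k(1), of "\<lambda>y. - (y \<bullet> \<xi>)"] integrable_mult_cis[OF k'(1), of "\<lambda>y. - (y \<bullet> \<xi>)"] 
          integrable_mult_cis[OF conv(1), of "\<lambda>y. - (y \<bullet> \<xi>)"]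
        by (simp del: integral_mult_left_zero integral_mult_left)
      finally show ?thesis
        unfolding conv_hat k(3)[rule_format] k'(3)[rule_format] by (simp add: algebra_simps)
    qed
  qed
qed

lemma L1_multiplier_power:
  "L1_multiplier C m \<Longrightarrow> L1_multiplier (C ^ k) (\<lambda>\<xi>. m \<xi> ^ k)"
proof (induction k)
  case 0
  show ?case using L1_multiplier_const[of 1] by simp
next
  case (Suc k)
  show ?case using L1_multiplier_mult[OF Suc.prems Suc.IH[OF Suc.prems]] by simp
qed

lemma L1_multiplier_sum:
  assumes "finite I" "\<And>i. i \<in> I \<Longrightarrow> L1_multiplier (C i) (m i)"
  shows "L1_multiplier (\<Sum>i\<in>I. C i) (\<lambda>\<xi>. \<Sum>i\<in>I. m i \<xi>)"
  using assms
proof (induction rule: finite_induct)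
  case empty
  show ?case using L1_multiplier_const[of 0] by simp
next
  case (insert i I)
  then have "L1_multiplier (C i + (\<Sum>i\<in>I. C i)) (\<lambda>\<xi>. m i \<xi> + (\<Sum>i\<in>I. m i \<xi>))"
    by (intro L1_multiplier_add) auto
  with insert(1,2) show ?case by simp
qed

text \<open>The completeness of L^1: the masses are summable, so by Tonelli the kernels converge
  absolutely almost everywhere, and both the mass bound and the transform pass through the
  series.\<close>

lemma L1_multiplier_suminf:
  fixes m :: "nat \<Rightarrow> 'n::finite cfun"
  assumes m: "\<And>i. L1_multiplier (C i) (m i)" and C: "summable C"
    and sums: "\<And>\<xi>. (\<lambda>i. m i \<xi>) sums M \<xi>"
  shows "L1_multiplier (\<Sum>i. C i) M"
proof -
  \<comment> \<open>Names the defining property so that one kernel and one Dirac coefficient can be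
    chosen for each index simultaneously.\<close>
  define Q where "Q i a k \<longleftrightarrow> integrable lborel k \<and> norm a + (LINT y|lborel. norm (k y)) \<le> C i \<and>
     (\<forall>\<xi>. m i \<xi> = a + (LINT y|lborel. k y * cis (- (y \<bullet> \<xi>))))" for i and a :: complex and k :: "'n cfun"
  have "\<exists>a k. Q i a k" for i
    using m[of i] unfolding L1_multiplier_def Q_def .
  then obtain a k where "Q i (a i) (k i)" for i
    by metis
  hence k: "integrable lborel (k i)" and
    le: "norm (a i) + (LINT y|lborel. norm (k i y)) \<le> C i" and
    eq: "m i \<xi> = a i + (LINT y|lborel. k i y * cis (- (y \<bullet> \<xi>)))" for i \<xi>
    unfolding Q_def by blast+
  have nn: "(LINT y|lborel. norm (k i y)) \<ge> 0" for i
    by simp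
  have "norm (a i) \<le> C i" for i
    using le[of i] nn[of i] by linarith
  hence "norm (norm (a i)) \<le> C i" for i
    by simp
  hence sa: "summable (\<lambda>i. norm (a i))"
    by (intro summable_comparison_test'[OF C])
  have "(LINT y|lborel. norm (k i y)) \<le> C i" for i
    using le[of i] norm_ge_zero[of "a i"] by linarith
  hence "norm (LINT y|lborel. norm (k i y)) \<le> C i" for i
    using nn[of i] by simp
  hence sk: "summable (\<lambda>i. LINT y|lborel. norm (k i y))"
    by (intro summable_comparison_test'[OF C])
  have [measurable]: "k i \<in> borel_measurable borel" for i
    using k[of i] by auto
  have AE_s: "AE y in lborel. summable (\<lambda>i. norm (k i y))"
  proof -
    have "(\<integral>\<^sup>+y. (\<Sum>i. ennreal (norm (k i y))) \<partial>lborel) = (\<Sum>i. \<integral>\<^sup>+y. ennreal (norm (k i y)) \<partial>lborel)"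
      by (rule nn_integral_suminf) auto
    also have "\<dots> = (\<Sum>i. ennreal (LINT y|lborel. norm (k i y)))"
      using k by (intro suminf_cong nn_integral_eq_integral) auto
    also have "\<dots> \<noteq> \<infinity>"
      using sk by (simp add: ennreal_suminf_neq_top)
    finally have "AE y in lborel. (\<Sum>i. ennreal (norm (k i y))) \<noteq> \<infinity>"
      by (intro nn_integral_PInf_AE) auto
    thus ?thesis
      by eventually_elim (auto intro: summable_suminf_not_top)
  qed
  let ?K = "\<lambda>y. \<Sum>i. k i y"
  show ?thesis
  proof (rule L1_multiplierI[of ?K "\<Sum>i. a i"])
    show iK: "integrable lborel ?K"
      by (rule integrable_suminf[OF k AE_s sk])
    have isn: "integrable lborel (\<lambda>y. \<Sum>i. norm (k i y))"
      by (rule integrable_suminf) (use k AE_s sk in auto)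
    have "(LINT y|lborel. norm (?K y)) \<le> (LINT y|lborel. (\<Sum>i. norm (k i y)))"
      by (rule integral_mono_AE[OF integrable_norm[OF iK] isn]) (use AE_s in eventually_elim, rule summable_norm)
    also have "\<dots> = (\<Sum>i. LINT y|lborel. norm (k i y))"
      by (rule integral_suminf) (use k AE_s sk in auto)
    finally have "norm (\<Sum>i. a i) + (LINT y|lborel. norm (?K y)) \<le> (\<Sum>i. norm (a i)) + (\<Sum>i. LINT y|lborel. norm (k i y))"
      using summable_norm[OF sa] by simp
    also have "\<dots> = (\<Sum>i. norm (a i) + (LINT y|lborel. norm (k i y)))"
      by (rule suminf_add[OF sa sk])
    also have "\<dots> \<le> (\<Sum>i. C i)"
      by (intro suminf_le le summable_add sa sk C)
    finally show "norm (\<Sum>i. a i) + (LINT y|lborel. norm (?K y)) \<le> (\<Sum>i. C i)" .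
    fix \<xi>
    have "(\<lambda>i. LINT y|lborel. k i y * cis (- (y \<bullet> \<xi>))) sums (LINT y|lborel. (\<Sum>i. k i y * cis (- (y \<bullet> \<xi>))))"
      by (rule sums_integral) (use k AE_s sk in \<open>auto simp: norm_mult intro!: integrable_mult_cis\<close>)
    also have "(LINT y|lborel. (\<Sum>i. k i y * cis (- (y \<bullet> \<xi>)))) = (LINT y|lborel. ?K y * cis (- (y \<bullet> \<xi>)))"
    proof (rule integral_cong_AE)
      show "AE y in lborel. (\<Sum>i. k i y * cis (- (y \<bullet> \<xi>))) = ?K y * cis (- (y \<bullet> \<xi>))"
        using AE_s by eventually_elim (metis suminf_mult2 summable_norm_cancel)
    qed measurable
    finally have "(\<lambda>i. m i \<xi>) sums ((\<Sum>i. a i) + (LINT y|lborel. ?K y * cis (- (y \<bullet> \<xi>))))"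
      unfolding eq using sa by (intro sums_add summable_sums) (auto dest: summable_norm_cancel)
    with sums show "M \<xi> = (\<Sum>i. a i) + (LINT y|lborel. ?K y * cis (- (y \<bullet> \<xi>)))"
      using sums_unique2 by blast
  qed
qed

section \<open>Resolvent powers as superpositions of Gaussians\<close>

lemma has_bochner_integral_Gamma:
  fixes \<theta> c :: real
  assumes "\<theta> > 0" "c > 0"
  shows "has_bochner_integral lborel (\<lambda>t. indicator {0<..} t * (t powr (\<theta> - 1) * exp (- c * t))) (Gamma \<theta> * c powr (- \<theta>))"
proof -
  have "(\<integral>\<^sup>+t. ennreal (indicator {0<..} t * (t powr (\<theta> - 1) * exp (- t))) \<partial>lborel) = ennreal (Gamma \<theta>)"
  proof -
    have "(\<integral>\<^sup>+t. ennreal (indicator {0<..} t * (t powr (\<theta> - 1) * exp (- t))) \<partial>lborel) =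
       (\<integral>\<^sup>+t. ennreal (indicator {0..} t * t powr (\<theta> - 1) / exp t) \<partial>lborel)"
      by (intro nn_integral_cong) (auto simp: indicator_def exp_minus field_simps)
    thus ?thesis
      using Gamma_conv_nn_integral_real[OF assms(1)] by simp
  qed
  hence "has_bochner_integral lborel (\<lambda>t. indicator {0<..} t * (t powr (\<theta> - 1) * exp (- t))) (Gamma \<theta>)"
    using assms(1) by (intro has_bochner_integral_nn_integral) (auto intro: Gamma_real_nonneg)
  from lborel_has_bochner_integral_real_affine_iff[THEN iffD1, OF _ this, of c 0] assms(2)
  have "has_bochner_integral lborel (\<lambda>t. indicator {0<..} (c * t) * ((c * t) powr (\<theta> - 1) * exp (- (c * t)))) (Gamma \<theta> / c)"
    by (simp add: divide_inverse mult.commute)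
  \<comment> \<open>After the substitution t -> c t the factor c^(1 - \<theta>) restores the
    integrand t^(\<theta> - 1).\<close>
  hence "has_bochner_integral lborel (\<lambda>t. c powr (1 - \<theta>) * (indicator {0<..} (c * t) * ((c * t) powr (\<theta> - 1) * exp (- (c * t))))) 
      (c powr (1 - \<theta>) * (Gamma \<theta> / c))"
    by (rule has_bochner_integral_mult_right)
  also have "(\<lambda>t. c powr (1 - \<theta>) * (indicator {0<..} (c * t) * ((c * t) powr (\<theta> - 1) * exp (- (c * t))))) =
    (\<lambda>t. indicator {0<..} t * (t powr (\<theta> - 1) * exp (- c * t)))"
  proof
    fix t
    have "c powr (1 - \<theta>) * c powr (\<theta> - 1) = 1"
      using assms by (simp add: powr_add[symmetric])
    thus "c powr (1 - \<theta>) * (indicator {0<..} (c * t) * ((c * t) powr (\<theta> - 1) * exp (- (c * t)))) =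
       indicator {0<..} t * (t powr (\<theta> - 1) * exp (- c * t))"
      using assms by (cases "t > 0") (auto simp: indicator_def powr_mult zero_less_mult_iff mult.assoc[symmetric])
  qed
  also have "c powr (1 - \<theta>) * (Gamma \<theta> / c) = Gamma \<theta> * c powr (- \<theta>)"
    using assms by (simp add: powr_diff powr_minus field_simps)
  finally show ?thesis .
qed

text \<open>The kernel of \<open>P (c + d|\<xi>|\<^sup>2)\<^sup>-\<^sup>\<theta>\<close> is a superposition of dilates of \<open>\<eta>\<close>, the kernel of
  \<open>P exp(-|\<xi>|\<^sup>2)\<close>, obtained from the Gamma integral.\<close>

lemma L1_multiplier_resolvent:
  fixes \<eta> P :: "'n::finite cfun"
  assumes \<eta>: "integrable lborel \<eta>"
    and \<eta>_hat: "\<And>\<xi>. (LINT y|lborel. \<eta> y * cis (- (y \<bullet> \<xi>))) = P \<xi> * complex_of_real (exp (- (norm \<xi>)\<^sup>2))"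
    and hom: "\<And>r \<xi>. r > 0 \<Longrightarrow> P (r *\<^sub>R \<xi>) = complex_of_real (r ^ L) * P \<xi>"
    and \<theta>: "\<theta> > real L / 2" and cd: "c > 0" "d > 0"
  shows "L1_multiplier ((LINT y|lborel. norm (\<eta> y)) * (Gamma (\<theta> - real L / 2) / Gamma \<theta>) * c powr (real L / 2 - \<theta>) * d powr (- real L / 2))
    (\<lambda>\<xi>. P \<xi> * complex_of_real ((c + d * (norm \<xi>)\<^sup>2) powr (- \<theta>)))"
proof -
  have \<theta>0: "\<theta> > 0" using \<theta> by (meson divide_nonneg_nonneg le_less_trans of_nat_0_le_iff zero_le_numeral)
  have [measurable]: "\<eta> \<in> borel_measurable borel"
    using \<eta> by auto
  \<comment> \<open>With this width, dilation turns exp(-|\<xi>|^2) into exp(-d t |\<xi>|^2).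
    Homogeneity of \<open>P\<close> then costs r^(-L), which the last factor (d t)^(-L/2) = r^L of
    \<open>w\<close> repays.\<close>
  define r where "r t = 1 / sqrt (d * t)" for t
  define w where "w t = indicator {0<..} t * (t powr (\<theta> - 1) * exp (- c * t)) / Gamma \<theta> * ((d * t) powr (- real L / 2))" for t
  define k where "k t y = complex_of_real (w t * r t ^ CARD('n)) * \<eta> (r t *\<^sub>R y)" for t y
  have r: "r t > 0" if "t > 0" for t
    using that cd by (simp add: r_def)
  have w0: "w t \<ge> 0" for t
    unfolding w_def using \<theta>0 by (intro mult_nonneg_nonneg divide_nonneg_nonneg) (auto intro: Gamma_real_nonneg)
  have w_neg: "w t = 0" if "\<not> t > 0" for t
    using that by (simp add: w_def)
  have rpow: "(d * t) powr (- real L / 2) = r t ^ L" if "t > 0" for t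
  proof -
    have "(d * t) powr (- real L / 2) = ((d * t) powr (- 1 / 2)) powr real L"
      by (simp add: powr_powr)
    also have "\<dots> = ((d * t) powr (- 1 / 2)) ^ L"
      using that cd by (intro powr_realpow) auto
    also have "(d * t) powr (- 1 / 2) = r t"
      using that cd powr_half_sqrt[of "d * t"] powr_minus_divide[of "d * t" "1 / 2"] by (simp add: r_def)
    finally show ?thesis .
  qed
  \<comment> \<open>The factor t^(-L/2) lowers the Gamma exponent to \<theta> - L/2. Its positivity
    is what keeps the total mass integrable at t = 0.\<close>
  have wi: "has_bochner_integral lborel w (d powr (- real L / 2) / Gamma \<theta> * (Gamma (\<theta> - real L / 2) * c powr (real L / 2 - \<theta>)))"
  proof -
    have "has_bochner_integral lborel (\<lambda>t. d powr (- real L / 2) / Gamma \<theta> * (indicator {0<..} t * (t powr ((\<theta> - real L / 2) - 1) * exp (- c * t))))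
      (d powr (- real L / 2) / Gamma \<theta> * (Gamma (\<theta> - real L / 2) * c powr (- (\<theta> - real L / 2))))"
      using \<theta> cd by (intro has_bochner_integral_mult_right has_bochner_integral_Gamma) auto
    also have "(\<lambda>t. d powr (- real L / 2) / Gamma \<theta> * (indicator {0<..} t * (t powr ((\<theta> - real L / 2) - 1) * exp (- c * t)))) = w"
    proof
      fix t
      show "d powr (- real L / 2) / Gamma \<theta> * (indicator {0<..} t * (t powr ((\<theta> - real L / 2) - 1) * exp (- c * t))) = w t"
      proof (cases "t > 0")
        case True
        have "t powr ((\<theta> - real L / 2) - 1) = t powr (\<theta> - 1) * t powr (- real L / 2)"
          by (simp add: powr_add[symmetric] algebra_simps)
        then show ?thesis
          using True cd unfolding w_def by (subst powr_mult) (auto simp: mult_ac)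
      qed (simp add: w_def)
    qed
    finally show ?thesis by simp
  qed
  have kt: "integrable lborel (k t)" and knorm: "(LINT y|lborel. norm (k t y)) = w t * (LINT y|lborel. norm (\<eta> y))"
    and khat: "(LINT y|lborel. k t y * cis (- (y \<bullet> \<xi>))) = 
      P \<xi> * complex_of_real (indicator {0<..} t * (t powr (\<theta> - 1) * exp (- (c + d * (norm \<xi>)\<^sup>2) * t)) / Gamma \<theta>)" for t \<xi>
  proof -
    have "integrable lborel (k t) \<and> (LINT y|lborel. norm (k t y)) = w t * (LINT y|lborel. norm (\<eta> y)) \<and>
      (LINT y|lborel. k t y * cis (- (y \<bullet> \<xi>))) = 
      P \<xi> * complex_of_real (indicator {0<..} t * (t powr (\<theta> - 1) * exp (- (c + d * (norm \<xi>)\<^sup>2) * t)) / Gamma \<theta>)"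
    proof (cases "t > 0")
      case True
      note r = r[OF True]
      have 1: "integrable lborel (k t)"
        unfolding k_def using integrable_lborel_affine[OF \<eta>, of "r t" 0] r by auto
      have "(LINT y|lborel. norm (k t y)) = w t * (r t ^ CARD('n) * (LINT y|lborel. norm (\<eta> (r t *\<^sub>R y))))"
        unfolding k_def using w0[of t] r by (simp add: norm_mult abs_mult norm_power)
      also have "r t ^ CARD('n) * (LINT y|lborel. norm (\<eta> (r t *\<^sub>R y))) = (LINT y|lborel. norm (\<eta> y))"
        using r integral_lborel_affine[of "r t" "\<lambda>y. norm (\<eta> y)" 0] by simp
      finally have 2: "(LINT y|lborel. norm (k t y)) = w t * (LINT y|lborel. norm (\<eta> y))" .
      define \<zeta> where "\<zeta> = (1 / r t) *\<^sub>R \<xi>"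
      have \<zeta>: "(r t *\<^sub>R y) \<bullet> \<zeta> = y \<bullet> \<xi>" for y
        using r by (simp add: \<zeta>_def)
      have "(LINT y|lborel. k t y * cis (- (y \<bullet> \<xi>))) = 
        complex_of_real (w t) * ((r t ^ CARD('n)) *\<^sub>R (LINT y|lborel. \<eta> (r t *\<^sub>R y) * cis (- ((r t *\<^sub>R y) \<bullet> \<zeta>))))"
        unfolding \<zeta> k_def by (simp add: scaleR_conv_of_real mult.assoc)
      also have "(r t ^ CARD('n)) *\<^sub>R (LINT y|lborel. \<eta> (r t *\<^sub>R y) * cis (- ((r t *\<^sub>R y) \<bullet> \<zeta>))) = (LINT y|lborel. \<eta> y * cis (- (y \<bullet> \<zeta>)))"
        using r by (subst integral_lborel_affine[of "r t" _ 0]) auto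
      also have "\<dots> = P \<zeta> * complex_of_real (exp (- (norm \<zeta>)\<^sup>2))"
        by (rule \<eta>_hat)
      also have "P \<zeta> = complex_of_real ((1 / r t) ^ L) * P \<xi>"
        unfolding \<zeta>_def using r by (intro hom) auto
      also have "(norm \<zeta>)\<^sup>2 = d * t * (norm \<xi>)\<^sup>2"
        using True cd by (simp add: \<zeta>_def r_def power_mult_distrib)
      finally have "(LINT y|lborel. k t y * cis (- (y \<bullet> \<xi>))) = 
         P \<xi> * complex_of_real (w t * (1 / r t) ^ L * exp (- (d * t * (norm \<xi>)\<^sup>2)))"
        by (simp add: mult_ac)
      also have "w t * (1 / r t) ^ L * exp (- (d * t * (norm \<xi>)\<^sup>2)) = 
          t powr (\<theta> - 1) * (exp (- c * t) * exp (- (d * t * (norm \<xi>)\<^sup>2))) / Gamma \<theta>"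
        unfolding w_def rpow[OF True] using True r by (simp add: power_divide)
      also have "exp (- c * t) * exp (- (d * t * (norm \<xi>)\<^sup>2)) = exp (- (c + d * (norm \<xi>)\<^sup>2) * t)"
        by (simp add: exp_add[symmetric] algebra_simps)
      finally show ?thesis
        using True 1 2 by simp
    next
      \<comment> \<open>The weight vanishes for t \<le> 0, so the superposition may run over the
        whole line.\<close>
      case False
      then have "k t = (\<lambda>_. 0)" by (simp add: k_def w_neg fun_eq_iff)
      then show ?thesis using False by (simp add: w_neg)
    qed
    thus "integrable lborel (k t)" "(LINT y|lborel. norm (k t y)) = w t * (LINT y|lborel. norm (\<eta> y))"
      "(LINT y|lborel. k t y * cis (- (y \<bullet> \<xi>))) = 
      P \<xi> * complex_of_real (indicator {0<..} t * (t powr (\<theta> - 1) * exp (- (c + d * (norm \<xi>)\<^sup>2) * t)) / Gamma \<theta>)"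
      by auto
  qed
  have w_int: "integrable lborel w" and w_eq: "(LINT t|lborel. w t) = 
      d powr (- real L / 2) / Gamma \<theta> * (Gamma (\<theta> - real L / 2) * c powr (real L / 2 - \<theta>))"
    using wi by (auto simp: has_bochner_integral_iff)
  have [measurable]: "w \<in> borel_measurable borel" "r \<in> borel_measurable borel"
    using w_int by (auto simp: r_def[abs_def])
  have sup: "sigma_finite_measure (lborel :: real measure)"
    "case_prod k \<in> borel_measurable (lborel \<Otimes>\<^sub>M lborel)"
    "\<And>t. integrable lborel (k t)"
    "integrable lborel (\<lambda>t. LINT y|lborel. norm (k t y))"
  proof -
    show "case_prod k \<in> borel_measurable (lborel \<Otimes>\<^sub>M lborel)"
      unfolding k_def by measurable
    show "integrable lborel (\<lambda>t. LINT y|lborel. norm (k t y))"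
      unfolding knorm using w_int by auto
  qed (auto intro: sigma_finite_lborel kt)
  show ?thesis
  proof (rule L1_multiplierI[of "\<lambda>y. LINT t|lborel. k t y" 0])
    show "integrable lborel (\<lambda>y. LINT t|lborel. k t y)"
      by (rule kernel_superposition(1)[OF sup])
    show "norm (0 :: complex) + (LINT y|lborel. norm (LINT t|lborel. k t y)) \<le>
       (LINT y|lborel. norm (\<eta> y)) * (Gamma (\<theta> - real L / 2) / Gamma \<theta>) * c powr (real L / 2 - \<theta>) * d powr (- real L / 2)"
      using kernel_superposition(2)[OF sup] unfolding knorm by (simp add: w_eq mult_ac)
    fix \<xi> :: "real^'n"
    have pos: "c + d * (norm \<xi>)\<^sup>2 > 0"
      using cd by (intro add_pos_nonneg) auto
    have "has_bochner_integral lborel (\<lambda>t. indicator {0<..} t * (t powr (\<theta> - 1) * exp (- (c + d * (norm \<xi>)\<^sup>2) * t)) / Gamma \<theta>)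
      (Gamma \<theta> * (c + d * (norm \<xi>)\<^sup>2) powr (- \<theta>) / Gamma \<theta>)"
      using \<theta>0 pos by (intro has_bochner_integral_divide_zero has_bochner_integral_Gamma)
    hence "(LINT t|lborel. indicator {0<..} t * (t powr (\<theta> - 1) * exp (- (c + d * (norm \<xi>)\<^sup>2) * t)) / Gamma \<theta>) = (c + d * (norm \<xi>)\<^sup>2) powr (- \<theta>)"
      using Gamma_real_pos[OF \<theta>0] by (simp add: has_bochner_integral_iff)
    hence "(LINT t|lborel. LINT y|lborel. k t y * cis (- (y \<bullet> \<xi>))) = P \<xi> * complex_of_real ((c + d * (norm \<xi>)\<^sup>2) powr (- \<theta>))"
      unfolding khat by (subst integral_mult_right_zero, subst integral_complex_of_real) simp
    thus "P \<xi> * complex_of_real ((c + d * (norm \<xi>)\<^sup>2) powr (- \<theta>)) = 0 + (LINT y|lborel. (LINT t|lborel. k t y) * cis (- (y \<bullet> \<xi>)))"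
      unfolding kernel_superposition(3)[OF sup] by simp
  qed
qed

section \<open>Splitting the symbol of a derivative\<close>

text \<open>The sign of -i is that of differentiating \<open>fourier \<phi>\<close> in its own
  variable: distributional derivatives are moved to test functions, and these are written as
  transforms.\<close>

definition deriv_symbol :: "'n::finite list \<Rightarrow> 'n cfun" where
  "deriv_symbol ds \<xi> = prod_list (map (\<lambda>i. - \<i> * complex_of_real (\<xi> $ i)) ds)"

text \<open>A tempered distribution has meaningful values only on Schwartz functions, so a symbol
  may be multiplied into its argument only if the product is Schwartz again.\<close>

definition schwartz_multiplier :: "'n::finite cfun \<Rightarrow> bool" where
  "schwartz_multiplier m \<longleftrightarrow> (\<forall>\<phi>\<in>schwartz. (\<lambda>x. m x * \<phi> x) \<in> schwartz)"

lemma schwartz_multiplierD: "schwartz_multiplier m \<Longrightarrow> \<phi> \<in> schwartz \<Longrightarrow> (\<lambda>x. m x * \<phi> x) \<in> schwartz"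
  by (simp add: schwartz_multiplier_def)

lemma schwartz_multiplier_const: "schwartz_multiplier (\<lambda>_. c)"
  by (simp add: schwartz_multiplier_def schwartz_cmult)

lemma schwartz_multiplier_add:
  "schwartz_multiplier m \<Longrightarrow> schwartz_multiplier m' \<Longrightarrow> schwartz_multiplier (\<lambda>x. m x + m' x)"
  by (simp add: schwartz_multiplier_def distrib_right schwartz_add)

lemma schwartz_multiplier_mult:
  "schwartz_multiplier m \<Longrightarrow> schwartz_multiplier m' \<Longrightarrow> schwartz_multiplier (\<lambda>x. m x * m' x)"
  by (simp add: schwartz_multiplier_def mult.assoc)

lemma schwartz_multiplier_power:
  "schwartz_multiplier m \<Longrightarrow> schwartz_multiplier (\<lambda>x. m x ^ k)"
  by (induction k) (auto intro: schwartz_multiplier_const schwartz_multiplier_mult)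

lemma schwartz_multiplier_sum:
  "finite I \<Longrightarrow> (\<And>i. i \<in> I \<Longrightarrow> schwartz_multiplier (m i)) \<Longrightarrow> schwartz_multiplier (\<lambda>x. \<Sum>i\<in>I. m i x)"
  by (induction I rule: finite_induct) (auto intro: schwartz_multiplier_const schwartz_multiplier_add)

lemma schwartz_multiplier_coord: "schwartz_multiplier (\<lambda>x. complex_of_real (x $ i))"
  by (simp add: schwartz_multiplier_def schwartz_coord_mult)

lemma schwartz_multiplier_powr:
  "c > 0 \<Longrightarrow> d > 0 \<Longrightarrow> schwartz_multiplier (\<lambda>x. complex_of_real ((c + d * (norm x)\<^sup>2) powr \<sigma>))"
  by (simp add: schwartz_multiplier_def schwartz_powr_mult)

lemma schwartz_multiplier_deriv_symbol: "schwartz_multiplier (deriv_symbol ds)"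
proof (induction ds)
  case Nil
  have "deriv_symbol ([] :: 'a list) = (\<lambda>_. 1)"
    by (auto simp: deriv_symbol_def)
  then show ?case using schwartz_multiplier_const[of 1] by simp
next
  case (Cons i ds)
  have "deriv_symbol (i # ds) = (\<lambda>\<xi>. (- \<i>) * complex_of_real (\<xi> $ i) * deriv_symbol ds \<xi>)"
    by (auto simp: deriv_symbol_def)
  then show ?case
    using Cons by (simp only:) (intro schwartz_multiplier_mult schwartz_multiplier_const schwartz_multiplier_coord)
qed

lemma iter_partial_fourier:
  assumes "\<phi> \<in> schwartz"
  shows "iter_partial ds (fourier \<phi>) = fourier (\<lambda>\<xi>. deriv_symbol ds \<xi> * \<phi> \<xi>)"
proof (induction ds)
  case Nil
  then show ?case by (simp add: iter_partial_def deriv_symbol_def)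
next
  case (Cons i ds)
  have "iter_partial (i # ds) (fourier \<phi>) = partial i (fourier (\<lambda>\<xi>. deriv_symbol ds \<xi> * \<phi> \<xi>))"
    using Cons by (simp add: iter_partial_def)
  also have "\<dots> = fourier (\<lambda>\<xi>. deriv_symbol (i # ds) \<xi> * \<phi> \<xi>)"
    by (subst fourier_partial[OF schwartz_multiplierD[OF schwartz_multiplier_deriv_symbol assms]])
       (simp add: deriv_symbol_def mult.assoc)
  finally show ?case .
qed

lemma deriv_symbol_scaleR: "deriv_symbol ds (r *\<^sub>R \<xi>) = complex_of_real (r ^ length ds) * deriv_symbol ds \<xi>"
  by (induction ds) (auto simp: deriv_symbol_def)

text \<open>Produces a kernel for a Schwartz symbol. The constant absorbs the normalisation of
  \<open>fourier\<close>, which \<open>L1_multiplier\<close> omits.\<close>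

lemma fourier_pair_cis:
  fixes u :: "'n::finite cfun"
  assumes "u \<in> schwartz"
  defines "\<eta> \<equiv> \<lambda>y. fourier_const TYPE('n) * inv_fourier u y"
  shows "integrable lborel \<eta>" "(LINT y|lborel. \<eta> y * cis (- (y \<bullet> \<xi>))) = u \<xi>"
proof -
  show "integrable lborel \<eta>"
    unfolding \<eta>_def by (intro integrable_mult_right schwartz_integrable inv_fourier_schwartz assms)
  have "(LINT y|lborel. \<eta> y * cis (- (y \<bullet> \<xi>))) = fourier (inv_fourier u) \<xi>"
    unfolding fourier_cis \<eta>_def by (simp add: mult.assoc)
  thus "(LINT y|lborel. \<eta> y * cis (- (y \<bullet> \<xi>))) = u \<xi>"
    by (simp add: fourier_inv_fourier assms(1))
qed

lemma gauss_sqrt2: "gauss (sqrt 2 *\<^sub>R \<xi>) = complex_of_real (exp (- (norm \<xi>)\<^sup>2))"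
  by (simp add: gauss_def power_mult_distrib)

lemma gauss_sqrt2_schwartz: "(\<lambda>\<xi>. complex_of_real (exp (- (norm \<xi>)\<^sup>2))) \<in> schwartz"
  using schwartz_dilate[OF gauss_schwartz, of "sqrt 2"] by (simp add: gauss_sqrt2)

text \<open>The derivative symbol is homogeneous of degree |ds|. Taking c = 1 and d = h^2 in
  \<open>L1_multiplier_resolvent\<close>, the bound depends on h only through d^(-|ds|/2) =
  h^(-|ds|).\<close>

lemma L1_multiplier_deriv_resolvent:
  assumes "\<theta> > real (length ds) / 2"
  obtains C where "C \<ge> 0" "\<forall>h>0. L1_multiplier (C * h powr (- real (length ds)))
    (\<lambda>\<xi>. deriv_symbol ds \<xi> * complex_of_real ((1 + h\<^sup>2 * (norm \<xi>)\<^sup>2) powr (- \<theta>)))"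
proof -
  let ?L = "length ds"
  define \<eta> where "\<eta> = (\<lambda>y. fourier_const TYPE('a) * inv_fourier (\<lambda>\<xi>. deriv_symbol ds \<xi> * complex_of_real (exp (- (norm \<xi>)\<^sup>2))) y)"
  have *: "integrable lborel \<eta>" 
    "(LINT y|lborel. \<eta> y * cis (- (y \<bullet> \<xi>))) = deriv_symbol ds \<xi> * complex_of_real (exp (- (norm \<xi>)\<^sup>2))" for \<xi>
    unfolding \<eta>_def
    using fourier_pair_cis[OF schwartz_multiplierD[OF schwartz_multiplier_deriv_symbol gauss_sqrt2_schwartz], of ds] .
  define C where "C = (LINT y|lborel. norm (\<eta> y)) * (Gamma (\<theta> - real ?L / 2) / Gamma \<theta>)"
  have "L1_multiplier (C * h powr (- real ?L))
    (\<lambda>\<xi>. deriv_symbol ds \<xi> * complex_of_real ((1 + h\<^sup>2 * (norm \<xi>)\<^sup>2) powr (- \<theta>)))" if h: "h > 0" for h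
  proof -
    have "(h\<^sup>2) powr (- real ?L / 2) = h powr (- real ?L)"
      using h by (simp add: powr_realpow[symmetric] powr_powr del: powr_numeral)
    thus ?thesis
      using L1_multiplier_resolvent[OF * _ assms, of 1 "h\<^sup>2"] h
      by (simp add: deriv_symbol_scaleR C_def)
  qed
  moreover have "\<theta> > 0" 
    using assms by (meson divide_nonneg_nonneg le_less_trans of_nat_0_le_iff zero_le_numeral)
  hence "C \<ge> 0"
    unfolding C_def using assms by (intro mult_nonneg_nonneg divide_nonneg_nonneg Gamma_real_nonneg integral_nonneg_AE) auto
  ultimately show ?thesis by (intro that) auto
qed

text \<open>The bound must be exactly 1, so that all powers of the resolvent keep mass at most 1 and
  can be summed in a binomial series. It is 1 because the Gaussian \<open>\<eta>\<close> is
  nonnegative: its mass is the value of its transform at 0.\<close>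

lemma L1_multiplier_resolvent_exact:
  assumes "h > 0"
  shows "L1_multiplier 1 (\<lambda>\<xi>::real^'n::finite. complex_of_real (1 / (1 + h\<^sup>2 * (norm \<xi>)\<^sup>2)))"
proof -
  define g where "g = (\<lambda>\<xi>::real^'n. complex_of_real (exp (- (norm \<xi>)\<^sup>2)))"
  define \<eta> where "\<eta> = (\<lambda>y. fourier_const TYPE('n) * inv_fourier g y)"
  have g: "g \<in> schwartz"
    unfolding g_def by (rule gauss_sqrt2_schwartz)
  have *: "integrable lborel \<eta>" "(LINT y|lborel. \<eta> y * cis (- (y \<bullet> \<xi>))) = g \<xi>" for \<xi>
    unfolding \<eta>_def using fourier_pair_cis[OF g] .
  have "g = (\<lambda>\<xi>. gauss (sqrt 2 *\<^sub>R \<xi>))"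
    by (simp add: g_def gauss_sqrt2)
  hence "inv_fourier g y = complex_of_real (1 / sqrt 2 ^ CARD('n)) * gauss ((- y) /\<^sub>R sqrt 2)" for y
    by (simp only: inv_fourier_eq fourier_dilate[of "sqrt 2"] real_sqrt_gt_zero fourier_gauss zero_less_numeral)
  hence "\<eta> y = complex_of_real ((2 * pi) powr (- real CARD('n) / 2) *
      (1 / sqrt 2 ^ CARD('n) * exp (- (norm ((- y) /\<^sub>R sqrt 2))\<^sup>2 / 2)))" for y
    by (simp only: \<eta>_def gauss_def of_real_mult)
  moreover have "0 \<le> (2 * pi) powr (- real CARD('n) / 2) *
      (1 / sqrt 2 ^ CARD('n) * exp (- (norm ((- y) /\<^sub>R sqrt 2))\<^sup>2 / 2))" for y :: "real^'n"
    by (intro mult_nonneg_nonneg) auto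
  ultimately have "\<eta> y = complex_of_real (norm (\<eta> y))" for y
    by (simp only: norm_of_real abs_of_nonneg)
  hence "complex_of_real (LINT y|lborel. norm (\<eta> y)) = (LINT y|lborel. \<eta> y * cis (- (y \<bullet> 0)))"
    by (subst integral_complex_of_real[symmetric]) simp
  also have "\<dots> = 1"
    unfolding *(2) by (simp add: g_def)
  finally have 1: "(LINT y|lborel. norm (\<eta> y)) = 1"
    using of_real_eq_1_iff by blast
  have "L1_multiplier ((LINT y|lborel. norm (\<eta> y)) * (Gamma (1 - real 0 / 2) / Gamma 1) * 1 powr (real 0 / 2 - 1) * (h\<^sup>2) powr (- real 0 / 2))
    (\<lambda>\<xi>::real^'n. 1 * complex_of_real ((1 + h\<^sup>2 * (norm \<xi>)\<^sup>2) powr (- 1)))"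
    by (rule L1_multiplier_resolvent[OF *(1)]) (use assms in \<open>auto simp: *(2) g_def\<close>)
  moreover have "1 + h\<^sup>2 * (norm \<xi>)\<^sup>2 > 0" for \<xi> :: "real^'n"
    by (intro add_pos_nonneg) auto
  hence "(1 + h\<^sup>2 * (norm \<xi>)\<^sup>2) powr (- 1) = 1 / (1 + h\<^sup>2 * (norm \<xi>)\<^sup>2)" for \<xi> :: "real^'n"
    by (subst powr_minus_divide) (simp add: less_imp_le)
  ultimately show ?thesis
    using assms 1 by simp
qed

text \<open>Pascal's rule turns \<open>|\<theta> choose (k+1)|\<close> into a telescoping difference of the
  absolute values \<open>|\<theta>-1 choose k|\<close> once \<open>k + 1 \<ge> \<theta>\<close>.\<close>

lemma summable_abs_gbinomial:
  fixes \<theta> :: real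
  assumes "\<theta> > 0"
  shows "summable (\<lambda>k. \<bar>\<theta> gchoose k\<bar>)"
proof -
  define b where "b k = \<bar>(\<theta> - 1) gchoose k\<bar>" for k
  define N where "N = nat \<lceil>\<theta>\<rceil>"
  have step: "\<bar>\<theta> gchoose Suc k\<bar> = b k - b (Suc k)" if "k \<ge> N" for k
  proof -
    have k: "\<theta> \<le> real k + 1"
      using that unfolding N_def by linarith
    define x where "x = (\<theta> - 1) gchoose k"
    have "(\<theta> - 1) * x = real k * x + real (Suc k) * ((\<theta> - 1) gchoose Suc k)"
      unfolding x_def by (rule gbinomial_mult_1)
    hence 1: "(\<theta> - 1) gchoose Suc k = - (x * ((real k + 1 - \<theta>) / (real k + 1)))"
      by (simp add: field_simps)
    have "\<theta> gchoose Suc k = x + ((\<theta> - 1) gchoose Suc k)"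
      using gbinomial_Suc_Suc[of "\<theta> - 1" k] by (simp add: x_def)
    hence 2: "\<theta> gchoose Suc k = x * (\<theta> / (real k + 1))"
      unfolding 1 by (simp add: field_simps)
    have "\<bar>\<theta> gchoose Suc k\<bar> = \<bar>x\<bar> * (\<theta> / (real k + 1))"
      unfolding 2 using assms by (simp add: abs_mult)
    moreover have "b (Suc k) = \<bar>x\<bar> * ((real k + 1 - \<theta>) / (real k + 1))"
      unfolding b_def 1 using k by (simp add: abs_mult)
    moreover have "b k = \<bar>x\<bar>"
      by (simp add: b_def x_def)
    moreover have "\<bar>x\<bar> * (\<theta> / (real k + 1)) = \<bar>x\<bar> - \<bar>x\<bar> * ((real k + 1 - \<theta>) / (real k + 1))"
      by (simp add: field_simps)
    ultimately show ?thesis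
      by simp
  qed
  have "summable (\<lambda>k. \<bar>\<theta> gchoose Suc (k + N)\<bar>)"
  proof (rule summableI_nonneg_bounded)
    fix n
    have "(\<Sum>k<n. \<bar>\<theta> gchoose Suc (k + N)\<bar>) = (\<Sum>k<n. b (k + N) - b (Suc k + N))"
      by (intro sum.cong) (auto simp: step)
    also have "\<dots> = b N - b (n + N)"
      using sum_lessThan_telescope'[of "\<lambda>k. b (k + N)" n] by simp
    also have "\<dots> \<le> b N"
      by (simp add: b_def)
    finally show "(\<Sum>k<n. \<bar>\<theta> gchoose Suc (k + N)\<bar>) \<le> b N" .
  qed auto
  hence "summable (\<lambda>k. \<bar>\<theta> gchoose (k + Suc N)\<bar>)"
    by simp
  thus ?thesis
    by (subst (asm) summable_iff_shift)
qed

section \<open>The resolvent symbol and fractional powers of its complement\<close>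

definition resolvent_symbol :: "real \<Rightarrow> real ^ 'n::finite \<Rightarrow> real" where
  "resolvent_symbol h \<xi> = (1 - h\<^sup>2) / (1 + h\<^sup>2 * (norm \<xi>)\<^sup>2)"

text \<open>The numerator 1 - h^2 makes 1 - Z proportional to 1 + |\<xi>|^2. With numerator 1 it
  would be proportional to |\<xi>|^2, whose fractional powers are singular at the origin and do not
  match the Bessel weight.\<close>

lemma
  assumes h: "0 < h" "h < 1"
  shows resolvent_symbol_pos: "resolvent_symbol h \<xi> > 0"
    and resolvent_symbol_less_1: "resolvent_symbol h \<xi> < 1"
    and one_minus_resolvent_symbol: "1 - resolvent_symbol h \<xi> = h\<^sup>2 * (1 + (norm \<xi>)\<^sup>2) / (1 + h\<^sup>2 * (norm \<xi>)\<^sup>2)"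
proof -
  have h2: "h\<^sup>2 > 0" "h\<^sup>2 < 1"
    using h by (auto simp: power_less_one_iff)
  have Y: "1 + h\<^sup>2 * (norm \<xi>)\<^sup>2 > 0"
    by (intro add_pos_nonneg) auto
  show "resolvent_symbol h \<xi> > 0"
    unfolding resolvent_symbol_def using h2 Y by (intro divide_pos_pos) auto
  show eq: "1 - resolvent_symbol h \<xi> = h\<^sup>2 * (1 + (norm \<xi>)\<^sup>2) / (1 + h\<^sup>2 * (norm \<xi>)\<^sup>2)"
    unfolding resolvent_symbol_def using Y by (simp add: field_simps)
  have "h\<^sup>2 * (1 + (norm \<xi>)\<^sup>2) > 0"
    using h2 by (intro mult_pos_pos add_pos_nonneg) auto
  hence "h\<^sup>2 * (1 + (norm \<xi>)\<^sup>2) / (1 + h\<^sup>2 * (norm \<xi>)\<^sup>2) > 0"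
    using Y by (rule divide_pos_pos)
  thus "resolvent_symbol h \<xi> < 1"
    unfolding eq[symmetric] by simp
qed

text \<open>Trades the Bessel weight at scale 1 for a weight at scale h and a symbol bounded
  uniformly in h. At \<sigma> = s/2 it supplies the factor h^s used in both the upper and the lower
  bound.\<close>

lemma one_minus_resolvent_symbol_powr:
  assumes h: "0 < h" "h < 1"
  shows "(1 - resolvent_symbol h \<xi>) powr \<sigma> = 
    h powr (2 * \<sigma>) * (1 + (norm \<xi>)\<^sup>2) powr \<sigma> * (1 + h\<^sup>2 * (norm \<xi>)\<^sup>2) powr (- \<sigma>)"
proof -
  have "(h\<^sup>2) powr \<sigma> = h powr (2 * \<sigma>)"
    using h by (simp add: powr_realpow[symmetric] powr_powr del: powr_numeral)
  thus ?thesis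
    unfolding one_minus_resolvent_symbol[OF h]
    by (simp add: powr_divide powr_mult powr_minus_divide)
qed

lemma L1_multiplier_resolvent_symbol:
  assumes h: "0 < h" "h < 1"
  shows "L1_multiplier 1 (\<lambda>\<xi>::real^'n::finite. complex_of_real (resolvent_symbol h \<xi>))"
proof -
  have "h\<^sup>2 < 1"
    using h by (auto simp: power_less_one_iff)
  hence "norm (complex_of_real (1 - h\<^sup>2)) * 1 \<le> 1"
    by (simp only: norm_of_real) simp
  moreover have "(\<lambda>\<xi>::real^'n. complex_of_real (resolvent_symbol h \<xi>)) = 
      (\<lambda>\<xi>. complex_of_real (1 - h\<^sup>2) * complex_of_real (1 / (1 + h\<^sup>2 * (norm \<xi>)\<^sup>2)))"
    by (simp add: resolvent_symbol_def)
  ultimately show ?thesis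
    by (simp only:) (rule L1_multiplier_mono[OF L1_multiplier_cmult[OF L1_multiplier_resolvent_exact[OF h(1)]]])
qed

lemma schwartz_multiplier_resolvent_symbol:
  assumes h: "0 < h" "h < 1"
  shows "schwartz_multiplier (\<lambda>\<xi>::real^'n::finite. complex_of_real (resolvent_symbol h \<xi>))"
proof -
  have "1 + h\<^sup>2 * (norm \<xi>)\<^sup>2 > 0" for \<xi> :: "real^'n"
    by (intro add_pos_nonneg) auto
  hence "(1 + h\<^sup>2 * (norm \<xi>)\<^sup>2) powr (- 1) = 1 / (1 + h\<^sup>2 * (norm \<xi>)\<^sup>2)" for \<xi> :: "real^'n"
    by (subst powr_minus_divide) (simp add: less_imp_le)
  hence "(\<lambda>\<xi>::real^'n. complex_of_real (resolvent_symbol h \<xi>)) = 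
      (\<lambda>\<xi>. complex_of_real (1 - h\<^sup>2) * complex_of_real ((1 + h\<^sup>2 * (norm \<xi>)\<^sup>2) powr (- 1)))"
    by (simp add: resolvent_symbol_def)
  thus ?thesis
    using h by (simp only:) (intro schwartz_multiplier_mult schwartz_multiplier_const schwartz_multiplier_powr, auto)
qed

lemma schwartz_multiplier_one_minus_resolvent_powr:
  assumes h: "0 < h" "h < 1"
  shows "schwartz_multiplier (\<lambda>\<xi>. complex_of_real ((1 - resolvent_symbol h \<xi>) powr \<sigma>))"
  unfolding one_minus_resolvent_symbol_powr[OF h] of_real_mult
  using schwartz_multiplier_powr[of 1 1 \<sigma>] schwartz_multiplier_powr[of 1 "h\<^sup>2" "- \<sigma>"] h
  by (intro schwartz_multiplier_mult schwartz_multiplier_const) auto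

text \<open>Each power of Z has mass at most 1, so the absolute values of the binomial coefficients
  alone bound the series, with no trace of h. The series applies at every frequency because 0 < Z <
  1.\<close>

lemma L1_multiplier_one_minus_resolvent_powr:
  assumes "\<theta> > 0" and h: "0 < h" "h < 1"
  shows "L1_multiplier (\<Sum>k. \<bar>\<theta> gchoose k\<bar>) (\<lambda>\<xi>::real^'n::finite. complex_of_real ((1 - resolvent_symbol h \<xi>) powr \<theta>))"
proof (rule L1_multiplier_suminf)
    show "summable (\<lambda>k. \<bar>\<theta> gchoose k\<bar>)"
      by (intro summable_abs_gbinomial assms)
    fix k
    show "L1_multiplier \<bar>\<theta> gchoose k\<bar> (\<lambda>\<xi>::real^'n. complex_of_real ((\<theta> gchoose k) * (-1) ^ k) * complex_of_real (resolvent_symbol h \<xi>) ^ k)"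
      using L1_multiplier_cmult[OF L1_multiplier_power[OF L1_multiplier_resolvent_symbol[OF h], of k], of "complex_of_real ((\<theta> gchoose k) * (-1) ^ k)"]
      by (simp add: norm_mult norm_power)
  next
    fix \<xi> :: "real^'n"
    have "(\<lambda>k. (\<theta> gchoose k) * (- resolvent_symbol h \<xi>) ^ k) sums (1 + (- resolvent_symbol h \<xi>)) powr \<theta>"
      using resolvent_symbol_pos[OF h, of \<xi>] resolvent_symbol_less_1[OF h, of \<xi>] by (intro gen_binomial_real) auto
    hence "(\<lambda>k. complex_of_real ((\<theta> gchoose k) * (- resolvent_symbol h \<xi>) ^ k)) sums complex_of_real ((1 + (- resolvent_symbol h \<xi>)) powr \<theta>)"
      by (rule sums_of_real)
    thus "(\<lambda>k. complex_of_real ((\<theta> gchoose k) * (-1) ^ k) * complex_of_real (resolvent_symbol h \<xi>) ^ k) sums complex_of_real ((1 - resolvent_symbol h \<xi>) powr \<theta>)"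
      by (simp add: power_minus[of "complex_of_real _"] mult.assoc)
qed

lemma L1_multiplier_poly_resolvent:
  fixes P :: "real poly"
  assumes h: "0 < h" "h < 1"
  shows "L1_multiplier (\<Sum>i\<le>degree P. \<bar>coeff P i\<bar>) (\<lambda>\<xi>. complex_of_real (poly P (resolvent_symbol h \<xi>)))"
    and "schwartz_multiplier (\<lambda>\<xi>. complex_of_real (poly P (resolvent_symbol h \<xi>)))"
proof -
  have *: "L1_multiplier \<bar>coeff P i\<bar> (\<lambda>\<xi>. complex_of_real (coeff P i) * complex_of_real (resolvent_symbol h \<xi>) ^ i)" for i
    using L1_multiplier_cmult[OF L1_multiplier_power[OF L1_multiplier_resolvent_symbol[OF h], of i], of "complex_of_real (coeff P i)"]
    by simp
  show "L1_multiplier (\<Sum>i\<le>degree P. \<bar>coeff P i\<bar>) (\<lambda>\<xi>. complex_of_real (poly P (resolvent_symbol h \<xi>)))"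
    unfolding poly_altdef of_real_sum of_real_mult of_real_power
    by (intro L1_multiplier_sum *) auto
  show "schwartz_multiplier (\<lambda>\<xi>. complex_of_real (poly P (resolvent_symbol h \<xi>)))"
    unfolding poly_altdef of_real_sum of_real_mult of_real_power
    by (intro schwartz_multiplier_sum schwartz_multiplier_mult schwartz_multiplier_const schwartz_multiplier_power
          schwartz_multiplier_resolvent_symbol[OF h]) auto
qed

text \<open>Squaring the identity for n + 1 gives pure terms of exponent 2n + 2 \<ge> n + 2. The
  mixed term is multiplied by 1 = z + (1 - z) and shared between the two sides. For N = 0 the pair
  1, 0 is taken.\<close>

lemma bezout_powers:
  obtains P Q :: "real poly" where "\<forall>z. z ^ N * poly P z + (1 - z) ^ N * poly Q z = 1"
proof -
  have "\<exists>P Q :: real poly. \<forall>z. z ^ Suc n * poly P z + (1 - z) ^ Suc n * poly Q z = 1" for n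
  proof (induction n)
    case 0
    show ?case by (rule exI[of _ 1], rule exI[of _ 1]) simp
  next
    case (Suc n)
    then obtain P Q :: "real poly" where PQ: "\<And>z. z ^ Suc n * poly P z + (1 - z) ^ Suc n * poly Q z = 1"
      by blast
    let ?z = "[:0, 1:] :: real poly" and ?w = "[:1, -1:] :: real poly"
    have "z ^ Suc (Suc n) * poly (?z ^ n * P ^ 2 + 2 * ?w ^ Suc n * P * Q) z + 
      (1 - z) ^ Suc (Suc n) * poly (?w ^ n * Q ^ 2 + 2 * ?z ^ Suc n * P * Q) z = 1" for z
    proof -
      define A B where "A = z ^ n" "B = (1 - z) ^ n"
      have "z * A * poly P z + (1 - z) * B * poly Q z = 1"
        using PQ[of z] by (simp add: A_B_def)
      hence "(z * A * poly P z + (1 - z) * B * poly Q z)\<^sup>2 = 1"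
        by simp
      thus ?thesis
        by (simp add: A_B_def[symmetric] power2_eq_square) (simp add: algebra_simps)
    qed
    then show ?case by blast
  qed
  from this[of "N - 1"] that show ?thesis
    by (cases N) (auto intro: that[of "1" "0"])
qed

text \<open>With \<open>Z\<close> the resolvent symbol, multiply \<open>1 = Z\<^sup>N P(Z) + (1 - Z)\<^sup>N Q(Z)\<close> by the symbol of the
  derivative: the first summand gains \<open>N\<close> resolvents, and in the second one
  \<open>(1 - Z)\<^sup>s\<^sup>/\<^sup>2\<close> is \<open>h\<^sup>s (1 + |\<xi>|\<^sup>2)\<^sup>s\<^sup>/\<^sup>2\<close> times a resolvent of order \<open>s/2\<close>.\<close>

lemma deriv_symbol_splitting:
  fixes ds :: "'n::finite list"
  assumes s: "real (length ds) < s"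
  obtains C where "C > 0" 
    "\<forall>h. 0 < h \<longrightarrow> h < 1 \<longrightarrow> (\<exists>a b. L1_multiplier (C * h powr (- real (length ds))) a \<and> schwartz_multiplier a \<and>
       L1_multiplier (C * h powr (s - real (length ds))) b \<and> schwartz_multiplier b \<and>
       (\<forall>\<xi>. deriv_symbol ds \<xi> = a \<xi> + complex_of_real ((1 + (norm \<xi>)\<^sup>2) powr (s / 2)) * b \<xi>))"
proof -
  let ?L = "real (length ds)"
  \<comment> \<open>Two demands are met by rounding s up: N resolvents must outweigh |ds|/2, and the
    leftover exponent N - s/2 must be positive.\<close>
  define N where "N = nat \<lceil>s\<rceil>"
  have N: "real N \<ge> s" unfolding N_def by linarith
  have s0: "s > 0" using s by linarith
  obtain P Q :: "real poly" where PQ: "\<forall>z. z ^ N * poly P z + (1 - z) ^ N * poly Q z = 1"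
    by (rule bezout_powers[of N])
  define B where "B = (\<Sum>k. \<bar>(real N - s / 2) gchoose k\<bar>)"
  have Ns: "real N - s / 2 > 0"
    using N s0 by simp
  have B: "B \<ge> 0" unfolding B_def
    by (intro suminf_nonneg summable_abs_gbinomial Ns) auto
  \<comment> \<open>The second inequality is the hypothesis |ds| < s itself: a resolvent of order
    s/2 makes the kernel of the derivative integrable.\<close>
  have L1: "real (length ds) / 2 < real N" "real (length ds) / 2 < s / 2"
    using N s s0 by auto
  obtain C1 where C1: "C1 \<ge> 0" "\<forall>h>0. L1_multiplier (C1 * h powr (- ?L))
    (\<lambda>\<xi>. deriv_symbol ds \<xi> * complex_of_real ((1 + h\<^sup>2 * (norm \<xi>)\<^sup>2) powr (- real N)))"
    using L1_multiplier_deriv_resolvent[OF L1(1)] .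
  obtain C2 where C2: "C2 \<ge> 0" "\<forall>h>0. L1_multiplier (C2 * h powr (- ?L))
    (\<lambda>\<xi>. deriv_symbol ds \<xi> * complex_of_real ((1 + h\<^sup>2 * (norm \<xi>)\<^sup>2) powr (- (s / 2))))"
    using L1_multiplier_deriv_resolvent[OF L1(2)] .
  define p where "p = (\<Sum>i\<le>degree P. \<bar>coeff P i\<bar>)"
  define q where "q = (\<Sum>i\<le>degree Q. \<bar>coeff Q i\<bar>)"
  have pq: "p \<ge> 0" "q \<ge> 0" by (auto simp: p_def q_def intro!: sum_nonneg)
  \<comment> \<open>One constant for both symbols; the summand 1 makes it positive.\<close>
  define C where "C = C1 * p + C2 * (B * q) + 1"
  have C: "C > 0" "C1 * p \<le> C" "C2 * (B * q) \<le> C"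
    using C1(1) C2(1) B pq by (auto simp: C_def add_nonneg_pos add_nonneg_nonneg)
  have "\<exists>a b. L1_multiplier (C * h powr (- ?L)) a \<and> schwartz_multiplier a \<and>
       L1_multiplier (C * h powr (s - ?L)) b \<and> schwartz_multiplier b \<and>
       (\<forall>\<xi>. deriv_symbol ds \<xi> = a \<xi> + complex_of_real ((1 + (norm \<xi>)\<^sup>2) powr (s / 2)) * b \<xi>)"
    if h: "0 < h" "h < 1" for h
  proof -
    let ?Z = "resolvent_symbol h"
    define a where "a = (\<lambda>\<xi>. complex_of_real ((1 - h\<^sup>2) ^ N) *
       ((deriv_symbol ds \<xi> * complex_of_real ((1 + h\<^sup>2 * (norm \<xi>)\<^sup>2) powr (- real N))) * complex_of_real (poly P (?Z \<xi>))))"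
    define b where "b = (\<lambda>\<xi>. complex_of_real (h powr s) *
       ((deriv_symbol ds \<xi> * complex_of_real ((1 + h\<^sup>2 * (norm \<xi>)\<^sup>2) powr (- (s / 2)))) * 
         (complex_of_real ((1 - ?Z \<xi>) powr (real N - s / 2)) * complex_of_real (poly Q (?Z \<xi>)))))"
    have h2: "h\<^sup>2 > 0" "h\<^sup>2 < 1"
      using h by (auto simp: power_less_one_iff)
    have sa: "schwartz_multiplier a" and sb: "schwartz_multiplier b"
      unfolding a_def b_def
      by (intro schwartz_multiplier_mult schwartz_multiplier_const schwartz_multiplier_deriv_symbol
          schwartz_multiplier_powr L1_multiplier_poly_resolvent(2) schwartz_multiplier_one_minus_resolvent_powr h2 h zero_less_one)+
    have "L1_multiplier (norm (complex_of_real ((1 - h\<^sup>2) ^ N)) * ((C1 * h powr (- ?L)) * p)) a"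
      unfolding a_def p_def by (intro L1_multiplier_cmult L1_multiplier_mult C1(2)[rule_format] L1_multiplier_poly_resolvent(1) h)
    moreover have "norm (complex_of_real ((1 - h\<^sup>2) ^ N)) * ((C1 * h powr (- ?L)) * p) \<le> 1 * (C * h powr (- ?L))"
    proof (rule mult_mono)
      show "norm (complex_of_real ((1 - h\<^sup>2) ^ N)) \<le> 1"
        unfolding norm_of_real using h2 by (simp add: power_le_one abs_le_iff)
      show "C1 * h powr (- ?L) * p \<le> C * h powr (- ?L)"
        using mult_right_mono[OF C(2), of "h powr (- ?L)"] by (simp add: mult_ac)
    qed (use C1(1) pq in auto)
    ultimately have La: "L1_multiplier (C * h powr (- ?L)) a"
      unfolding mult_1 by (rule L1_multiplier_mono)
    have "L1_multiplier (norm (complex_of_real (h powr s)) * ((C2 * h powr (- ?L)) * (B * q))) b"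
      unfolding b_def q_def B_def
      by (intro L1_multiplier_cmult L1_multiplier_mult C2(2)[rule_format] L1_multiplier_poly_resolvent(1)
          L1_multiplier_one_minus_resolvent_powr Ns h)
    moreover have "norm (complex_of_real (h powr s)) * ((C2 * h powr (- ?L)) * (B * q)) = C2 * (B * q) * (h powr s * h powr (- ?L))"
      by (simp add: mult_ac)
    moreover have "h powr s * h powr (- ?L) = h powr (s - ?L)"
      by (simp add: powr_add[symmetric])
    moreover have "C2 * (B * q) * h powr (s - ?L) \<le> C * h powr (s - ?L)"
      by (intro mult_right_mono C) auto
    ultimately have Lb: "L1_multiplier (C * h powr (s - ?L)) b"
      by (simp only: L1_multiplier_mono)
    have "deriv_symbol ds \<xi> = a \<xi> + complex_of_real ((1 + (norm \<xi>)\<^sup>2) powr (s / 2)) * b \<xi>" for \<xi>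
    proof -
      have Y: "1 + h\<^sup>2 * (norm \<xi>)\<^sup>2 > 0"
        by (intro add_pos_nonneg) auto
      have 1: "(1 - h\<^sup>2) ^ N * (1 + h\<^sup>2 * (norm \<xi>)\<^sup>2) powr (- real N) = ?Z \<xi> ^ N"
        using Y by (simp add: resolvent_symbol_def power_divide powr_minus_divide powr_realpow)
      have "(1 + (norm \<xi>)\<^sup>2) powr (s / 2) * (h powr s * (1 + h\<^sup>2 * (norm \<xi>)\<^sup>2) powr (- (s / 2))) = (1 - ?Z \<xi>) powr (s / 2)"
        unfolding one_minus_resolvent_symbol_powr[OF h] by simp
      moreover have "(1 - ?Z \<xi>) powr (s / 2) * (1 - ?Z \<xi>) powr (real N - s / 2) = (1 - ?Z \<xi>) ^ N"
        using resolvent_symbol_less_1[OF h, of \<xi>] by (simp add: powr_add[symmetric] powr_realpow)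
      ultimately have 2: "(1 + (norm \<xi>)\<^sup>2) powr (s / 2) * (h powr s * (1 + h\<^sup>2 * (norm \<xi>)\<^sup>2) powr (- (s / 2))) * (1 - ?Z \<xi>) powr (real N - s / 2)
         = (1 - ?Z \<xi>) ^ N"
        by simp
      have "a \<xi> + complex_of_real ((1 + (norm \<xi>)\<^sup>2) powr (s / 2)) * b \<xi> = 
         deriv_symbol ds \<xi> * complex_of_real (((1 - h\<^sup>2) ^ N * (1 + h\<^sup>2 * (norm \<xi>)\<^sup>2) powr (- real N)) * poly P (?Z \<xi>) +
           ((1 + (norm \<xi>)\<^sup>2) powr (s / 2) * (h powr s * (1 + h\<^sup>2 * (norm \<xi>)\<^sup>2) powr (- (s / 2))) * (1 - ?Z \<xi>) powr (real N - s / 2)) * poly Q (?Z \<xi>))"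
        by (simp add: a_def b_def algebra_simps)
      also have "\<dots> = deriv_symbol ds \<xi>"
        unfolding 1 2 PQ[rule_format] by simp
      finally show ?thesis by simp
    qed
    thus ?thesis using sa sb La Lb by (intro exI[of _ a] exI[of _ b] conjI allI)
  qed
  with C(1) show ?thesis by (intro that allI impI)
qed

section \<open>Convolution operators on \<open>L\<^sup>p\<close>\<close>

text \<open>Young's inequality, integrated after dividing both functions by their norms. If one norm
  is 0, the product vanishes almost everywhere.\<close>

lemma Holder_inequality_integral:
  fixes f g :: "'a \<Rightarrow> real"
  assumes pq: "p > 1" "q > 1" "1 / p + 1 / q = 1"
    and [measurable]: "f \<in> borel_measurable M" "g \<in> borel_measurable M"
    and f0: "\<And>x. f x \<ge> 0" and g0: "\<And>x. g x \<ge> 0"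
    and fi: "integrable M (\<lambda>x. f x powr p)" and gi: "integrable M (\<lambda>x. g x powr q)"
  shows "integrable M (\<lambda>x. f x * g x)"
    and "(LINT x|M. f x * g x) \<le> (LINT x|M. f x powr p) powr (1 / p) * (LINT x|M. g x powr q) powr (1 / q)"
proof -
  have young: "f x * g x \<le> f x powr p / p + g x powr q / q" for x
    by (rule Youngs_inequality) (use pq f0 g0 in auto)
  have yi: "integrable M (\<lambda>x. f x powr p / p + g x powr q / q)"
    using fi gi by auto
  show fg: "integrable M (\<lambda>x. f x * g x)"
  proof (rule Bochner_Integration.integrable_bound[OF yi])
    have "norm (f x * g x) \<le> norm (f x powr p / p + g x powr q / q)" for x
      using young[of x] f0[of x] g0[of x] by (simp add: abs_of_nonneg)
    thus "AE x in M. norm (f x * g x) \<le> norm (f x powr p / p + g x powr q / q)"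
      by simp
  qed measurable
  let ?F = "LINT x|M. f x powr p" and ?G = "LINT x|M. g x powr q"
  have F0: "?F \<ge> 0" and G0: "?G \<ge> 0"
    by (auto intro!: integral_nonneg_AE)
  show "(LINT x|M. f x * g x) \<le> ?F powr (1 / p) * ?G powr (1 / q)"
  proof (cases "?F = 0 \<or> ?G = 0")
    case True
    have "AE x in M. f x * g x = 0"
    proof (cases "?F = 0")
      case True
      hence "AE x in M. f x powr p = 0"
        using fi by (subst (asm) integral_nonneg_eq_0_iff_AE) auto
      thus ?thesis by eventually_elim auto
    next
      case False
      hence "AE x in M. g x powr q = 0"
        using gi True by (subst (asm) integral_nonneg_eq_0_iff_AE) auto
      thus ?thesis by eventually_elim auto
    qed
    hence "(LINT x|M. f x * g x) = 0"
      by (intro integral_eq_zero_AE)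
    thus ?thesis by simp
  next
    case False
    hence F: "?F > 0" and G: "?G > 0"
      using F0 G0 unfolding less_le by metis+
    let ?a = "?F powr (1 / p)" and ?b = "?G powr (1 / q)"
    have ab: "?a > 0" "?b > 0" "?a powr p = ?F" "?b powr q = ?G"
      using F G pq by (auto simp: powr_powr)
    have y: "f x * g x \<le> ?a * ?b * (f x powr p / (?F * p) + g x powr q / (?G * q))" for x
    proof -
      have "(f x / ?a) * (g x / ?b) \<le> (f x / ?a) powr p / p + (g x / ?b) powr q / q"
        using pq f0[of x] g0[of x] ab(1,2) by (intro Youngs_inequality) auto
      hence "(f x / ?a) * (g x / ?b) \<le> f x powr p / (?F * p) + g x powr q / (?G * q)"
        using f0[of x] g0[of x] ab by (simp add: powr_divide)
      hence "?a * ?b * ((f x / ?a) * (g x / ?b)) \<le> ?a * ?b * (f x powr p / (?F * p) + g x powr q / (?G * q))"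
        using ab(1,2) by (intro mult_left_mono) auto
      thus ?thesis using ab(1,2) by simp
    qed
    have "(LINT x|M. f x * g x) \<le> (LINT x|M. ?a * ?b * (f x powr p / (?F * p) + g x powr q / (?G * q)))"
      using fi gi y by (intro integral_mono fg) auto
    also have "\<dots> = ?a * ?b * (?F / (?F * p) + ?G / (?G * q))"
      using fi gi by simp
    also have "?F / (?F * p) + ?G / (?G * q) = 1"
      using F G pq by simp
    finally show ?thesis by simp
  qed
qed

lemma AE_lborel_affine:
  fixes P :: "'a::euclidean_space \<Rightarrow> bool"
  assumes "AE x in lborel. P x" and c: "c \<noteq> 0"
  shows "AE x in lborel. P (t + c *\<^sub>R x)"
proof -
  obtain N where N: "{x. \<not> P x} \<subseteq> N" "emeasure lborel N = 0" "N \<in> sets borel"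
    using AE_E[OF assms(1)] by auto
  have [measurable]: "N \<in> sets borel" by fact
  have "(\<integral>\<^sup>+x. indicator N x \<partial>lborel) = 0"
    using N by simp
  hence "(\<integral>\<^sup>+x. indicator N (t + c *\<^sub>R x) \<partial>lborel) = (0::ennreal)"
    by (subst (asm) nn_integral_lborel_affine[OF _ c, of _ t]) (use c in auto)
  hence "AE x in lborel. indicator N (t + c *\<^sub>R x) = (0::ennreal)"
    by (subst (asm) nn_integral_0_iff_AE) auto
  thus ?thesis
    by eventually_elim (use N(1) in \<open>auto simp: indicator_def split: if_splits\<close>)
qed

text \<open>The integral identity states the multiplier property in transposed form, so no L^p
  function has to be Fourier transformed. The factor 2 comes from the constant in
  \<open>Lp_add\<close>; the clauses on 0 and on almost everywhere equality are what
  \<open>A(0) = 0\<close> and \<open>Lp_maps\<close> demand of a reconstruction.\<close>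

definition Lp_multiplier_operator :: "real \<Rightarrow> real \<Rightarrow> 'n::finite cfun \<Rightarrow> ('n cfun \<Rightarrow> 'n cfun) \<Rightarrow> bool" where
  "Lp_multiplier_operator p C m T \<longleftrightarrow> (\<forall>x. T (\<lambda>_. 0) x = 0) \<and>
     (\<forall>g\<in>Lp p. T g \<in> Lp p \<and> Lp_norm p (T g) \<le> 2 * C * Lp_norm p g \<and>
       (\<forall>\<psi>\<in>schwartz. (LINT x|lborel. T g x * \<psi> x) = (LINT x|lborel. g x * fourier (\<lambda>\<xi>. m \<xi> * inv_fourier \<psi> \<xi>) x)) \<and>
       (\<forall>g'\<in>Lp p. (AE x in lborel. g x = g' x) \<longrightarrow> (AE x in lborel. T g x = T g' x)))"

lemma Lp_multiplier_operatorD: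
  assumes "Lp_multiplier_operator p C m T"
  shows "T (\<lambda>_. 0) x = 0"
    and "g \<in> Lp p \<Longrightarrow> T g \<in> Lp p"
    and "g \<in> Lp p \<Longrightarrow> Lp_norm p (T g) \<le> 2 * C * Lp_norm p g"
    and "g \<in> Lp p \<Longrightarrow> \<psi> \<in> schwartz \<Longrightarrow>
      (LINT x|lborel. T g x * \<psi> x) = (LINT x|lborel. g x * fourier (\<lambda>\<xi>. m \<xi> * inv_fourier \<psi> \<xi>) x)"
    and "g \<in> Lp p \<Longrightarrow> g' \<in> Lp p \<Longrightarrow> AE x in lborel. g x = g' x \<Longrightarrow> AE x in lborel. T g x = T g' x"
  using assms by (auto simp: Lp_multiplier_operator_def)

section \<open>Convolution by an integrable kernel on L^p, for conjugate exponents\<close>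

context
  fixes p q :: real
  assumes pq: "p > 1" "q > 1" "1 / p + 1 / q = 1"
begin

lemma LpD:
  assumes "g \<in> Lp p"
  shows "g \<in> borel_measurable borel" "integrable lborel (\<lambda>x. norm (g x) powr p)"
  using assms by (auto simp: Lp_def)

lemma Lp_norm_powr: "Lp_norm p g powr p = (LINT x|lborel. norm (g x) powr p)"
  using pq by (simp add: Lp_norm_def powr_powr)

lemma Lp_norm_nonneg: "Lp_norm p g \<ge> 0"
  by (simp add: Lp_norm_def)

lemma Lp_norm_leI:
  assumes "(LINT x|lborel. norm (g x) powr p) \<le> C powr p" "C \<ge> 0"
  shows "Lp_norm p g \<le> C"
proof -
  have "Lp_norm p g \<le> (C powr p) powr (1 / p)"
    unfolding Lp_norm_def using assms pq by (intro powr_mono2) (auto intro!: integral_nonneg_AE)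
  thus ?thesis
    using assms pq by (simp add: powr_powr)
qed

lemma schwartz_Lp: "\<phi> \<in> schwartz \<Longrightarrow> \<phi> \<in> Lp p"
  using schwartz_powr_integrable[of \<phi> p] pq by (auto simp: Lp_def schwartz_measurable)

text \<open>A triangle inequality with constant 2, enough for bounds up to constants: |u + v| is at
  most twice the larger of |u| and |v|.\<close>

lemma Lp_add:
  assumes u: "u \<in> Lp p" and v: "v \<in> Lp p"
  shows "(\<lambda>x. u x + v x) \<in> Lp p" "Lp_norm p (\<lambda>x. u x + v x) \<le> 2 * (Lp_norm p u + Lp_norm p v)"
proof -
  note [measurable] = LpD(1)[OF u] LpD(1)[OF v]
  have le: "norm (u x + v x) powr p \<le> 2 powr p * (norm (u x) powr p + norm (v x) powr p)" for x
  proof -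
    let ?m = "max (norm (u x)) (norm (v x))"
    have "norm (u x + v x) powr p \<le> (2 * ?m) powr p"
      using norm_triangle_ineq[of "u x" "v x"] pq by (intro powr_mono2) auto
    also have "\<dots> = 2 powr p * ?m powr p"
      by (rule powr_mult)
    also have "?m powr p \<le> norm (u x) powr p + norm (v x) powr p"
      by (auto simp: max_def)
    finally show ?thesis by simp
  qed
  have i: "integrable lborel (\<lambda>x. 2 powr p * (norm (u x) powr p + norm (v x) powr p))"
    using LpD(2)[OF u] LpD(2)[OF v] by auto
  have iuv: "integrable lborel (\<lambda>x. norm (u x + v x) powr p)"
    by (rule Bochner_Integration.integrable_bound[OF i]) (use le in auto)
  thus "(\<lambda>x. u x + v x) \<in> Lp p"
    by (auto simp: Lp_def)
  let ?U = "Lp_norm p u" and ?V = "Lp_norm p v"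
  have U: "?U \<ge> 0" "?V \<ge> 0" by (auto simp: Lp_norm_nonneg)
  have "(LINT x|lborel. norm (u x + v x) powr p) \<le> (LINT x|lborel. 2 powr p * (norm (u x) powr p + norm (v x) powr p))"
    using le by (intro integral_mono iuv i)
  also have "\<dots> = 2 powr p * (?U powr p + ?V powr p)"
    unfolding Lp_norm_powr using LpD(2)[OF u] LpD(2)[OF v] by simp
  \<comment> \<open>Superadditivity of the p-th power on nonnegative numbers, from w^p = w w^(p-1)
    and monotonicity of the second factor.\<close>
  also have "?U powr p + ?V powr p \<le> (?U + ?V) powr p"
  proof -
    have split: "w powr p = w * w powr (p - 1)" if "w \<ge> 0" for w :: real
      using that by (cases "w = 0") (auto simp: powr_diff)
    have "?U powr p + ?V powr p = ?U * ?U powr (p - 1) + ?V * ?V powr (p - 1)"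
      using U split by metis
    also have "\<dots> \<le> ?U * (?U + ?V) powr (p - 1) + ?V * (?U + ?V) powr (p - 1)"
      using U pq by (intro add_mono mult_left_mono powr_mono2) auto
    also have "\<dots> = (?U + ?V) powr p"
      using U split[of "?U + ?V"] by (simp add: algebra_simps)
    finally show ?thesis .
  qed
  finally have "(LINT x|lborel. norm (u x + v x) powr p) \<le> (2 * (?U + ?V)) powr p"
    using U by (subst powr_mult) auto
  thus "Lp_norm p (\<lambda>x. u x + v x) \<le> 2 * (?U + ?V)"
    using U by (intro Lp_norm_leI) auto
qed

lemma Lp_cmult:
  assumes u: "u \<in> Lp p"
  shows "(\<lambda>x. c * u x) \<in> Lp p" "Lp_norm p (\<lambda>x. c * u x) = norm c * Lp_norm p u"
proof -
  note [measurable] = LpD(1)[OF u]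
  have eq: "norm (c * u x) powr p = norm c powr p * norm (u x) powr p" for x
    by (simp add: norm_mult powr_mult)
  show "(\<lambda>x. c * u x) \<in> Lp p"
    using LpD(2)[OF u] by (auto simp: Lp_def eq)
  show "Lp_norm p (\<lambda>x. c * u x) = norm c * Lp_norm p u"
    unfolding Lp_norm_def eq using pq by (simp add: powr_mult powr_powr integral_nonneg_AE)
qed

lemma Lp_dilate:
  fixes u :: "'n::finite cfun"
  assumes u: "u \<in> Lp p" and h: "h > 0"
  shows "(\<lambda>x. u (x /\<^sub>R h)) \<in> Lp p" "Lp_norm p (\<lambda>x. u (x /\<^sub>R h)) = h powr (real CARD('n) / p) * Lp_norm p u"
proof -
  note [measurable] = LpD(1)[OF u]
  show "(\<lambda>x. u (x /\<^sub>R h)) \<in> Lp p"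
    using integrable_lborel_affine[OF LpD(2)[OF u], of "inverse h" 0] h by (auto simp: Lp_def)
  have "(LINT x|lborel. norm (u (x /\<^sub>R h)) powr p) = h ^ CARD('n) * (LINT x|lborel. norm (u x) powr p)"
    using h by (subst integral_lborel_affine[of h _ 0]) auto
  also have "h ^ CARD('n) = h powr real CARD('n)"
    using h by (simp add: powr_realpow)
  finally show "Lp_norm p (\<lambda>x. u (x /\<^sub>R h)) = h powr (real CARD('n) / p) * Lp_norm p u"
    unfolding Lp_norm_def using h pq by (simp add: powr_mult powr_powr integral_nonneg_AE)
qed

lemma Lp_Holder:
  assumes u: "u \<in> Lp p" and \<psi>: "\<psi> \<in> borel_measurable borel" "integrable lborel (\<lambda>x. norm (\<psi> x) powr q)"
  shows "integrable lborel (\<lambda>x. norm (u x) * norm (\<psi> x))"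
    "(LINT x|lborel. norm (u x) * norm (\<psi> x)) \<le> Lp_norm p u * Lp_norm q \<psi>"
  unfolding Lp_norm_def
  using Holder_inequality_integral[OF pq, of "\<lambda>x. norm (u x)" lborel "\<lambda>x. norm (\<psi> x)"] LpD[OF u] \<psi> by auto

lemma Lp_schwartz_integrable:
  assumes u: "u \<in> Lp p" and \<psi>: "\<psi> \<in> schwartz"
  shows "integrable lborel (\<lambda>x. u x * \<psi> x)"
proof (rule Bochner_Integration.integrable_bound)
  show "integrable lborel (\<lambda>x. norm (u x) * norm (\<psi> x))"
    using pq by (intro Lp_Holder u schwartz_powr_integrable schwartz_measurable \<psi>) auto
  note [measurable] = LpD(1)[OF u] schwartz_measurable[OF \<psi>]
  show "(\<lambda>x. u x * \<psi> x) \<in> borel_measurable lborel"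
    by measurable
qed (auto simp: norm_mult)

definition conv :: "'n::finite cfun \<Rightarrow> 'n cfun \<Rightarrow> 'n cfun" where
  "conv k g x = (LINT y|lborel. k y * g (x - y))"

text \<open>Young's convolution inequality. Splitting |k| = |k|^(1/p) |k|^(1/q) in Hoelder's
  inequality bounds |k * g|^p by A^(p-1) times the convolution \<open>H\<close> of |k| with |g|^p,
  where A is the mass of k. Fubini gives the integral of \<open>H\<close>.\<close>

lemma conv_Lp:
  fixes k g :: "'n::finite cfun"
  assumes k: "integrable lborel k" and g: "g \<in> Lp p"
  shows "conv k g \<in> Lp p" "Lp_norm p (conv k g) \<le> (LINT y|lborel. norm (k y)) * Lp_norm p g"
proof -
  have [measurable]: "k \<in> borel_measurable borel" "g \<in> borel_measurable borel"
    using k LpD(1)[OF g] by auto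
  let ?A = "LINT y|lborel. norm (k y)"
  define H where "H x = (LINT y|lborel. norm (k y) * norm (g (x - y)) powr p)" for x
  have tr: "integrable lborel (\<lambda>x. norm (g (x - y)) powr p)" 
    "(LINT x|lborel. norm (g (x - y)) powr p) = (LINT x|lborel. norm (g x) powr p)" for y
    using integrable_lborel_affine[OF LpD(2)[OF g], of 1 "-y"] integral_lborel_affine[of 1 "\<lambda>x. norm (g x) powr p" "-y"]
    by (auto simp: algebra_simps)
  have I: "integrable (lborel \<Otimes>\<^sub>M lborel) (\<lambda>(y, x). norm (k y) * norm (g (x - y)) powr p)"
  proof (rule lborel_pair.Fubini_integrable)
    show "integrable lborel (\<lambda>y. LINT x|lborel. norm (case (y, x) of (y, x) \<Rightarrow> norm (k y) * norm (g (x - y)) powr p))"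
      using k by (simp add: tr(2))
    show "AE y in lborel. integrable lborel (\<lambda>x. case (y, x) of (y, x) \<Rightarrow> norm (k y) * norm (g (x - y)) powr p)"
      using tr(1) by (intro AE_I2) auto
  qed measurable
  have Hi: "integrable lborel H"
    unfolding H_def using lborel_pair.integrable_snd[OF I] by simp
  have "(LINT x|lborel. H x) = (LINT y|lborel. LINT x|lborel. norm (k y) * norm (g (x - y)) powr p)"
    unfolding H_def using lborel_pair.Fubini_integral[OF I] by simp
  also have "\<dots> = ?A * (LINT x|lborel. norm (g x) powr p)"
    by (simp add: tr(2))
  finally have HI: "(LINT x|lborel. H x) = ?A * (LINT x|lborel. norm (g x) powr p)" .
  have "AE x in lborel. integrable lborel (\<lambda>y. norm (k y) * norm (g (x - y)) powr p)"
    using lborel_pair.AE_integrable_snd[OF I] by simp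
  hence le: "AE x in lborel. norm (conv k g x) powr p \<le> ?A powr (p - 1) * H x"
  proof eventually_elim
    fix x assume i: "integrable lborel (\<lambda>y. norm (k y) * norm (g (x - y)) powr p)"
    let ?f = "\<lambda>y. norm (k y) powr (1 / p) * norm (g (x - y))" and ?h = "\<lambda>y. norm (k y) powr (1 / q)"
    have fp: "?f y powr p = norm (k y) * norm (g (x - y)) powr p" for y
      using pq by (simp add: powr_mult powr_powr)
    have hq: "?h y powr q = norm (k y)" for y
      using pq by (simp add: powr_powr)
    have fh: "?f y * ?h y = norm (k y * g (x - y))" for y
    proof -
      have "?f y * ?h y = (norm (k y) powr (1 / p) * norm (k y) powr (1 / q)) * norm (g (x - y))"
        by simp
      also have "norm (k y) powr (1 / p) * norm (k y) powr (1 / q) = norm (k y)"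
        using pq(3) by (simp add: powr_add[symmetric])
      finally show ?thesis by (simp add: norm_mult)
    qed
    have "(LINT y|lborel. ?f y * ?h y) \<le> (LINT y|lborel. ?f y powr p) powr (1 / p) * (LINT y|lborel. ?h y powr q) powr (1 / q)"
      by (rule Holder_inequality_integral(2)[OF pq]) (use i k in \<open>auto simp: fp hq\<close>)
    hence "(LINT y|lborel. norm (k y * g (x - y))) \<le> H x powr (1 / p) * ?A powr (1 / q)"
      unfolding fh fp hq H_def .
    moreover have "norm (conv k g x) \<le> (LINT y|lborel. norm (k y * g (x - y)))"
      unfolding conv_def by (rule integral_norm_bound)
    ultimately have "norm (conv k g x) powr p \<le> (H x powr (1 / p) * ?A powr (1 / q)) powr p"
      using pq by (intro powr_mono2) auto
    also have "\<dots> = H x powr 1 * ?A powr (p / q)"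
      using pq by (simp add: powr_mult powr_powr)
    also have "H x powr 1 = H x"
      by (simp add: H_def integral_nonneg_AE)
    also have "p / q = p - 1"
      using pq by (simp add: field_simps)
    finally show "norm (conv k g x) powr p \<le> ?A powr (p - 1) * H x"
      by (simp add: mult.commute)
  qed
  have [measurable]: "conv k g \<in> borel_measurable borel"
    unfolding conv_def by measurable
  have ci: "integrable lborel (\<lambda>x. norm (conv k g x) powr p)"
    by (rule Bochner_Integration.integrable_bound[OF integrable_mult_right[OF Hi, of "?A powr (p - 1)"]])
       (use le in auto)
  thus "conv k g \<in> Lp p"
    by (auto simp: Lp_def)
  have A: "?A \<ge> 0" by simp
  have "(LINT x|lborel. norm (conv k g x) powr p) \<le> (LINT x|lborel. ?A powr (p - 1) * H x)"
    by (intro integral_mono_AE ci integrable_mult_right Hi le)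
  also have "\<dots> = (?A powr (p - 1) * ?A) * Lp_norm p g powr p"
    by (simp add: HI Lp_norm_powr)
  also have "?A powr (p - 1) * ?A = ?A powr p"
    using A by (cases "?A = 0") (auto simp: powr_diff)
  also have "?A powr p * Lp_norm p g powr p = (?A * Lp_norm p g) powr p"
    using A Lp_norm_nonneg[of g] by (simp add: powr_mult)
  finally show "Lp_norm p (conv k g) \<le> ?A * Lp_norm p g"
    using A Lp_norm_nonneg[of g] by (intro Lp_norm_leI) auto
qed

text \<open>For each fixed x, y -> x - y preserves null sets, so the two convolutions agree at every
  point and not only almost everywhere.\<close>

lemma conv_cong_AE:
  assumes "AE x in lborel. g x = g' x"
    and [measurable]: "k \<in> borel_measurable borel" "g \<in> borel_measurable borel" "g' \<in> borel_measurable borel"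
  shows "conv k g x = conv k g' x"
proof -
  have "AE y in lborel. g (x - y) = g' (x - y)"
    using AE_lborel_affine[OF assms(1), of "-1" x] by simp
  hence "AE y in lborel. k y * g (x - y) = k y * g' (x - y)"
    by eventually_elim simp
  thus ?thesis
    unfolding conv_def by (intro integral_cong_AE) auto
qed

text \<open>Fubini and a translation move the operator to the test function. Absolute integrability
  follows from Hoelder, because the norm of a translate of \<psi> does not depend on the
  shift.\<close>

lemma conv_duality:
  fixes k g \<psi> :: "'n::finite cfun"
  assumes k: "integrable lborel k" and g: "g \<in> Lp p" and \<psi>: "\<psi> \<in> schwartz"
  shows "integrable lborel (\<lambda>x. g x * (LINT y|lborel. k y * \<psi> (x + y)))"
    "(LINT x|lborel. conv k g x * \<psi> x) = (LINT x|lborel. g x * (LINT y|lborel. k y * \<psi> (x + y)))"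
proof -
  have [measurable]: "k \<in> borel_measurable borel" "g \<in> borel_measurable borel" "\<psi> \<in> borel_measurable borel"
    using k LpD(1)[OF g] schwartz_measurable[OF \<psi>] by auto
  have \<psi>t: "(\<lambda>x. \<psi> (x + y)) \<in> borel_measurable borel" "integrable lborel (\<lambda>x. norm (\<psi> (x + y)) powr q)" 
    "Lp_norm q (\<lambda>x. \<psi> (x + y)) = Lp_norm q \<psi>" for y
    using integrable_lborel_affine[OF schwartz_powr_integrable[OF \<psi>, of q], of 1 y] pq
      integral_lborel_affine[of 1 "\<lambda>x. norm (\<psi> x) powr q" y]
    by (auto simp: Lp_norm_def add.commute)
  note H = Lp_Holder[OF g \<psi>t(1,2)]
  have J: "integrable (lborel \<Otimes>\<^sub>M lborel) (\<lambda>(y, x). k y * (g x * \<psi> (x + y)))"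
  proof (rule lborel_pair.Fubini_integrable)
    show "AE y in lborel. integrable lborel (\<lambda>x. case (y, x) of (y, x) \<Rightarrow> k y * (g x * \<psi> (x + y)))"
    proof (intro AE_I2)
      fix y
      have "integrable lborel (\<lambda>x. g x * \<psi> (x + y))"
        by (rule Bochner_Integration.integrable_bound[OF H(1)[of y]]) (auto simp: norm_mult)
      thus "integrable lborel (\<lambda>x. case (y, x) of (y, x) \<Rightarrow> k y * (g x * \<psi> (x + y)))"
        by simp
    qed
    show "integrable lborel (\<lambda>y. LINT x|lborel. norm (case (y, x) of (y, x) \<Rightarrow> k y * (g x * \<psi> (x + y))))"
    proof (rule Bochner_Integration.integrable_bound)
      show "integrable lborel (\<lambda>y. norm (k y) * (Lp_norm p g * Lp_norm q \<psi>))"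
        using k by auto
      show "(\<lambda>y. LINT x|lborel. norm (case (y, x) of (y, x) \<Rightarrow> k y * (g x * \<psi> (x + y)))) \<in> borel_measurable lborel"
        by measurable
      have "norm (LINT x|lborel. norm (k y * (g x * \<psi> (x + y)))) \<le> norm (norm (k y) * (Lp_norm p g * Lp_norm q \<psi>))" for y
      proof -
        have "norm (LINT x|lborel. norm (k y * (g x * \<psi> (x + y)))) = norm (k y) * (LINT x|lborel. norm (g x) * norm (\<psi> (x + y)))"
          by (simp add: norm_mult integral_nonneg_AE)
        also have "\<dots> \<le> norm (k y) * (Lp_norm p g * Lp_norm q (\<lambda>x. \<psi> (x + y)))"
          by (intro mult_left_mono H) auto
        finally show ?thesis
          unfolding \<psi>t(3) by (simp add: Lp_norm_def abs_mult)
      qed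
      thus "AE y in lborel. norm (LINT x|lborel. norm (case (y, x) of (y, x) \<Rightarrow> k y * (g x * \<psi> (x + y)))) \<le> norm (norm (k y) * (Lp_norm p g * Lp_norm q \<psi>))"
        by (intro AE_I2) simp
    qed
  qed measurable
  show "integrable lborel (\<lambda>x. g x * (LINT y|lborel. k y * \<psi> (x + y)))"
    using lborel_pair.integrable_snd[OF J] by (simp add: mult.left_commute)
  have eq: "(LINT x|lborel. k y * (g (x - y) * \<psi> x)) = (LINT x|lborel. k y * (g x * \<psi> (x + y)))" for y
    by (subst integral_lborel_affine[of 1 _ y]) (auto simp: add.commute)
  \<comment> \<open>\<open>I\<close> concerns the integrand before the shift of x by y,
    \<open>J\<close> the one after it; the inner integrals of the norms coincide, so
    \<open>J\<close> yields \<open>I\<close>.\<close>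
  have I: "integrable (lborel \<Otimes>\<^sub>M lborel) (\<lambda>(y, x). k y * (g (x - y) * \<psi> x))"
  proof (rule lborel_pair.Fubini_integrable)
    have inr: "integrable lborel (\<lambda>x. g (x - y) * \<psi> x)" for y
    proof -
      have "integrable lborel (\<lambda>x. g x * \<psi> (x + y))"
        by (rule Bochner_Integration.integrable_bound[OF H(1)[of y]]) (auto simp: norm_mult)
      from integrable_lborel_affine[OF this, of 1 "- y"] show ?thesis
        by simp
    qed
    show "AE y in lborel. integrable lborel (\<lambda>x. case (y, x) of (y, x) \<Rightarrow> k y * (g (x - y) * \<psi> x))"
      using inr by (intro AE_I2) simp
    have "(LINT x|lborel. norm (k y * (g (x - y) * \<psi> x))) = (LINT x|lborel. norm (k y * (g x * \<psi> (x + y))))" for y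
      by (subst integral_lborel_affine[of 1 _ y]) (auto simp: add.commute)
    moreover have "integrable lborel (\<lambda>y. LINT x|lborel. norm (k y * (g x * \<psi> (x + y))))"
      using lborel_pair.integrable_fst'[OF integrable_norm[OF J]] by simp
    ultimately show "integrable lborel (\<lambda>y. LINT x|lborel. norm (case (y, x) of (y, x) \<Rightarrow> k y * (g (x - y) * \<psi> x)))"
      by simp
  qed measurable
  have "(LINT x|lborel. conv k g x * \<psi> x) = (LINT x|lborel. LINT y|lborel. k y * (g (x - y) * \<psi> x))"
    unfolding conv_def integral_mult_left_zero[symmetric] by (simp add: mult.assoc)
  also have "\<dots> = (LINT y|lborel. LINT x|lborel. k y * (g (x - y) * \<psi> x))"
    by (rule lborel_pair.Fubini_integral[OF I])
  also have "\<dots> = (LINT y|lborel. LINT x|lborel. k y * (g x * \<psi> (x + y)))"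
    by (simp only: eq)
  also have "\<dots> = (LINT x|lborel. LINT y|lborel. k y * (g x * \<psi> (x + y)))"
    by (rule lborel_pair.Fubini_integral[OF J, symmetric])
  also have "\<dots> = (LINT x|lborel. g x * (LINT y|lborel. k y * \<psi> (x + y)))"
    unfolding integral_mult_right_zero[symmetric] by (simp add: mult.left_commute)
  finally show "(LINT x|lborel. conv k g x * \<psi> x) = (LINT x|lborel. g x * (LINT y|lborel. k y * \<psi> (x + y)))" .
qed

text \<open>The multiplier acting on a test function is a correlation with the kernel, hence \<psi>
  (x + y): the same transposed integral as in \<open>conv_duality\<close>.\<close>

lemma fourier_kernel_mult:
  fixes k \<psi> :: "'n::finite cfun"
  assumes k: "integrable lborel k" and \<psi>: "\<psi> \<in> schwartz"
    and m: "\<And>\<xi>. m \<xi> = a + (LINT y|lborel. k y * cis (- (y \<bullet> \<xi>)))"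
  shows "fourier (\<lambda>\<xi>. m \<xi> * inv_fourier \<psi> \<xi>) x = a * \<psi> x + (LINT y|lborel. k y * \<psi> (x + y))"
proof -
  let ?u = "inv_fourier \<psi>"
  have u: "?u \<in> schwartz" by (rule inv_fourier_schwartz[OF \<psi>])
  have ui: "integrable lborel ?u" by (rule schwartz_integrable[OF u])
  have \<psi>u: "\<psi> z = fourier_const TYPE('n) * (LINT \<xi>|lborel. ?u \<xi> * cis (- (\<xi> \<bullet> z)))" for z
    using fun_cong[OF fourier_inv_fourier[OF \<psi>], of z] unfolding fourier_cis by simp
  have I: "integrable (lborel \<Otimes>\<^sub>M lborel) (\<lambda>(\<xi>, y). ?u \<xi> * k y * cis (- (\<xi> \<bullet> (x + y))))"
    using integrable_fubini_mult[OF ui k, of "\<lambda>(\<xi>, y). - (\<xi> \<bullet> (x + y))"] by simp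
  have eq: "m \<xi> * ?u \<xi> * cis (- (\<xi> \<bullet> x)) = a * (?u \<xi> * cis (- (\<xi> \<bullet> x))) + (LINT y|lborel. ?u \<xi> * k y * cis (- (\<xi> \<bullet> (x + y))))" for \<xi>
  proof -
    have "(LINT y|lborel. ?u \<xi> * k y * cis (- (\<xi> \<bullet> (x + y)))) = (LINT y|lborel. (?u \<xi> * cis (- (\<xi> \<bullet> x))) * (k y * cis (- (y \<bullet> \<xi>))))"
    proof (intro Bochner_Integration.integral_cong refl)
      fix y
      have "cis (- (\<xi> \<bullet> (x + y))) = cis (- (\<xi> \<bullet> x)) * cis (- (y \<bullet> \<xi>))"
        by (simp add: cis_mult inner_add_right inner_commute[of y \<xi>])
      thus "?u \<xi> * k y * cis (- (\<xi> \<bullet> (x + y))) = (?u \<xi> * cis (- (\<xi> \<bullet> x))) * (k y * cis (- (y \<bullet> \<xi>)))"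
        by (simp add: mult_ac)
    qed
    also have "\<dots> = (?u \<xi> * cis (- (\<xi> \<bullet> x))) * (LINT y|lborel. k y * cis (- (y \<bullet> \<xi>)))"
      by simp
    finally show ?thesis
      by (simp add: m algebra_simps)
  qed
  have "(LINT \<xi>|lborel. m \<xi> * ?u \<xi> * cis (- (\<xi> \<bullet> x))) = 
      (LINT \<xi>|lborel. a * (?u \<xi> * cis (- (\<xi> \<bullet> x)))) + (LINT \<xi>|lborel. LINT y|lborel. ?u \<xi> * k y * cis (- (\<xi> \<bullet> (x + y))))"
    unfolding eq
    using integrable_mult_right[OF integrable_mult_cis[OF ui, of "\<lambda>\<xi>. - (\<xi> \<bullet> x)"], of a] lborel_pair.integrable_fst[OF I]
    by (intro Bochner_Integration.integral_add) auto
  also have "(LINT \<xi>|lborel. LINT y|lborel. ?u \<xi> * k y * cis (- (\<xi> \<bullet> (x + y)))) =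
      (LINT y|lborel. LINT \<xi>|lborel. ?u \<xi> * k y * cis (- (\<xi> \<bullet> (x + y))))"
    by (rule lborel_pair.Fubini_integral[OF I, symmetric])
  also have "\<dots> = (LINT y|lborel. k y * (LINT \<xi>|lborel. ?u \<xi> * cis (- (\<xi> \<bullet> (x + y)))))"
    unfolding integral_mult_right_zero[symmetric] by (simp add: mult_ac)
  finally have "fourier (\<lambda>\<xi>. m \<xi> * ?u \<xi>) x = a * (fourier_const TYPE('n) * (LINT \<xi>|lborel. ?u \<xi> * cis (- (\<xi> \<bullet> x)))) +
      (LINT y|lborel. k y * (fourier_const TYPE('n) * (LINT \<xi>|lborel. ?u \<xi> * cis (- (\<xi> \<bullet> (x + y))))))"
    unfolding fourier_cis
    by (simp only: distrib_left integral_mult_right_zero mult.left_commute[of _ "fourier_const TYPE('n)"])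
  thus ?thesis
    unfolding \<psi>u[symmetric] .
qed

text \<open>The Dirac part acts as a scalar and the kernel by convolution;
  \<open>conv_duality\<close> and \<open>fourier_kernel_mult\<close> meet in the same correlation
  integral.\<close>

lemma L1_multiplier_operator:
  fixes m :: "'n::finite cfun"
  assumes "L1_multiplier C m"
  obtains T where "Lp_multiplier_operator p C m T"
proof -
  obtain k a where k: "integrable lborel k" "norm a + (LINT y|lborel. norm (k y)) \<le> C"
      "\<forall>\<xi>. m \<xi> = a + (LINT y|lborel. k y * cis (- (y \<bullet> \<xi>)))"
    by (rule L1_multiplierE[OF assms])
  have [measurable]: "k \<in> borel_measurable borel"
    using k(1) by auto
  define T where "T g = (\<lambda>x. a * g x + conv k g x)" for g
  show ?thesis
  proof (rule that[of T], unfold Lp_multiplier_operator_def, intro conjI ballI allI impI)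
    fix g :: "'n cfun" assume g: "g \<in> Lp p"
    note ag = Lp_cmult[OF g, of a] and kg = conv_Lp[OF k(1) g]
    have "Lp_norm p (T g) \<le> 2 * (norm a * Lp_norm p g + Lp_norm p (conv k g))"
      unfolding T_def ag(2)[symmetric] by (rule Lp_add(2)[OF ag(1) kg(1)])
    also have "\<dots> \<le> 2 * (norm a * Lp_norm p g + (LINT y|lborel. norm (k y)) * Lp_norm p g)"
      using kg(2) by simp
    also have "\<dots> = 2 * (norm a + (LINT y|lborel. norm (k y))) * Lp_norm p g"
      by (simp add: algebra_simps)
    also have "\<dots> \<le> 2 * C * Lp_norm p g"
      using k(2) Lp_norm_nonneg[of g] by (intro mult_right_mono) auto
    finally show "Lp_norm p (T g) \<le> 2 * C * Lp_norm p g" .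
    show "T g \<in> Lp p"
      unfolding T_def using Lp_add(1)[OF ag(1) kg(1)] .
    fix \<psi> :: "'n cfun" assume \<psi>: "\<psi> \<in> schwartz"
    have "(LINT x|lborel. T g x * \<psi> x) = (LINT x|lborel. a * g x * \<psi> x + conv k g x * \<psi> x)"
      by (simp add: T_def distrib_right)
    also have "\<dots> = (LINT x|lborel. a * g x * \<psi> x) + (LINT x|lborel. conv k g x * \<psi> x)"
      by (intro Bochner_Integration.integral_add Lp_schwartz_integrable ag kg \<psi>)
    also have "\<dots> = (LINT x|lborel. a * g x * \<psi> x) + (LINT x|lborel. g x * (LINT y|lborel. k y * \<psi> (x + y)))"
      by (simp only: conv_duality(2)[OF k(1) g \<psi>])
    also have "\<dots> = (LINT x|lborel. a * g x * \<psi> x + g x * (LINT y|lborel. k y * \<psi> (x + y)))"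
      by (intro Bochner_Integration.integral_add[symmetric] Lp_schwartz_integrable ag conv_duality(1)[OF k(1) g] \<psi>)
    also have "\<dots> = (LINT x|lborel. g x * fourier (\<lambda>\<xi>. m \<xi> * inv_fourier \<psi> \<xi>) x)"
      unfolding fourier_kernel_mult[OF k(1) \<psi> k(3)[rule_format]] by (simp add: algebra_simps)
    finally show "(LINT x|lborel. T g x * \<psi> x) = (LINT x|lborel. g x * fourier (\<lambda>\<xi>. m \<xi> * inv_fourier \<psi> \<xi>) x)" .
  next
    fix g g' :: "'n cfun" assume *: "g \<in> Lp p" "g' \<in> Lp p" "AE x in lborel. g x = g' x"
    show "AE x in lborel. T g x = T g' x"
      using *(3) unfolding T_def
      by eventually_elim (use conv_cong_AE[OF *(3) _ LpD(1)[OF *(1)] LpD(1)[OF *(2)]] in simp)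
  qed (auto simp: T_def conv_def)
qed

end

section \<open>The order of optimal recovery\<close>

lemma count_list_concat_replicate:
  "distinct xs \<Longrightarrow> count_list (concat (map (\<lambda>i. replicate (f i) i) xs)) j = (if j \<in> set xs then f j else 0)"
proof (induction xs)
  case (Cons x xs)
  have "count_list (replicate n x) j = (if j = x then n else 0)" for n
    by (induction n) auto
  then show ?case
    using Cons by auto
qed auto

text \<open>\<open>mi_dirs\<close> is a choice, so a suitable list has to be exhibited first: every
  index repeated as often as \<alpha> prescribes.\<close>

lemma length_mi_dirs: "length (mi_dirs \<alpha>) = mi_size \<alpha>"
proof -
  obtain xs :: "'a list" where xs: "set xs = UNIV" "distinct xs"
    using finite_distinct_list[of "UNIV :: 'a set"] by auto
  have "\<exists>ds. \<forall>i. count_list ds i = \<alpha> $ i"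
    using count_list_concat_replicate[OF xs(2), of "\<lambda>i. \<alpha> $ i"] xs(1) by auto
  hence "\<forall>i. count_list (mi_dirs \<alpha>) i = \<alpha> $ i"
    unfolding mi_dirs_def by (rule someI_ex)
  thus ?thesis
    unfolding mi_size_def using sum_count_set[of "mi_dirs \<alpha>" UNIV] by simp
qed

lemma iter_partial_dilate:
  fixes \<phi> :: "'n::finite cfun"
  assumes "\<phi> \<in> schwartz"
  shows "iter_partial ds (\<lambda>x. \<phi> (r *\<^sub>R x)) = (\<lambda>x. complex_of_real (r ^ length ds) * iter_partial ds \<phi> (r *\<^sub>R x))"
proof (induction ds)
  case Nil
  then show ?case by (simp add: iter_partial_def)
next
  case (Cons i ds)
  have d: "iter_partial ds \<phi> differentiable (at y)" for y
    by (intro schwartz_differentiable schwartz_iter_partial assms)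
  have "iter_partial (i # ds) (\<lambda>x. \<phi> (r *\<^sub>R x)) = partial i (\<lambda>x. complex_of_real (r ^ length ds) * iter_partial ds \<phi> (r *\<^sub>R x))"
    using Cons by (simp add: iter_partial_def)
  also have "\<dots> = (\<lambda>x. complex_of_real (r ^ length (i # ds)) * iter_partial (i # ds) \<phi> (r *\<^sub>R x))"
    using d by (auto simp: partial_mult partial_dilate iter_partial_def)
  finally show ?case .
qed

text \<open>The bump of the lower bound has to be an element of \<open>bessel_space\<close>. Since f
  is integrable, the sup seminorm alone controls the pairing, and continuity needs just one basic
  neighbourhood.\<close>

lemma tempered_distr_of_schwartz:
  fixes f :: "'n::finite cfun"
  assumes f: "f \<in> schwartz"
  shows "tempered (distr_of f)"
  unfolding tempered_def
proof (intro conjI ballI allI)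
  have fi: "integrable lborel f"
    by (rule schwartz_integrable[OF f])
  have prod: "integrable lborel (\<lambda>x. f x * \<phi> x)" if \<phi>: "\<phi> \<in> schwartz" for \<phi>
  proof -
    obtain B where B: "\<And>x. norm (\<phi> x) \<le> B"
      using schwartz_bounded[OF \<phi>] by metis
    note [measurable] = schwartz_measurable[OF f] schwartz_measurable[OF \<phi>]
    have "norm (f x * \<phi> x) \<le> norm (B * norm (f x))" for x
      using mult_left_mono[OF B[of x], of "norm (f x)"] order_trans[OF norm_ge_zero B[of x]]
      by (simp add: norm_mult abs_mult mult.commute)
    thus ?thesis
      by (intro Bochner_Integration.integrable_bound[OF integrable_mult_right[OF integrable_norm[OF fi], of B]]) auto
  qed
  show "distr_of f (\<lambda>x. a * \<phi> x + b * \<psi> x) = a * distr_of f \<phi> + b * distr_of f \<psi>"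
    if "\<phi> \<in> schwartz" "\<psi> \<in> schwartz" for \<phi> \<psi> a b
  proof -
    have "distr_of f (\<lambda>x. a * \<phi> x + b * \<psi> x) = (LINT x|lborel. a * (f x * \<phi> x) + b * (f x * \<psi> x))"
      by (simp add: distr_of_def algebra_simps)
    also have "\<dots> = a * distr_of f \<phi> + b * distr_of f \<psi>"
      unfolding distr_of_def using prod that by simp
    finally show ?thesis .
  qed
  show "continuous_map schwartz_topology euclidean (distr_of f)"
    unfolding continuous_map_def
  proof (intro conjI allI impI)
    fix U :: "complex set" assume "openin euclidean U"
    hence U: "open U" by simp
    show "openin schwartz_topology {\<phi> \<in> topspace schwartz_topology. distr_of f \<phi> \<in> U}"
    proof (subst openin_subopen, intro ballI)
      fix \<phi> assume "\<phi> \<in> {\<phi> \<in> topspace schwartz_topology. distr_of f \<phi> \<in> U}"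
      hence \<phi>: "\<phi> \<in> schwartz" and \<phi>U: "distr_of f \<phi> \<in> U"
        unfolding schwartz_topology_def topology_generated_by_topspace by auto
      obtain e where e: "e > 0" "ball (distr_of f \<phi>) e \<subseteq> U"
        using U \<phi>U by (rule openE)
      let ?I = "LINT x|lborel. norm (f x)"
      have I: "?I \<ge> 0" by simp
      have I1: "?I + 1 > 0" using I by (intro add_nonneg_pos) auto
      \<comment> \<open>Adding 1 avoids division by zero for f = 0 and makes the final estimate
        strict.\<close>
      have pos: "e / (?I + 1) > 0"
        using e(1) I by (intro divide_pos_pos add_nonneg_pos) auto
      define T where "T = {\<psi> \<in> schwartz. schwartz_seminorm 0 [] (\<lambda>x. \<psi> x - \<phi> x) < e / (?I + 1)}"
      have T: "openin schwartz_topology T"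
        unfolding schwartz_topology_def T_def using \<phi> pos
        by (intro topology_generated_by_Basis CollectI exI[of _ 0] exI[of _ "[]"] exI[of _ \<phi>] exI[of _ "e / (?I + 1)"]
              conjI refl)
      moreover have "\<phi> \<in> T"
        using \<phi> pos by (simp add: T_def schwartz_seminorm_def iter_partial_def)
      moreover have "distr_of f \<psi> \<in> U" if "\<psi> \<in> T" for \<psi>
      proof -
        have \<psi>: "\<psi> \<in> schwartz" and less: "(SUP x. norm (\<psi> x - \<phi> x)) < e / (?I + 1)"
          using that by (auto simp: T_def schwartz_seminorm_def iter_partial_def)
        let ?S = "SUP x. norm (\<psi> x - \<phi> x)"
        obtain B where "\<And>x. norm (\<psi> x - \<phi> x) \<le> B"
          using schwartz_bounded[OF schwartz_minus[OF \<psi> \<phi>]] by metis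
        hence S: "norm (\<psi> x - \<phi> x) \<le> ?S" for x
          by (intro cSUP_upper bdd_aboveI2) auto
        have "distr_of f \<psi> - distr_of f \<phi> = (LINT x|lborel. f x * (\<psi> x - \<phi> x))"
          unfolding distr_of_def using prod[OF \<psi>] prod[OF \<phi>] by (simp add: right_diff_distrib)
        also have "norm \<dots> \<le> (LINT x|lborel. norm (f x * (\<psi> x - \<phi> x)))"
          by (rule integral_norm_bound)
        also have "\<dots> \<le> (LINT x|lborel. norm (f x) * ?S)"
        proof (rule integral_mono)
          show "integrable lborel (\<lambda>x. norm (f x * (\<psi> x - \<phi> x)))"
            by (intro integrable_norm prod schwartz_minus \<psi> \<phi>)
        qed (use fi S in \<open>auto simp: norm_mult intro!: mult_left_mono\<close>)
        also have "\<dots> = ?I * ?S"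
          by simp
        also have "\<dots> \<le> ?I * (e / (?I + 1))"
          using less I by (intro mult_left_mono) auto
        also have "?I * (e / (?I + 1)) = e - e / (?I + 1)"
          using I1 by (simp add: field_simps)
        also have "\<dots> < e"
          using pos by simp
        finally have "distr_of f \<psi> \<in> ball (distr_of f \<phi>) e"
          by (simp add: dist_norm norm_minus_commute)
        thus ?thesis using e(2) by blast
      qed
      ultimately show "\<exists>T. openin schwartz_topology T \<and> \<phi> \<in> T \<and> T \<subseteq> {\<phi> \<in> topspace schwartz_topology. distr_of f \<phi> \<in> U}"
        using openin_subset[OF T] by (intro exI[of _ T]) blast
    qed
  qed simp
qed

text \<open>The norm is an infimum over representing functions. Settling for a representative within
  a factor 2 bypasses the uniqueness of representatives; c > 0 makes c < 2c.\<close>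

lemma distr_Lp_norm_leD:
  assumes "distr_Lp_norm p u \<le> ennreal c" "c > 0"
  obtains g where "g \<in> Lp p" "represents g u" "Lp_norm p g \<le> 2 * c"
proof -
  have "ennreal c < ennreal (2 * c)"
    using assms(2) by (simp add: ennreal_less_iff)
  hence "distr_Lp_norm p u < ennreal (2 * c)"
    using assms(1) by (rule le_less_trans[rotated])
  then obtain g where "g \<in> Lp p" "represents g u" "ennreal (Lp_norm p g) < ennreal (2 * c)"
    unfolding distr_Lp_norm_def INF_less_iff by auto
  thus ?thesis
    using that assms(2) by (auto simp: ennreal_less_iff Lp_norm_def)
qed

lemma distr_Lp_norm_leI:
  assumes "g \<in> Lp p" "represents g u" "Lp_norm p g \<le> c"
  shows "distr_Lp_norm p u \<le> ennreal c"
  unfolding distr_Lp_norm_def using assms by (intro INF_lower2[of g]) (auto intro: ennreal_leI)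

lemma bessel_op_apply:
  "bessel_op s u \<phi> = u (fourier (\<lambda>\<xi>. complex_of_real ((1 + (norm \<xi>)\<^sup>2) powr (s / 2)) * inv_fourier \<phi> \<xi>))"
  by (simp add: bessel_op_def distr_inv_fourier_def distr_mult_def distr_fourier_def)

text \<open>The last two identities are the balance of the errors: noise amplified by h^(-L), and
  smoothness E gaining h^(s-L), both yield the rate. The third one converts the noise level into the
  smoothness level in the lower bound.\<close>

lemma scale_identities:
  fixes E \<delta> s L :: real
  assumes "0 < \<delta>" "\<delta> < E" "s > 0"
  defines "h \<equiv> (\<delta> / E) powr (1 / s)"
  shows "0 < h" "h < 1" "h powr (- s) * \<delta> = E"
    "h powr (- L) * \<delta> = E powr (L / s) * \<delta> powr (1 - L / s)"
    "h powr (s - L) * E = E powr (L / s) * \<delta> powr (1 - L / s)"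
proof -
  have E: "E > 0" using assms by simp
  have h: "h powr t = \<delta> powr (t / s) / E powr (t / s)" for t
    unfolding h_def using assms E by (simp add: powr_powr powr_divide)
  show "0 < h" using assms E by (simp add: h_def)
  show "h < 1"
    using assms(1-3) E powr_less_mono2[of "1 / s" "\<delta> / E" 1] unfolding h_def by simp
  show "h powr (- s) * \<delta> = E"
    unfolding h using assms E by (simp add: powr_minus_divide)
  show "h powr (- L) * \<delta> = E powr (L / s) * \<delta> powr (1 - L / s)"
    unfolding h using assms E by (simp add: powr_minus_divide powr_diff)
  have "(s - L) / s = 1 - L / s"
    using assms by (simp add: diff_divide_distrib)
  thus "h powr (s - L) * E = E powr (L / s) * \<delta> powr (1 - L / s)"
    unfolding h using assms E by (simp add: powr_diff)
qed

section \<open>Admissible data and the upper bound\<close>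

definition recovery_data :: "real \<Rightarrow> real \<Rightarrow> real \<Rightarrow> real \<Rightarrow> ('n::finite distr \<times> 'n cfun) set" where
  "recovery_data p s E \<delta> = {(f, f\<^sub>\<delta>). f \<in> bessel_space s p \<and> f\<^sub>\<delta> \<in> Lp p \<and> bessel_norm s p f \<le> ennreal E \<and>
     distr_Lp_norm p (distr_diff f (distr_of f\<^sub>\<delta>)) \<le> ennreal \<delta>}"

definition recovery_rate :: "nat ^ 'n::finite \<Rightarrow> real \<Rightarrow> real \<Rightarrow> real \<Rightarrow> real" where
  "recovery_rate \<alpha> s E \<delta> = E powr (real (mi_size \<alpha>) / s) * \<delta> powr (1 - real (mi_size \<alpha>) / s)"

lemma recovery_upper_bound:
  fixes p s :: real and \<alpha> :: "nat ^ 'n::finite"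
  assumes p: "1 < p" and s: "0 < s" and \<alpha>: "real (mi_size \<alpha>) < s"
  obtains C where "C > 0" "\<forall>E \<delta>. 0 < \<delta> \<and> \<delta> < E \<longrightarrow> (\<exists>A\<in>Lp_maps p. (\<forall>x. A (\<lambda>_. 0) x = 0) \<and>
    (\<forall>(f, f\<^sub>\<delta>)\<in>recovery_data p s E \<delta>. distr_Lp_norm p (distr_diff (distr_partial \<alpha> f) (distr_of (A f\<^sub>\<delta>))) \<le>
       ennreal (C * recovery_rate \<alpha> s E \<delta>)))"
proof -
  let ?L = "mi_size \<alpha>" and ?ds = "mi_dirs \<alpha>"
  define q where "q = p / (p - 1)"
  have pq: "p > 1" "q > 1" "1 / p + 1 / q = 1"
    using p by (auto simp: q_def field_simps)
  obtain C where C: "C > 0" and split: "\<forall>h. 0 < h \<longrightarrow> h < 1 \<longrightarrow> (\<exists>a b. L1_multiplier (C * h powr (- real ?L)) a \<and> schwartz_multiplier a \<and>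
       L1_multiplier (C * h powr (s - real ?L)) b \<and> schwartz_multiplier b \<and>
       (\<forall>\<xi>. deriv_symbol ?ds \<xi> = a \<xi> + complex_of_real ((1 + (norm \<xi>)\<^sup>2) powr (s / 2)) * b \<xi>))"
    using \<alpha> by (rule deriv_symbol_splitting[of ?ds s, unfolded length_mi_dirs])
  show ?thesis
  \<comment> \<open>16 is a factor 2 for the choice of representatives, 2 for the operator norm, 2
    for the two error terms and 2 for their addition by \<open>Lp_add\<close>.\<close>
  proof (rule that[of "16 * C"]; (intro allI impI)?)
    show "16 * C > 0" using C by simp
    fix E \<delta> :: real assume E\<delta>: "0 < \<delta> \<and> \<delta> < E"
    let ?K = "recovery_rate \<alpha> s E \<delta>"
    define h where "h = (\<delta> / E) powr (1 / s)"
    note h = scale_identities[OF conjunct1[OF E\<delta>] conjunct2[OF E\<delta>] s, folded h_def]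
    obtain a b where La: "L1_multiplier (C * h powr (- real ?L)) a" and sa: "schwartz_multiplier a" and
       Lb: "L1_multiplier (C * h powr (s - real ?L)) b" and sb: "schwartz_multiplier b" and
       ab: "\<forall>\<xi>. deriv_symbol ?ds \<xi> = a \<xi> + complex_of_real ((1 + (norm \<xi>)\<^sup>2) powr (s / 2)) * b \<xi>"
      using split[rule_format, OF h(1,2)] by (elim exE conjE)
    obtain Ta where Ta: "Lp_multiplier_operator p (C * h powr (- real ?L)) a Ta"
      by (rule L1_multiplier_operator[OF pq La])
    obtain Tb where Tb: "Lp_multiplier_operator p (C * h powr (s - real ?L)) b Tb"
      by (rule L1_multiplier_operator[OF pq Lb])
    \<comment> \<open>The sign is the one in \<open>distr_partial\<close>, which the symbol a does
      not contain.\<close>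
    define A where "A g = (\<lambda>x. (- 1) ^ ?L * Ta g x)" for g
    have "A \<in> Lp_maps p"
      unfolding Lp_maps_def A_def
    proof (intro CollectI conjI ballI impI)
      fix g :: "'n cfun" assume g: "g \<in> Lp p"
      show "(\<lambda>x. (- 1) ^ ?L * Ta g x) \<in> Lp p"
        using Lp_multiplier_operatorD(2)[OF Ta g] by (rule Lp_cmult[OF pq])
      fix g' :: "'n cfun" assume g': "g' \<in> Lp p" "AE x in lborel. g x = g' x"
      have "AE x in lborel. Ta g x = Ta g' x"
        by (rule Lp_multiplier_operatorD(5)[OF Ta g g'])
      thus "AE x in lborel. (- 1) ^ ?L * Ta g x = (- 1) ^ ?L * Ta g' x"
        by eventually_elim simp
    qed
    moreover have "\<forall>x. A (\<lambda>_. 0) x = 0"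
      using Lp_multiplier_operatorD(1)[OF Ta] by (simp add: A_def)
    moreover have "distr_Lp_norm p (distr_diff (distr_partial \<alpha> f) (distr_of (A f\<^sub>\<delta>))) \<le> ennreal (16 * C * ?K)"
      if "(f, f\<^sub>\<delta>) \<in> recovery_data p s E \<delta>" for f f\<^sub>\<delta>
    proof -
      have f: "f \<in> bessel_space s p" and f\<delta>: "f\<^sub>\<delta> \<in> Lp p" and fE: "bessel_norm s p f \<le> ennreal E"
        and fd: "distr_Lp_norm p (distr_diff f (distr_of f\<^sub>\<delta>)) \<le> ennreal \<delta>"
        using that by (auto simp: recovery_data_def)
      obtain g where g: "g \<in> Lp p" "represents g (bessel_op s f)" "Lp_norm p g \<le> 2 * E"
        using fE E\<delta> unfolding bessel_norm_def by (auto elim: distr_Lp_norm_leD)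
      obtain r where r: "r \<in> Lp p" "represents r (distr_diff f (distr_of f\<^sub>\<delta>))" "Lp_norm p r \<le> 2 * \<delta>"
        using fd E\<delta> by (auto elim: distr_Lp_norm_leD)
      note Tar = Lp_multiplier_operatorD(2,3)[OF Ta r(1)] and Tbg = Lp_multiplier_operatorD(2,3)[OF Tb g(1)]
      \<comment> \<open>The reconstruction error as a function: r represents the difference of f and
        the data, and g represents the Bessel derivative of f.\<close>
      define w where "w = (\<lambda>x. (- 1) ^ ?L * (Ta r x + Tb g x))"
      have sum: "(\<lambda>x. Ta r x + Tb g x) \<in> Lp p" "Lp_norm p (\<lambda>x. Ta r x + Tb g x) \<le> 2 * (Lp_norm p (Ta r) + Lp_norm p (Tb g))"
        using Lp_add[OF pq Tar(1) Tbg(1)] .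
      have w: "w \<in> Lp p" "Lp_norm p w = Lp_norm p (\<lambda>x. Ta r x + Tb g x)"
        unfolding w_def using Lp_cmult[OF pq sum(1), of "(- 1) ^ ?L"] by (auto simp: norm_power)
      have "Lp_norm p (Ta r) \<le> 2 * (C * h powr (- real ?L)) * (2 * \<delta>)"
        using r(3) C by (intro order_trans[OF Tar(2)] mult_left_mono) auto
      also have "\<dots> = 4 * C * (h powr (- real ?L) * \<delta>)"
        by simp
      also have "\<dots> = 4 * C * ?K"
        by (simp only: h(4) recovery_rate_def)
      finally have 1: "Lp_norm p (Ta r) \<le> 4 * C * ?K" .
      have "Lp_norm p (Tb g) \<le> 2 * (C * h powr (s - real ?L)) * (2 * E)"
        using g(3) C by (intro order_trans[OF Tbg(2)] mult_left_mono) auto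
      also have "\<dots> = 4 * C * (h powr (s - real ?L) * E)"
        by simp
      also have "\<dots> = 4 * C * ?K"
        by (simp only: h(5) recovery_rate_def)
      finally have 2: "Lp_norm p (Tb g) \<le> 4 * C * ?K" .
      have "Lp_norm p w \<le> 2 * (4 * C * ?K + 4 * C * ?K)"
        unfolding w(2) by (intro order_trans[OF sum(2)] mult_left_mono add_mono 1 2) simp
      hence w_le: "Lp_norm p w \<le> 16 * C * ?K"
        by simp
      have "represents w (distr_diff (distr_partial \<alpha> f) (distr_of (A f\<^sub>\<delta>)))"
        unfolding represents_def
      proof
        fix \<psi> :: "'n cfun" assume \<psi>: "\<psi> \<in> schwartz"
        let ?m = "\<lambda>\<xi>. complex_of_real ((1 + (norm \<xi>)\<^sup>2) powr (s / 2))"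
        define u where "u = inv_fourier \<psi>"
        have u: "u \<in> schwartz" unfolding u_def by (rule inv_fourier_schwartz[OF \<psi>])
        have au: "(\<lambda>\<xi>. a \<xi> * u \<xi>) \<in> schwartz" and bu: "(\<lambda>\<xi>. b \<xi> * u \<xi>) \<in> schwartz"
          using sa sb u by (auto intro: schwartz_multiplierD)
        have mbu: "(\<lambda>\<xi>. ?m \<xi> * (b \<xi> * u \<xi>)) \<in> schwartz"
          using schwartz_powr_mult[OF bu, of 1 1 "s / 2"] by simp
        \<comment> \<open>Writing \<psi> as the transform of u turns its derivative into
          multiplication of u by the symbol that is to be split.\<close>
        have "mi_partial \<alpha> \<psi> = fourier (\<lambda>\<xi>. deriv_symbol ?ds \<xi> * u \<xi>)"
          unfolding mi_partial_def u_def 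
          by (subst iter_partial_fourier[OF inv_fourier_schwartz[OF \<psi>], symmetric]) (simp add: fourier_inv_fourier \<psi>)
        also have "(\<lambda>\<xi>. deriv_symbol ?ds \<xi> * u \<xi>) = (\<lambda>\<xi>. a \<xi> * u \<xi> + ?m \<xi> * (b \<xi> * u \<xi>))"
          using ab by (simp add: distrib_right mult.assoc)
        \<comment> \<open>The factors 1 bring the sum into the shape of the linearity clause of
          \<open>tempered\<close>.\<close>
        also have "fourier \<dots> = (\<lambda>x. 1 * fourier (\<lambda>\<xi>. a \<xi> * u \<xi>) x + 1 * fourier (\<lambda>\<xi>. ?m \<xi> * (b \<xi> * u \<xi>)) x)"
          using schwartz_integrable[OF au] schwartz_integrable[OF mbu] by (auto simp: fourier_add)
        finally have "f (mi_partial \<alpha> \<psi>) = f (\<lambda>x. 1 * fourier (\<lambda>\<xi>. a \<xi> * u \<xi>) x + 1 * fourier (\<lambda>\<xi>. ?m \<xi> * (b \<xi> * u \<xi>)) x)"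
          by simp
        also have "\<dots> = 1 * f (fourier (\<lambda>\<xi>. a \<xi> * u \<xi>)) + 1 * f (fourier (\<lambda>\<xi>. ?m \<xi> * (b \<xi> * u \<xi>)))"
          using f fourier_schwartz[OF au] fourier_schwartz[OF mbu] unfolding bessel_space_def tempered_def by blast
        \<comment> \<open>The Bessel weight is passed from the test function to f, where it becomes
          \<open>bessel_op s f\<close> and is represented by g.\<close>
        also have "f (fourier (\<lambda>\<xi>. ?m \<xi> * (b \<xi> * u \<xi>))) = bessel_op s f (fourier (\<lambda>\<xi>. b \<xi> * u \<xi>))"
          unfolding bessel_op_apply inv_fourier_fourier[OF bu] ..
        also have "\<dots> = (LINT x|lborel. g x * fourier (\<lambda>\<xi>. b \<xi> * u \<xi>) x)"
          using g(2) fourier_schwartz[OF bu] unfolding represents_def distr_of_def by blast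
        also have "\<dots> = (LINT x|lborel. Tb g x * \<psi> x)"
          unfolding u_def by (rule Lp_multiplier_operatorD(4)[OF Tb g(1) \<psi>, symmetric])
        \<comment> \<open>In the a-part f is replaced by data plus noise. The data term is what the
          reconstruction produces and cancels in the error.\<close>
        also have "f (fourier (\<lambda>\<xi>. a \<xi> * u \<xi>)) = distr_of f\<^sub>\<delta> (fourier (\<lambda>\<xi>. a \<xi> * u \<xi>)) + distr_of r (fourier (\<lambda>\<xi>. a \<xi> * u \<xi>))"
          using r(2) fourier_schwartz[OF au] unfolding represents_def distr_diff_def by (simp add: algebra_simps)
        also have "distr_of f\<^sub>\<delta> (fourier (\<lambda>\<xi>. a \<xi> * u \<xi>)) = (LINT x|lborel. Ta f\<^sub>\<delta> x * \<psi> x)"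
          unfolding distr_of_def u_def by (rule Lp_multiplier_operatorD(4)[OF Ta f\<delta> \<psi>, symmetric])
        also have "distr_of r (fourier (\<lambda>\<xi>. a \<xi> * u \<xi>)) = (LINT x|lborel. Ta r x * \<psi> x)"
          unfolding distr_of_def u_def by (rule Lp_multiplier_operatorD(4)[OF Ta r(1) \<psi>, symmetric])
        finally have f_eq: "f (mi_partial \<alpha> \<psi>) = (LINT x|lborel. Ta f\<^sub>\<delta> x * \<psi> x) + (LINT x|lborel. Ta r x * \<psi> x) + (LINT x|lborel. Tb g x * \<psi> x)"
          by simp
        have "distr_of w \<psi> = (LINT x|lborel. (- 1) ^ ?L * (Ta r x * \<psi> x + Tb g x * \<psi> x))"
          unfolding distr_of_def w_def by (simp add: algebra_simps)
        also have "\<dots> = (- 1) ^ ?L * ((LINT x|lborel. Ta r x * \<psi> x) + (LINT x|lborel. Tb g x * \<psi> x))"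
          using Lp_schwartz_integrable[OF pq Tar(1) \<psi>] Lp_schwartz_integrable[OF pq Tbg(1) \<psi>] by simp
        finally have w_eq: "distr_of w \<psi> = (- 1) ^ ?L * ((LINT x|lborel. Ta r x * \<psi> x) + (LINT x|lborel. Tb g x * \<psi> x))" .
        have "distr_of (A f\<^sub>\<delta>) \<psi> = (- 1) ^ ?L * (LINT x|lborel. Ta f\<^sub>\<delta> x * \<psi> x)"
          unfolding distr_of_def A_def by (simp add: mult.assoc)
        thus "distr_diff (distr_partial \<alpha> f) (distr_of (A f\<^sub>\<delta>)) \<psi> = distr_of w \<psi>"
          unfolding distr_diff_def distr_partial_def f_eq w_eq by (simp add: algebra_simps)
      qed
      thus ?thesis
        using w(1) w_le by (intro distr_Lp_norm_leI)
    qed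
    ultimately show "\<exists>A\<in>Lp_maps p. (\<forall>x. A (\<lambda>_. 0) x = 0) \<and> (\<forall>(f, f\<^sub>\<delta>)\<in>recovery_data p s E \<delta>.
        distr_Lp_norm p (distr_diff (distr_partial \<alpha> f) (distr_of (A f\<^sub>\<delta>))) \<le> ennreal (16 * C * ?K))"
      by blast
  qed
qed

section \<open>The lower bound\<close>

text \<open>The pairing turns into \<open>\<integral> v\<^sup>2\<close> with \<open>v = (-i\<xi>)\<^sup>\<alpha> exp(-|\<xi>|\<^sup>2/2)\<close> on the Fourier side.\<close>

lemma deriv_gauss_pairing_nonzero:
  fixes ds :: "'n::finite list"
  defines "v \<equiv> \<lambda>\<xi>. deriv_symbol ds \<xi> * gauss \<xi>"
  shows "v \<in> schwartz" "(LINT x|lborel. inv_fourier v x * iter_partial ds gauss x) \<noteq> 0"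
proof -
  show v: "v \<in> schwartz"
    unfolding v_def by (intro schwartz_multiplierD schwartz_multiplier_deriv_symbol gauss_schwartz)
  have "iter_partial ds gauss = fourier v"
    unfolding v_def using iter_partial_fourier[OF gauss_schwartz] by (simp add: fourier_gauss)
  hence "(LINT x|lborel. inv_fourier v x * iter_partial ds gauss x) = (LINT x|lborel. inv_fourier v x * fourier v x)"
    by simp
  also have "\<dots> = (LINT x|lborel. v x * v x)"
    using fourier_mult_formula[OF schwartz_integrable[OF inv_fourier_schwartz[OF v]] schwartz_integrable[OF v]]
    by (simp add: fourier_inv_fourier v)
  \<comment> \<open>The pairing is bilinear, without conjugation, but each factor -i x_i squares to
    -x_i^2, so v^2 has a constant sign and its integral cannot cancel.\<close>
  also have "(\<lambda>x. v x * v x) = (\<lambda>x. (- 1) ^ length ds * complex_of_real ((norm (v x))\<^sup>2))"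
  proof
    fix x
    have "deriv_symbol ds x * deriv_symbol ds x = (- 1) ^ length ds * complex_of_real ((norm (deriv_symbol ds x))\<^sup>2)"
    proof (induction ds)
      case (Cons i ds)
      let ?D = "deriv_symbol ds x"
      have "deriv_symbol (i # ds) x = - \<i> * complex_of_real (x $ i) * ?D"
        by (simp add: deriv_symbol_def)
      hence "deriv_symbol (i # ds) x * deriv_symbol (i # ds) x = (- \<i> * - \<i>) * (complex_of_real ((x $ i)\<^sup>2) * (?D * ?D))"
        by (simp only: power2_eq_square of_real_mult mult_ac)
      also have "\<dots> = (- 1) ^ length (i # ds) * complex_of_real ((x $ i)\<^sup>2 * (norm ?D)\<^sup>2)"
        unfolding Cons by simp
      also have "(x $ i)\<^sup>2 * (norm ?D)\<^sup>2 = (norm (deriv_symbol (i # ds) x))\<^sup>2"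
        by (simp add: deriv_symbol_def norm_mult power_mult_distrib)
      finally show ?case .
    qed (simp add: deriv_symbol_def)
    thus "v x * v x = (- 1) ^ length ds * complex_of_real ((norm (v x))\<^sup>2)"
      by (simp add: v_def gauss_def norm_mult power2_eq_square mult_ac)
  qed
  finally have eq: "(LINT x|lborel. inv_fourier v x * iter_partial ds gauss x) = 
      (- 1) ^ length ds * complex_of_real (LINT x|lborel. (norm (v x))\<^sup>2)"
    unfolding integral_mult_right_zero integral_complex_of_real .
  have vi: "integrable lborel (\<lambda>x. (norm (v x))\<^sup>2)"
    using schwartz_powr_integrable[OF v, of 2] by (simp add: powr_numeral)
  have "(LINT x|lborel. (norm (v x))\<^sup>2) \<noteq> 0"
  proof
    assume "(LINT x|lborel. (norm (v x))\<^sup>2) = 0"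
    hence "AE x in lborel. (norm (v x))\<^sup>2 = 0"
      using vi by (subst (asm) integral_nonneg_eq_0_iff_AE) auto
    \<comment> \<open>On this unit cube all coordinates lie in [1, 2], so v has no zero on a set of
      positive measure.\<close>
    moreover have "v x \<noteq> 0" if "x \<in> cbox 1 2" for x
    proof -
      have "x $ i \<noteq> 0" for i
        using that by (auto simp: mem_box_cart dest!: spec[of _ i])
      hence "deriv_symbol ds x \<noteq> 0"
        by (induction ds) (auto simp: deriv_symbol_def)
      thus ?thesis by (simp add: v_def gauss_def)
    qed
    ultimately have "AE x in lborel. x \<notin> cbox 1 (2 :: real^'n)"
      by (auto elim!: eventually_mono)
    hence "emeasure lborel (cbox 1 (2 :: real^'n)) = 0"
      by (subst (asm) AE_iff_null_sets[symmetric]) auto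
    moreover have "1 \<bullet> b \<le> 2 \<bullet> b" if "b \<in> Basis" for b :: "real^'n"
      using that by (auto simp: Basis_vec_def inner_axis)
    hence "emeasure lborel (cbox 1 (2 :: real^'n)) = (\<Prod>b\<in>Basis. ((2 - 1) :: real^'n) \<bullet> b)"
      by (rule emeasure_lborel_cbox)
    moreover have "(\<Prod>b\<in>Basis. ((2 - 1) :: real^'n) \<bullet> b) = 1"
      by (intro prod.neutral) (auto simp: Basis_vec_def inner_axis)
    ultimately show False by simp
  qed
  thus "(LINT x|lborel. inv_fourier v x * iter_partial ds gauss x) \<noteq> 0"
    unfolding eq by simp
qed

text \<open>The factor h^n from transforming a dilate cancels against the inverse transform. The
  weight at scale h on a bump of width h is thus the dilate of an h-independent function.\<close>

lemma inv_fourier_mult_dilate: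
  fixes \<phi> :: "'n::finite cfun"
  assumes h: "h > 0"
  shows "inv_fourier (\<lambda>\<xi>. complex_of_real ((1 + h\<^sup>2 * (norm \<xi>)\<^sup>2) powr \<sigma>) * fourier (\<lambda>x. \<phi> (x /\<^sub>R h)) \<xi>) x =
     inv_fourier (\<lambda>\<xi>. complex_of_real ((1 + (norm \<xi>)\<^sup>2) powr \<sigma>) * fourier \<phi> \<xi>) (x /\<^sub>R h)"
proof -
  define G where "G = (\<lambda>\<xi>. complex_of_real ((1 + (norm \<xi>)\<^sup>2) powr \<sigma>) * fourier \<phi> \<xi>)"
  have "fourier (\<lambda>x. \<phi> (x /\<^sub>R h)) \<xi> = complex_of_real (h ^ CARD('n)) * fourier \<phi> (h *\<^sub>R \<xi>)" for \<xi>
    using fourier_dilate[of "inverse h" \<phi> \<xi>] h by (simp add: power_inverse divide_inverse)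
  hence "(\<lambda>\<xi>. complex_of_real ((1 + h\<^sup>2 * (norm \<xi>)\<^sup>2) powr \<sigma>) * fourier (\<lambda>x. \<phi> (x /\<^sub>R h)) \<xi>) =
     (\<lambda>\<xi>. complex_of_real (h ^ CARD('n)) * G (h *\<^sub>R \<xi>))"
    by (simp add: G_def power_mult_distrib mult_ac)
  thus ?thesis
    unfolding inv_fourier_eq G_def[symmetric] using h by (simp add: fourier_cmult fourier_dilate[of h G])
qed

lemma recovery_lower_bound:
  fixes p s :: real and \<alpha> :: "nat ^ 'n::finite"
  assumes p: "1 < p" and s: "0 < s"
  obtains c where "c > 0" "\<forall>E \<delta>. 0 < \<delta> \<and> \<delta> < E \<longrightarrow>
    (\<exists>f. (f, \<lambda>_. 0) \<in> recovery_data p s E \<delta> \<and> ennreal (c * recovery_rate \<alpha> s E \<delta>) \<le> distr_Lp_norm p (distr_partial \<alpha> f))"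
proof -
  let ?L = "mi_size \<alpha>" and ?ds = "mi_dirs \<alpha>" and ?n = "real CARD('n)"
  define q where "q = p / (p - 1)"
  have pq: "p > 1" "q > 1" "1 / p + 1 / q = 1"
    using p by (auto simp: q_def field_simps)
  hence qp: "q > 1" "p > 1" "1 / q + 1 / p = 1"
    by auto
  \<comment> \<open>Chosen so that its pairing with the \<alpha>-derivative of the Gaussian is the
    nonzero integral of \<open>deriv_gauss_pairing_nonzero\<close>.\<close>
  define \<phi> :: "'n cfun" where "\<phi> = inv_fourier (\<lambda>\<xi>. deriv_symbol ?ds \<xi> * gauss \<xi>)"
  have \<phi>: "\<phi> \<in> schwartz"
    unfolding \<phi>_def by (intro inv_fourier_schwartz deriv_gauss_pairing_nonzero)
  define \<kappa> where "\<kappa> = (LINT x|lborel. \<phi> x * iter_partial ?ds gauss x)"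
  have \<kappa>: "norm \<kappa> > 0"
    using deriv_gauss_pairing_nonzero(2)[of ?ds] by (simp add: \<kappa>_def \<phi>_def)
  let ?x = "\<lambda>\<xi>::real^'n. complex_of_real ((1 + (norm \<xi>)\<^sup>2) powr (s / 2))"
  define \<Psi> where "\<Psi> = inv_fourier (\<lambda>\<xi>. ?x \<xi> * fourier \<phi> \<xi>)"
  have \<Psi>: "\<Psi> \<in> schwartz"
    unfolding \<Psi>_def using schwartz_powr_mult[OF fourier_schwartz[OF \<phi>], of 1 1] by (intro inv_fourier_schwartz) simp
  define B where "B = (\<Sum>k. \<bar>(s / 2) gchoose k\<bar>)"
  have B: "B \<ge> 0"
    unfolding B_def using s by (intro suminf_nonneg summable_abs_gbinomial) auto
  \<comment> \<open>Collects both constraints on the bump, the L^p bound and the Bessel bound, where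
    2B is the norm of the multiplier operator; the summand 1 keeps it positive.\<close>
  define M where "M = Lp_norm p \<phi> + 2 * B * Lp_norm p \<Psi> + 1"
  have M: "M > 0" "Lp_norm p \<phi> \<le> M" "2 * B * Lp_norm p \<Psi> \<le> M"
    using B by (auto simp: M_def Lp_norm_def add_nonneg_pos)
  define G where "G = Lp_norm q (gauss :: 'n cfun) + 1"
  have G: "G > 0" "Lp_norm q (gauss :: 'n cfun) \<le> G"
    by (auto simp: G_def Lp_norm_def add_nonneg_pos)
  show ?thesis
  \<comment> \<open>The unscaled pairing, divided by the cost \<open>M\<close> of admissibility and
    the cost \<open>G\<close> of testing against a Gaussian.\<close>
  proof (rule that[of "norm \<kappa> / (M * G)"]; (intro allI impI)?)
    show "norm \<kappa> / (M * G) > 0"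
      using \<kappa> M G by simp
    fix E \<delta> :: real assume E\<delta>: "0 < \<delta> \<and> \<delta> < E"
    let ?K = "recovery_rate \<alpha> s E \<delta>"
    define h where "h = (\<delta> / E) powr (1 / s)"
    note h = scale_identities[OF conjunct1[OF E\<delta>] conjunct2[OF E\<delta>] s, folded h_def]
    \<comment> \<open>Dilation by h multiplies the L^p norm by h^(n/p); this height cancels that
      factor and leaves at most \<delta>.\<close>
    define l where "l = \<delta> * h powr (- ?n / p) / M"
    have l: "l > 0"
      using E\<delta> h(1) M by (simp add: l_def)
    have lh: "l * h powr (?n / p) = \<delta> / M"
      unfolding l_def using h(1) by (simp add: powr_add[symmetric])
    define f1 where "f1 = (\<lambda>x. \<phi> (x /\<^sub>R h))"
    have f1: "f1 \<in> schwartz"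
      unfolding f1_def using h(1) by (intro schwartz_dilate \<phi>) auto
    define f0 where "f0 = (\<lambda>x. complex_of_real l * f1 x)"
    have f0: "f0 \<in> schwartz"
      unfolding f0_def by (intro schwartz_cmult f1)
    note f0_Lp = schwartz_Lp[OF pq f0]
    have "Lp_norm p f0 = l * (h powr (?n / p) * Lp_norm p \<phi>)"
      unfolding f0_def f1_def using l
      by (simp add: Lp_cmult(2)[OF pq Lp_dilate(1)[OF pq schwartz_Lp[OF pq \<phi>] h(1)]] Lp_dilate(2)[OF pq schwartz_Lp[OF pq \<phi>] h(1)])
    also have "\<dots> = \<delta> * (Lp_norm p \<phi> / M)"
      using lh by (simp add: mult.assoc[symmetric])
    also have "\<dots> \<le> \<delta> * 1"
      using M E\<delta> by (intro mult_left_mono) auto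
    finally have f0_norm: "Lp_norm p f0 \<le> \<delta>" by simp
    \<comment> \<open>The weight at scale h applied to \<open>f1\<close>, by the scaling rule
      \<open>inv_fourier_mult_dilate\<close>; its norm is that of \<Psi> times h^(n/p).\<close>
    define \<Psi>1 where "\<Psi>1 = (\<lambda>x. \<Psi> (x /\<^sub>R h))"
    have \<Psi>1: "\<Psi>1 \<in> schwartz"
      unfolding \<Psi>1_def using h(1) by (intro schwartz_dilate \<Psi>) auto
    note \<Psi>1_Lp = schwartz_Lp[OF pq \<Psi>1]
    let ?Y = "\<lambda>\<xi>::real^'n. complex_of_real ((1 + h\<^sup>2 * (norm \<xi>)\<^sup>2) powr (s / 2))"
    let ?m = "\<lambda>\<xi>::real^'n. complex_of_real ((1 - resolvent_symbol h \<xi>) powr (s / 2))"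
    have \<Psi>1_hat: "fourier \<Psi>1 = (\<lambda>\<xi>. ?Y \<xi> * fourier f1 \<xi>)"
    proof -
      have "\<Psi>1 = inv_fourier (\<lambda>\<xi>. ?Y \<xi> * fourier f1 \<xi>)"
        unfolding \<Psi>1_def \<Psi>_def f1_def inv_fourier_mult_dilate[OF h(1), symmetric] by simp
      moreover have "(\<lambda>\<xi>. ?Y \<xi> * fourier f1 \<xi>) \<in> schwartz"
        using h(1) by (intro schwartz_powr_mult fourier_schwartz f1) auto
      ultimately show ?thesis
        by (simp add: fourier_inv_fourier)
    qed
    \<comment> \<open>Hence the Bessel derivative of \<open>f1\<close> is h^(-s) times the operator
      with symbol \<open>?m\<close> applied to \<open>\<Psi>1\<close>, which dictates
      \<open>w\<close> below.\<close>
    have mY: "?m \<xi> * ?Y \<xi> = complex_of_real (h powr s) * ?x \<xi>" for \<xi>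
    proof -
      have "1 + h\<^sup>2 * (norm \<xi>)\<^sup>2 > 0"
        by (intro add_pos_nonneg) auto
      hence "(1 + h\<^sup>2 * (norm \<xi>)\<^sup>2) powr (- (s / 2)) * (1 + h\<^sup>2 * (norm \<xi>)\<^sup>2) powr (s / 2) = 1"
        by (simp add: powr_add[symmetric])
      hence "(1 - resolvent_symbol h \<xi>) powr (s / 2) * (1 + h\<^sup>2 * (norm \<xi>)\<^sup>2) powr (s / 2) = h powr s * (1 + (norm \<xi>)\<^sup>2) powr (s / 2)"
        unfolding one_minus_resolvent_symbol_powr[OF h(1,2)] by (simp add: mult.assoc)
      thus ?thesis
        unfolding of_real_mult[symmetric] by simp
    qed
    have Lm: "L1_multiplier B ?m"
      unfolding B_def using s by (intro L1_multiplier_one_minus_resolvent_powr h) auto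
    have sm: "schwartz_multiplier ?m"
      by (intro schwartz_multiplier_one_minus_resolvent_powr h)
    obtain T where T: "Lp_multiplier_operator p B ?m T"
      by (rule L1_multiplier_operator[OF pq Lm])
    define w where "w = (\<lambda>x. complex_of_real (l * h powr (- s)) * T \<Psi>1 x)"
    note T\<Psi> = Lp_multiplier_operatorD(2,3)[OF T \<Psi>1_Lp]
    have w: "w \<in> Lp p" "Lp_norm p w = l * h powr (- s) * Lp_norm p (T \<Psi>1)"
    proof -
      have "norm (complex_of_real (l * h powr (- s))) = l * h powr (- s)"
        unfolding norm_of_real using l by simp
      thus "w \<in> Lp p" "Lp_norm p w = l * h powr (- s) * Lp_norm p (T \<Psi>1)"
        unfolding w_def using Lp_cmult[OF pq T\<Psi>(1), of "complex_of_real (l * h powr (- s))"] by simp_all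
    qed
    have "Lp_norm p w \<le> l * h powr (- s) * (2 * B * (h powr (?n / p) * Lp_norm p \<Psi>))"
      unfolding w(2) using T\<Psi> l Lp_dilate(2)[OF pq schwartz_Lp[OF pq \<Psi>] h(1)]
      by (intro mult_left_mono) (auto simp: \<Psi>1_def)
    also have "\<dots> = (l * h powr (?n / p)) * h powr (- s) * (2 * B * Lp_norm p \<Psi>)"
      by simp
    also have "\<dots> = (h powr (- s) * \<delta>) * (2 * B * Lp_norm p \<Psi> / M)"
      unfolding lh by simp
    also have "\<dots> \<le> E * 1"
      unfolding h(3) using M E\<delta> by (intro mult_left_mono) auto
    finally have w_norm: "Lp_norm p w \<le> E" by simp
    have w_rep: "represents w (bessel_op s (distr_of f0))"
      unfolding represents_def
    proof
      fix \<psi> :: "'n cfun" assume \<psi>: "\<psi> \<in> schwartz"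
      define u where "u = inv_fourier \<psi>"
      have u: "u \<in> schwartz" unfolding u_def by (rule inv_fourier_schwartz[OF \<psi>])
      have mu: "(\<lambda>\<xi>. ?m \<xi> * u \<xi>) \<in> schwartz"
        by (rule schwartz_multiplierD[OF sm u])
      have xu: "(\<lambda>\<xi>. ?x \<xi> * u \<xi>) \<in> schwartz"
        using schwartz_powr_mult[OF u, of 1 1] by simp
      have "(LINT x|lborel. T \<Psi>1 x * \<psi> x) = (LINT x|lborel. \<Psi>1 x * fourier (\<lambda>\<xi>. ?m \<xi> * u \<xi>) x)"
        unfolding u_def by (rule Lp_multiplier_operatorD(4)[OF T \<Psi>1_Lp \<psi>])
      also have "\<dots> = (LINT \<xi>|lborel. fourier \<Psi>1 \<xi> * (?m \<xi> * u \<xi>))"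
        by (rule fourier_mult_formula[OF schwartz_integrable[OF \<Psi>1] schwartz_integrable[OF mu], symmetric])
      also have "\<dots> = (LINT \<xi>|lborel. complex_of_real (h powr s) * (fourier f1 \<xi> * (?x \<xi> * u \<xi>)))"
      proof (intro Bochner_Integration.integral_cong refl)
        fix \<xi>
        have "fourier \<Psi>1 \<xi> * (?m \<xi> * u \<xi>) = (?m \<xi> * ?Y \<xi>) * (fourier f1 \<xi> * u \<xi>)"
          unfolding \<Psi>1_hat by (simp only: mult_ac)
        thus "fourier \<Psi>1 \<xi> * (?m \<xi> * u \<xi>) = complex_of_real (h powr s) * (fourier f1 \<xi> * (?x \<xi> * u \<xi>))"
          unfolding mY by (simp only: mult_ac)
      qed
      also have "\<dots> = complex_of_real (h powr s) * (LINT \<xi>|lborel. fourier f1 \<xi> * (?x \<xi> * u \<xi>))"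
        by simp
      also have "(LINT \<xi>|lborel. fourier f1 \<xi> * (?x \<xi> * u \<xi>)) = (LINT x|lborel. f1 x * fourier (\<lambda>\<xi>. ?x \<xi> * u \<xi>) x)"
        by (rule fourier_mult_formula[OF schwartz_integrable[OF f1] schwartz_integrable[OF xu]])
      finally have eq: "(LINT x|lborel. T \<Psi>1 x * \<psi> x) = complex_of_real (h powr s) * (LINT x|lborel. f1 x * fourier (\<lambda>\<xi>. ?x \<xi> * u \<xi>) x)" .
      have "distr_of w \<psi> = complex_of_real (l * h powr (- s)) * (LINT x|lborel. T \<Psi>1 x * \<psi> x)"
        unfolding distr_of_def w_def by (simp add: mult.assoc)
      also have "\<dots> = complex_of_real (l * (h powr (- s) * h powr s)) * (LINT x|lborel. f1 x * fourier (\<lambda>\<xi>. ?x \<xi> * u \<xi>) x)"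
        unfolding eq by simp
      also have "h powr (- s) * h powr s = 1"
        using h(1) by (simp add: powr_add[symmetric])
      also have "complex_of_real (l * 1) * (LINT x|lborel. f1 x * fourier (\<lambda>\<xi>. ?x \<xi> * u \<xi>) x) = bessel_op s (distr_of f0) \<psi>"
        unfolding bessel_op_apply distr_of_def f0_def u_def by (simp add: mult.assoc)
      finally show "bessel_op s (distr_of f0) \<psi> = distr_of w \<psi>" by simp
    qed
    have "(\<lambda>_. 0) \<in> (Lp p :: 'n cfun set)"
      by (auto simp: Lp_def)
    moreover have "distr_of f0 \<in> bessel_space s p"
      unfolding bessel_space_def using tempered_distr_of_schwartz[OF f0] w(1) w_rep by blast
    moreover have "bessel_norm s p (distr_of f0) \<le> ennreal E"
      unfolding bessel_norm_def by (rule distr_Lp_norm_leI[OF w(1) w_rep w_norm])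
    moreover have "distr_Lp_norm p (distr_diff (distr_of f0) (distr_of (\<lambda>_. 0))) \<le> ennreal \<delta>"
      by (rule distr_Lp_norm_leI[OF f0_Lp _ f0_norm]) (simp add: represents_def distr_diff_def distr_of_def)
    moreover have "ennreal (norm \<kappa> / (M * G) * ?K) \<le> distr_Lp_norm p (distr_partial \<alpha> (distr_of f0))"
      unfolding distr_Lp_norm_def
    proof (intro INF_greatest ennreal_leI)
      fix g assume "g \<in> {g \<in> Lp p. represents g (distr_partial \<alpha> (distr_of f0))}"
      hence g: "g \<in> Lp p" and rep: "represents g (distr_partial \<alpha> (distr_of f0))"
        by auto
      \<comment> \<open>The test function has the width of the bump, so the pairing reduces to
        \<kappa> by scaling.\<close>
      define \<psi> :: "'n cfun" where "\<psi> = (\<lambda>x. gauss (x /\<^sub>R h))"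
      have \<psi>: "\<psi> \<in> schwartz"
        unfolding \<psi>_def using h(1) by (intro schwartz_dilate gauss_schwartz) auto
      have "mi_partial \<alpha> \<psi> = (\<lambda>x. complex_of_real (inverse h ^ ?L) * iter_partial ?ds gauss (x /\<^sub>R h))"
        unfolding mi_partial_def \<psi>_def using iter_partial_dilate[OF gauss_schwartz, of ?ds "inverse h"]
        by (simp add: length_mi_dirs)
      hence "distr_of f0 (mi_partial \<alpha> \<psi>) = (LINT x|lborel. complex_of_real (l * inverse h ^ ?L) * (\<phi> (x /\<^sub>R h) * iter_partial ?ds gauss (x /\<^sub>R h)))"
        by (simp add: distr_of_def f0_def f1_def mult_ac)
      also have "\<dots> = complex_of_real (l * inverse h ^ ?L) * (LINT x|lborel. \<phi> (x /\<^sub>R h) * iter_partial ?ds gauss (x /\<^sub>R h))"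
        by simp
      also have "(LINT x|lborel. \<phi> (x /\<^sub>R h) * iter_partial ?ds gauss (x /\<^sub>R h)) = (h ^ CARD('n)) *\<^sub>R \<kappa>"
        unfolding \<kappa>_def using h(1) by (subst integral_lborel_affine[of h _ 0]) auto
      finally have "norm (distr_of f0 (mi_partial \<alpha> \<psi>)) = l * inverse h ^ ?L * (h ^ CARD('n) * norm \<kappa>)"
        using l h(1) by (simp add: norm_mult norm_power abs_mult norm_inverse power_inverse)
      also have "inverse h ^ ?L = h powr (- real ?L)"
        using h(1) by (simp add: powr_minus powr_realpow power_inverse)
      \<comment> \<open>The volume factor splits over the conjugate exponents: h^(n/p) is absorbed
        by the height l, and h^(n/q) cancels against the L^q norm of the test Gaussian.\<close>
      also have "h ^ CARD('n) = h powr (?n / p) * h powr (?n / q)"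
      proof -
        have "?n / p + ?n / q = ?n * (1 / p + 1 / q)"
          by (simp add: algebra_simps)
        thus ?thesis
          using h(1) pq by (simp add: powr_add[symmetric] powr_realpow)
      qed
      also have "l * h powr (- real ?L) * (h powr (?n / p) * h powr (?n / q) * norm \<kappa>) = 
         (l * h powr (?n / p)) * h powr (- real ?L) * (h powr (?n / q) * norm \<kappa>)"
        by simp
      also have "\<dots> = (h powr (- real ?L) * \<delta>) / M * (h powr (?n / q) * norm \<kappa>)"
        unfolding lh by simp
      also have "\<dots> = ?K / M * (h powr (?n / q) * norm \<kappa>)"
        unfolding h(4) recovery_rate_def ..
      finally have 1: "norm (distr_of f0 (mi_partial \<alpha> \<psi>)) = ?K / M * (h powr (?n / q) * norm \<kappa>)" .
      have "distr_of g \<psi> = (- 1) ^ ?L * distr_of f0 (mi_partial \<alpha> \<psi>)"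
        using rep \<psi> unfolding represents_def distr_partial_def by metis
      hence "norm (distr_of f0 (mi_partial \<alpha> \<psi>)) = norm (distr_of g \<psi>)"
        by (simp add: norm_mult norm_power)
      also have "\<dots> \<le> (LINT x|lborel. norm (g x * \<psi> x))"
        unfolding distr_of_def by (rule integral_norm_bound)
      also have "\<dots> = (LINT x|lborel. norm (g x) * norm (\<psi> x))"
        by (simp add: norm_mult)
      also have "\<dots> \<le> Lp_norm p g * Lp_norm q \<psi>"
        using pq by (intro Lp_Holder[OF pq g] schwartz_measurable schwartz_powr_integrable \<psi>) auto
      also have "Lp_norm q \<psi> = h powr (?n / q) * Lp_norm q (gauss :: 'n cfun)"
        unfolding \<psi>_def by (rule Lp_dilate(2)[OF qp schwartz_Lp[OF qp gauss_schwartz] h(1)])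
      also have "Lp_norm p g * (h powr (?n / q) * Lp_norm q (gauss :: 'n cfun)) \<le> Lp_norm p g * (h powr (?n / q) * G)"
        using G by (intro mult_left_mono) (auto simp: Lp_norm_def)
      finally have "h powr (?n / q) * (?K / M * norm \<kappa>) \<le> h powr (?n / q) * (Lp_norm p g * G)"
        unfolding 1 by (simp add: mult_ac)
      hence "?K / M * norm \<kappa> \<le> Lp_norm p g * G"
        using h(1) by (simp only: mult_le_cancel_left_pos powr_gt_zero less_imp_neq[symmetric] not_False_eq_True)
      hence "?K / M * norm \<kappa> / G \<le> Lp_norm p g"
        using G(1) by (subst pos_divide_le_eq)
      thus "norm \<kappa> / (M * G) * ?K \<le> Lp_norm p g"
        by (simp add: mult_ac)
    qed
    ultimately show "\<exists>f. (f, \<lambda>_. 0) \<in> recovery_data p s E \<delta> \<and>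
       ennreal (norm \<kappa> / (M * G) * ?K) \<le> distr_Lp_norm p (distr_partial \<alpha> f)"
      by (intro exI[of _ "distr_of f0"]) (simp add: recovery_data_def)
  qed
qed

section \<open>Combination of the two bounds\<close>

theorem mainTheorem3:
  fixes p s :: real and \<alpha> :: "nat ^ 'n::finite"
  assumes "1 < p" and "0 < s" and "real (mi_size \<alpha>) < s"
  shows "\<exists>c C :: real. 0 < c \<and> c \<le> C \<and>
    (\<forall>E \<delta> :: real. 0 < E \<and> 0 < \<delta> \<and> \<delta> < E \<longrightarrow>
      (let a = real (mi_size \<alpha>) / s;
           err = (INF A\<in>{A \<in> Lp_maps p. AE x in lborel. A (\<lambda>_. 0) x = 0}.
                   SUP (f, f\<^sub>\<delta>)\<in>{(f, f\<^sub>\<delta>). f \<in> bessel_space s p \<and> f\<^sub>\<delta> \<in> Lp p \<and>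
                                    bessel_norm s p f \<le> ennreal E \<and>
                                    distr_Lp_norm p (distr_diff f (distr_of f\<^sub>\<delta>)) \<le> ennreal \<delta>}.
                     distr_Lp_norm p (distr_diff (distr_partial \<alpha> f) (distr_of (A f\<^sub>\<delta>))))
       in ennreal (c * E powr a * \<delta> powr (1 - a)) \<le> err \<and>
          err \<le> ennreal (C * E powr a * \<delta> powr (1 - a))))"
proof -
  let ?K = "recovery_rate \<alpha> s"
  let ?e = "\<lambda>A (f, f\<^sub>\<delta>). distr_Lp_norm p (distr_diff (distr_partial \<alpha> f) (distr_of (A f\<^sub>\<delta>)))"
  let ?err = "\<lambda>E \<delta>. INF A\<in>{A \<in> Lp_maps p. AE x in lborel. A (\<lambda>_. 0) x = 0}. SUP z\<in>recovery_data p s E \<delta>. ?e A z"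
  obtain C where C: "C > 0" and upper: "\<forall>E \<delta>. 0 < \<delta> \<and> \<delta> < E \<longrightarrow> (\<exists>A\<in>Lp_maps p. (\<forall>x. A (\<lambda>_. 0) x = 0) \<and>
      (\<forall>(f, f\<^sub>\<delta>)\<in>recovery_data p s E \<delta>. ?e A (f, f\<^sub>\<delta>) \<le> ennreal (C * ?K E \<delta>)))"
    using recovery_upper_bound[OF assms] by auto
  obtain c where c: "c > 0" and lower: "\<forall>E \<delta>. 0 < \<delta> \<and> \<delta> < E \<longrightarrow>
      (\<exists>f. (f, \<lambda>_. 0) \<in> recovery_data p s E \<delta> \<and> ennreal (c * ?K E \<delta>) \<le> distr_Lp_norm p (distr_partial \<alpha> f))"
    using assms(1,2) by (rule recovery_lower_bound)
  \<comment> \<open>The maximum guarantees that the upper constant is at least the lower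
    one.\<close>
  have main: "ennreal (c * ?K E \<delta>) \<le> ?err E \<delta> \<and> ?err E \<delta> \<le> ennreal (max c C * ?K E \<delta>)"
    if E\<delta>: "0 < \<delta> \<and> \<delta> < E" for E \<delta>
  proof
    obtain f where f: "(f, \<lambda>_. 0) \<in> recovery_data p s E \<delta>" "ennreal (c * ?K E \<delta>) \<le> distr_Lp_norm p (distr_partial \<alpha> f)"
      using lower E\<delta> by blast
    show "ennreal (c * ?K E \<delta>) \<le> ?err E \<delta>"
    proof (rule INF_greatest)
      fix A :: "'n cfun \<Rightarrow> 'n cfun" assume "A \<in> {A \<in> Lp_maps p. AE x in lborel. A (\<lambda>_. 0) x = 0}"
      hence "AE x in lborel. A (\<lambda>_. 0) x = 0"
        by auto
      hence "AE x in lborel. A (\<lambda>_. 0) x * \<psi> x = 0" for \<psi> :: "'n cfun"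
        by eventually_elim simp
      \<comment> \<open>A vanishes on zero data only almost everywhere, which is all that a pairing
        with test functions detects.\<close>
      hence "distr_of (A (\<lambda>_. 0)) \<psi> = 0" for \<psi>
        unfolding distr_of_def by (rule integral_eq_zero_AE)
      hence "distr_diff (distr_partial \<alpha> f) (distr_of (A (\<lambda>_. 0))) = distr_partial \<alpha> f"
        by (simp add: distr_diff_def fun_eq_iff)
      thus "ennreal (c * ?K E \<delta>) \<le> (SUP z\<in>recovery_data p s E \<delta>. ?e A z)"
        using f by (intro SUP_upper2[of "(f, \<lambda>_. 0)"]) auto
    qed
    obtain A where A: "A \<in> Lp_maps p" "\<forall>x. A (\<lambda>_. 0) x = 0" and
      A_le: "\<forall>(f, f\<^sub>\<delta>)\<in>recovery_data p s E \<delta>. ?e A (f, f\<^sub>\<delta>) \<le> ennreal (C * ?K E \<delta>)"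
      using upper E\<delta> by blast
    have "(SUP z\<in>recovery_data p s E \<delta>. ?e A z) \<le> ennreal (C * ?K E \<delta>)"
      using A_le by (intro SUP_least) auto
    also have "\<dots> \<le> ennreal (max c C * ?K E \<delta>)"
      by (intro ennreal_leI mult_right_mono) (auto simp: recovery_rate_def)
    finally show "?err E \<delta> \<le> ennreal (max c C * ?K E \<delta>)"
      using A by (intro INF_lower2[of A]) auto
  qed
  show ?thesis
    unfolding Let_def using c main
    by (intro exI[of _ c] exI[of _ "max c C"] conjI allI impI)
       (auto simp: recovery_data_def recovery_rate_def mult.assoc)
qed

end
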